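(* Let $f$ be an inner function with $f(0)=0$ which is not a rotation and let $\{a_{n}\}_{n\ge1}$ be a sequence of complex numbers. Assume $\sum^{\infty}_{n=1}|a_{n}|^{2}<\infty$. (a) Then $F=\sum_{n=1}^{\infty} a_{n}f^{n}\in \mathrm{BMOA}(\mathbb{D})$ and for almost every $\xi\in\partial\mathbb{D}$ we have $$ \lim_{r\to 1}F(r\xi)=\sum^{\infty}_{n=1}a_{n}f^{n}(\xi). $$ Moreover there exists a constant $C=C(f)>0$, depending only on $f$ (not on the sequence $\{a_n\}$), such that $$ C^{-1} \sum^{\infty}_{n=1}|a_{n}|^{2} \le \|F\|^{2}_{\mathrm{BMOA}(\mathbb{D})}\le C\sum^{\infty}_{n=1}|a_{n}|^{2}. $$ (b) If $f$ is a finite Blaschke product, then $F=\sum^{\infty}_{n=1}a_{n}f^{n}\in\mathrm{VMOA}$.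
   Context: $\mathbb{D}$ is the open unit disc and $\partial\mathbb{D}$ the unit circle; $m$ is normalized Lebesgue measure on $\partial\mathbb{D}$. $P(z,\xi)=(1-|z|^{2})|\xi-z|^{-2}$ is the Poisson kernel. An inner function is an analytic mapping $f:\mathbb{D}\to\mathbb{D}$ whose radial limits have modulus one at almost every point of $\partial\mathbb{D}$. A rotation is a map $z\mapsto \lambda z$ with $|\lambda|=1$. $f^{n}$ denotes the $n$-th iterate of $f$ (not the power), and for almost every $\xi\in\partial\mathbb{D}$, $f^{n}(\xi)=\lim_{r\to1^-}f^{n}(r\xi)$. When $\sum|a_n|^2<\infty$, the series $\sum a_nf^n$ converges in the Hardy space $\mathbb{H}^2(\mathbb{D})$ (hence uniformly on compact subsets of $\mathbb{D}$), and $F$ denotes its sum. $\mathrm{BMOA}(\mathbb{D})$ is the space of analytic functions $F$ in $\mathbb{D}$ (with boundary values $F(\xi)$, the non-tangential limits, for almost every $\xi$) such that $$\|F\|^{2}_{\mathrm{BMOA}(\mathbb{D})}=\sup_{z\in \mathbb{D}} \int_{\partial\mathbb{D}} |F(\xi)-F(z)|^{2} P(z,\xi)\,dm(\xi)<\infty.$$ $\mathrm{VMOA}$ is the subspace of those $F\in\mathrm{BMOA}(\mathbb{D})$ for which the integral above tends to $0$ as $|z|\to1$. *)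

theory Defs
  imports "HOL-Complex_Analysis.Complex_Analysis" "HOL-Probability.Probability"
begin

section \<open>The unit circle and boundary values\<close>

definition circle_measure :: "complex measure" where
  "circle_measure =
     distr (uniform_measure lborel {0..2*pi}) (restrict_space borel (sphere 0 1)) cis"

definition poisson_kernel :: "complex \<Rightarrow> complex \<Rightarrow> real" where
  "poisson_kernel z \<xi> = (1 - (cmod z)\<^sup>2) / (cmod (\<xi> - z))\<^sup>2"

definition has_radial_limit :: "(complex \<Rightarrow> complex) \<Rightarrow> complex \<Rightarrow> complex \<Rightarrow> bool" where
  "has_radial_limit g \<xi> l \<longleftrightarrow> ((\<lambda>r::real. g (of_real r * \<xi>)) \<longlongrightarrow> l) (at_left 1)"

definition stolz_region :: "real \<Rightarrow> complex \<Rightarrow> complex set" where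
  "stolz_region \<alpha> \<xi> = {z \<in> ball 0 1. cmod (z - \<xi>) < \<alpha> * (1 - cmod z)}"

definition has_nontangential_limit :: "(complex \<Rightarrow> complex) \<Rightarrow> complex \<Rightarrow> complex \<Rightarrow> bool" where
  "has_nontangential_limit g \<xi> l \<longleftrightarrow> (\<forall>\<alpha>>1. (g \<longlongrightarrow> l) (at \<xi> within stolz_region \<alpha> \<xi>))"

text \<open>
  The boundary value is meaningful only where the non-tangential limit exists; everything below
  that uses it also requires existence almost everywhere.
\<close>

definition boundary_value :: "(complex \<Rightarrow> complex) \<Rightarrow> complex \<Rightarrow> complex" where
  "boundary_value g \<xi> = (THE l. has_nontangential_limit g \<xi> l)"

lemma prob_space_circle_measure: "prob_space circle_measure"
proof -
  interpret prob_space "uniform_measure lborel {0..2*pi::real}"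
    by (rule prob_space_uniform_measure) auto
  have "cis \<in> borel_measurable borel"
    by (intro borel_measurable_continuous_onI continuous_intros)
  then have "cis \<in> measurable (uniform_measure lborel {0..2*pi}) (restrict_space borel (sphere 0 1))"
    by (intro measurable_restrict_space2) auto
  then show ?thesis
    unfolding circle_measure_def by (rule prob_space_distr)
qed

lemma boundary_value_eq:
  assumes "cmod \<xi> = 1" and "has_nontangential_limit g \<xi> l"
  shows "boundary_value g \<xi> = l"
proof -
  have r: "LIM r (at_left (1::real)). of_real r * \<xi> :> at \<xi> within stolz_region 2 \<xi>"
    unfolding filterlim_at
  proof
    show "((\<lambda>r. of_real r * \<xi>) \<longlongrightarrow> \<xi>) (at_left (1::real))"
      by (rule tendsto_eq_intros refl | simp)+
    have "eventually (\<lambda>r. r \<in> {0<..<1::real}) (at_left 1)"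
      by (rule eventually_at_left_real) simp
    then show "\<forall>\<^sub>F r in at_left (1::real). of_real r * \<xi> \<in> stolz_region 2 \<xi> \<and> of_real r * \<xi> \<noteq> \<xi>"
    proof eventually_elim
      case (elim r)
      have "of_real r * \<xi> - \<xi> = of_real (r - 1) * \<xi>"
        by (simp add: algebra_simps)
      then have "cmod (of_real r * \<xi> - \<xi>) = 1 - r"
        using elim assms(1) by (simp only: norm_mult norm_of_real) simp
      moreover have "cmod (of_real r * \<xi>) = r"
        using elim assms(1) by (simp add: norm_mult)
      ultimately show ?case
        using elim by (auto simp: stolz_region_def)
    qed
  qed
  have lim: "((\<lambda>r. g (of_real r * \<xi>)) \<longlongrightarrow> l') (at_left (1::real))"
    if "has_nontangential_limit g \<xi> l'" for l'
  proof -
    have "(g \<longlongrightarrow> l') (at \<xi> within stolz_region 2 \<xi>)"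
      using that unfolding has_nontangential_limit_def by simp
    then show ?thesis
      using r by (rule filterlim_compose)
  qed
  show ?thesis
    unfolding boundary_value_def
    using assms(2) tendsto_unique[OF _ lim lim] by (intro the_equality) auto
qed


section \<open>Function spaces on the disc\<close>

text \<open>
  Square integrals are taken in \<^typ>\<open>ennreal\<close>, so that divergence is visible as \<open>\<infinity>\<close>.  Functions
  on the disc are total functions on \<open>\<complex>\<close> whose values outside the disc are irrelevant.
\<close>

definition hardy2_norm_sq :: "(complex \<Rightarrow> complex) \<Rightarrow> ennreal" where
  "hardy2_norm_sq g =
     (SUP r\<in>{0<..<1::real}. \<integral>\<^sup>+\<xi>. ennreal ((cmod (g (of_real r * \<xi>)))\<^sup>2) \<partial>circle_measure)"

definition hardy2 :: "(complex \<Rightarrow> complex) set" where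
  "hardy2 = {g. g holomorphic_on ball 0 1 \<and> hardy2_norm_sq g < \<infinity>}"

definition hardy2_sums ::
    "(nat \<Rightarrow> complex \<Rightarrow> complex) \<Rightarrow> (complex \<Rightarrow> complex) \<Rightarrow> bool" where
  "hardy2_sums u F \<longleftrightarrow> F \<in> hardy2 \<and> (\<forall>n. u n \<in> hardy2) \<and>
     (\<lambda>N. hardy2_norm_sq (\<lambda>z. F z - (\<Sum>n<N. u n z))) \<longlonglongrightarrow> 0"

definition bmo_integral :: "(complex \<Rightarrow> complex) \<Rightarrow> complex \<Rightarrow> ennreal" where
  "bmo_integral F z =
     (\<integral>\<^sup>+\<xi>. ennreal ((cmod (boundary_value F \<xi> - F z))\<^sup>2 * poisson_kernel z \<xi>) \<partial>circle_measure)"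

definition BMOA :: "(complex \<Rightarrow> complex) set" where
  "BMOA = {F. F holomorphic_on ball 0 1 \<and>
              (AE \<xi> in circle_measure. \<exists>l. has_nontangential_limit F \<xi> l) \<and>
              (SUP z\<in>ball 0 1. bmo_integral F z) < \<infinity>}"

text \<open>The value is only meaningful on \<^term>\<open>BMOA\<close>, where the supremum is finite.\<close>

definition bmoa_norm :: "(complex \<Rightarrow> complex) \<Rightarrow> real" where
  "bmoa_norm F = sqrt (enn2real (SUP z\<in>ball 0 1. bmo_integral F z))"

definition VMOA :: "(complex \<Rightarrow> complex) set" where
  "VMOA = {F \<in> BMOA. (bmo_integral F \<longlongrightarrow> 0) (filtercomap cmod (at_left 1))}"


section \<open>Inner functions and series of iterates\<close>

definition inner_function :: "(complex \<Rightarrow> complex) \<Rightarrow> bool" where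
  "inner_function f \<longleftrightarrow> f holomorphic_on ball 0 1 \<and> f ` ball 0 1 \<subseteq> ball 0 1 \<and>
     (AE \<xi> in circle_measure. \<exists>l. has_radial_limit f \<xi> l \<and> cmod l = 1)"

definition is_rotation :: "(complex \<Rightarrow> complex) \<Rightarrow> bool" where
  "is_rotation f \<longleftrightarrow> (\<exists>c. cmod c = 1 \<and> (\<forall>z\<in>ball 0 1. f z = c * z))"

text \<open>The list enumerates the zeros with multiplicity.\<close>

definition finite_blaschke_product :: "(complex \<Rightarrow> complex) \<Rightarrow> bool" where
  "finite_blaschke_product f \<longleftrightarrow> (\<exists>c ps. cmod c = 1 \<and> set ps \<subseteq> ball 0 1 \<and>
     (\<forall>z\<in>ball 0 1. f z = c * (\<Prod>p\<leftarrow>ps. (z - p) / (1 - cnj p * z))))"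

text \<open>
  Sequences are indexed by \<open>n \<ge> 1\<close>: the term with index \<open>n\<close> below is \<open>a\<^sub>n\<^sub>+\<^sub>1 f\<^sup>n\<^sup>+\<^sup>1\<close>, and \<open>a 0\<close> plays
  no role.
\<close>

definition iterate_term :: "(complex \<Rightarrow> complex) \<Rightarrow> (nat \<Rightarrow> complex) \<Rightarrow> nat \<Rightarrow> complex \<Rightarrow> complex" where
  "iterate_term f a n z = a (Suc n) * (f ^^ Suc n) z"

definition iterate_series :: "(complex \<Rightarrow> complex) \<Rightarrow> (nat \<Rightarrow> complex) \<Rightarrow> complex \<Rightarrow> complex" where
  "iterate_series f a z = (\<Sum>n. iterate_term f a n z)"

end

theory Submission imports Defs begin

text \<open>
  Let \<open>T\<close> be the boundary map of \<open>f\<close> and \<open>\<omega>\<^sub>z\<close> the harmonic measure at \<open>z\<close>.  Since \<open>T\<close> pushes \<open>\<omega>\<^sub>z\<close> forward to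
  \<open>\<omega>\<^bsub>f z\<^esub>\<close>, the Garsia integral of \<open>\<Sum> c\<^sub>n f\<^sup>n\<close> at \<open>z\<close> is a variance under \<open>\<omega>\<^sub>z\<close>, and the covariance of
  \<open>T\<^sup>n\<close> and \<open>T\<^sup>m\<close> for \<open>n \<le> m\<close> has modulus \<open>(1 - |f\<^sup>n z|\<^sup>2) |f\<^sup>m z / f\<^sup>n z|\<close>.  Harnack's inequality for
  \<open>f w / w\<close> bounds it by \<open>2 t\<^sub>n \<Prod>\<^bsub>n \<le> j < m\<^esub> (1 - \<kappa> t\<^sub>j)\<close> with \<open>t\<^sub>j = 1 - |f\<^sup>j z|\<close>; rows and columns of this
  matrix telescope, so Schur's test gives the upper bound.  At the origin \<open>T\<^sup>n - cnj \<alpha> T\<^sup>n\<^sup>+\<^sup>1\<close>, with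
  \<open>\<alpha> = f' 0\<close>, are orthogonal reverse martingale differences: this gives the lower bound and, through
  Kolmogorov's maximal inequality, almost everywhere convergence of \<open>\<Sum> c\<^sub>n T\<^sup>n\<close>.  Fatou's theorem
  identifies its sum with the non-tangential limit of \<open>\<Sum> c\<^sub>n f\<^sup>n\<close>.  If \<open>f\<close> is a finite Blaschke product,
  \<open>|f\<^sup>n z| \<longrightarrow> 1\<close> as \<open>|z| \<longrightarrow> 1\<close>, so every covariance tends to \<open>0\<close>.
\<close>

section \<open>The Poisson integral on the circle\<close>

text \<open>Two obstacles shape the argument. The iterates of \<open>T\<close> are not orthogonal
  unless \<alpha> = 0: at the origin their correlations are powers of \<alpha>. However,
  differentiating the push-forward identity at 0 shows that \<open>cnj \<alpha> * T \<xi>\<close> is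
  the conditional expectation of \<xi> given \<open>T\<close>. Subtracting it produces the
  martingale differences, and summation by parts carries their properties back to the original
  series. As f is not a rotation, |\<alpha>| < 1; this bounds the summation by parts and gives
  Harnack's inequality a positive gap \<kappa>. For 0 < |z| < 1 the measure \<open>harm z\<close> is
  not invariant under \<open>T\<close>, so the martingale serves only the origin, while BMOA asks
  for a bound uniform in z. This is why covariances are estimated directly. The resulting C is the
  larger of 4 / \<kappa> and 12 / (1 - |\<alpha>|)^2. An inner function comes with radial limits of
  f alone, whereas BMOA is defined by non-tangential ones. Hence Fatou's theorem is proved in the
  non-tangential form, for all integrable boundary functions.\<close>

interpretation circle: prob_space circle_measure
  by (rule prob_space_circle_measure)

lemma space_circle_measure [simp]: "space circle_measure = sphere 0 1"
  by (simp add: circle_measure_def)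

lemma sets_circle_measure [simp, measurable_cong]:
  "sets circle_measure = sets (restrict_space borel (sphere 0 1))"
  by (simp add: circle_measure_def)

section \<open>Integration over the circle in the angle variable\<close>

lemma continuous_on_imp_measurable_circle:
  assumes "continuous_on (sphere 0 1) \<phi>"
  shows "\<phi> \<in> borel_measurable circle_measure"
  using borel_measurable_continuous_on_restrict[OF assms] by measurable

lemma measurable_cis_circle [measurable]:
  "cis \<in> measurable borel (restrict_space borel (sphere 0 1))"
  by (intro measurable_restrict_space2 borel_measurable_continuous_onI continuous_intros) auto

lemma uniform_measure_angle:
  "uniform_measure lborel {0..2*pi} = density lborel (\<lambda>t. ennreal (indicator {0..2*pi} t / (2*pi)))"
  unfolding uniform_measure_def
  by (intro arg_cong2[where f=density] refl ext)
     (auto simp: indicator_def divide_ennreal[symmetric] ennreal_1[symmetric] simp del: ennreal_1)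

lemma integral_circle_measure:
  fixes \<phi> :: "complex \<Rightarrow> complex"
  assumes "\<phi> \<in> borel_measurable circle_measure"
  shows "integral\<^sup>L circle_measure \<phi> = (LINT t:{0..2*pi}|lborel. \<phi> (cis t)) / (2*pi)"
proof -
  have [measurable]: "\<phi> \<in> borel_measurable (restrict_space borel (sphere 0 1))"
    using assms by measurable
  have m: "cis \<in> measurable lborel (restrict_space borel (sphere 0 1))"
    by measurable
  have m': "(\<lambda>t. \<phi> (cis t)) \<in> borel_measurable lborel"
    by measurable
  have "integral\<^sup>L circle_measure \<phi> = integral\<^sup>L (uniform_measure lborel {0..2*pi}) (\<lambda>t. \<phi> (cis t))"
    unfolding circle_measure_def by (subst integral_distr) auto
  also have "\<dots> = (LINT t|lborel. (indicator {0..2*pi} t / (2*pi)) *\<^sub>R \<phi> (cis t))"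
    unfolding uniform_measure_angle by (subst integral_density) (use m' in auto)
  also have "\<dots> = (LINT t|lborel. (indicator {0..2*pi} t *\<^sub>R \<phi> (cis t)) / (2*pi))"
    by (intro Bochner_Integration.integral_cong) (auto simp: scaleR_conv_of_real)
  also have "\<dots> = (LINT t:{0..2*pi}|lborel. \<phi> (cis t)) / (2*pi)"
    unfolding set_lebesgue_integral_def by (subst integral_divide_zero) simp
  finally show ?thesis .
qed

lemma nn_integral_circle_measure:
  assumes "\<phi> \<in> borel_measurable circle_measure"
  shows "(\<integral>\<^sup>+\<xi>. \<phi> \<xi> \<partial>circle_measure) = (\<integral>\<^sup>+t. \<phi> (cis t) * indicator {0..2*pi} t \<partial>lborel) / ennreal (2*pi)"
proof -
  have [measurable]: "\<phi> \<in> borel_measurable (restrict_space borel (sphere 0 1))"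
    using assms by measurable
  have m': "(\<lambda>t. \<phi> (cis t)) \<in> borel_measurable lborel"
    by measurable
  have "(\<integral>\<^sup>+\<xi>. \<phi> \<xi> \<partial>circle_measure) = (\<integral>\<^sup>+t. \<phi> (cis t) \<partial>uniform_measure lborel {0..2*pi})"
    unfolding circle_measure_def by (subst nn_integral_distr) auto
  also have "\<dots> = (\<integral>\<^sup>+t. \<phi> (cis t) * indicator {0..2*pi} t \<partial>lborel) / ennreal (2*pi)"
    by (subst nn_integral_uniform_measure) (use m' in auto)
  finally show ?thesis .
qed

text \<open>On the unit circle d\<xi> = i \<xi> dt, so the factor \<xi> in the integrand turns
  Cauchy's contour formula into an average against normalized arc length.\<close>

lemma circle_cauchy_integral:
  assumes cont: "continuous_on (cball 0 1) H" and hol: "H holomorphic_on ball 0 1" and z: "cmod z < 1"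
  shows "(\<integral>\<xi>. H \<xi> * \<xi> / (\<xi> - z) \<partial>circle_measure) = H z"
proof -
  have ne: "cis t \<noteq> z" for t
    using z by (metis norm_cis less_irrefl)
  have contH: "continuous_on (sphere 0 1) (\<lambda>\<xi>. H \<xi> * \<xi> / (\<xi> - z))"
    using z by (intro continuous_intros continuous_on_subset[OF cont]) auto
  have "((\<lambda>u. H u / (u - z)) has_contour_integral 2 * of_real pi * \<i> * H z) (circlepath 0 1)"
    using Cauchy_integral_circlepath[OF cont hol] z by simp
  then have hi: "((\<lambda>t. H (cis t) / (cis t - z) * \<i> * cis t) has_integral 2 * of_real pi * \<i> * H z) {0..2*pi}"
    unfolding circlepath_def by (subst (asm) has_contour_integral_part_circlepath_iff) auto
  have eq: "(\<lambda>t. H (cis t) * cis t / (cis t - z)) = (\<lambda>t. (H (cis t) / (cis t - z) * \<i> * cis t) / \<i>)"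
    by (auto simp: fun_eq_iff field_simps)
  have hi': "((\<lambda>t. H (cis t) * cis t / (cis t - z)) has_integral 2 * of_real pi * H z) {0..2*pi}"
    unfolding eq by (rule has_integral_eq_rhs[OF has_integral_divide[OF hi, of \<i>]]) simp
  have "continuous_on {0..2*pi} (\<lambda>t. H (cis t) * cis t / (cis t - z))"
    by (rule continuous_on_compose2[OF contH]) (auto intro!: continuous_intros)
  then have "set_integrable lborel {0..2*pi} (\<lambda>t. H (cis t) * cis t / (cis t - z))"
    by (rule borel_integrable_atLeastAtMost')
  from set_borel_integral_eq_integral(2)[OF this] hi'
  have "(LINT t:{0..2*pi}|lborel. H (cis t) * cis t / (cis t - z)) = 2 * of_real pi * H z"
    by (simp add: integral_unique)
  then show ?thesis
    by (subst integral_circle_measure[OF continuous_on_imp_measurable_circle[OF contH]]) simp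
qed

section \<open>Poisson kernel and harmonic measure\<close>

lemma poisson_kernel_nonneg: "cmod z < 1 \<Longrightarrow> 0 \<le> poisson_kernel z \<xi>"
  unfolding poisson_kernel_def
  by (intro divide_nonneg_nonneg) (auto simp: abs_square_le_1)

lemma poisson_kernel_0 [simp]: "cmod \<xi> = 1 \<Longrightarrow> poisson_kernel 0 \<xi> = 1"
  by (simp add: poisson_kernel_def)

lemma poisson_kernel_le:
  assumes "cmod z < 1" "cmod \<xi> = 1"
  shows "poisson_kernel z \<xi> \<le> 2 / (1 - cmod z)"
proof -
  have d: "1 - cmod z \<le> cmod (\<xi> - z)"
    using norm_triangle_ineq2[of \<xi> z] assms by simp
  have "(1 - (cmod z)\<^sup>2) / (cmod (\<xi> - z))\<^sup>2 \<le> (1 - (cmod z)\<^sup>2) / (1 - cmod z)\<^sup>2"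
    using assms d by (intro divide_left_mono power_mono mult_pos_pos zero_less_power) (auto simp: abs_square_le_1)
  also have "\<dots> = (1 + cmod z) / (1 - cmod z)"
  proof -
    have "1 - (cmod z)\<^sup>2 = (1 - cmod z) * (1 + cmod z)"
      by (simp add: power2_eq_square algebra_simps)
    then show ?thesis
      using assms by (simp add: power2_eq_square)
  qed
  also have "\<dots> \<le> 2 / (1 - cmod z)"
    using assms by (intro divide_right_mono) auto
  finally show ?thesis
    by (simp add: poisson_kernel_def)
qed

lemma poisson_kernel_ge:
  assumes "cmod z < 1" "cmod \<xi> = 1"
  shows "(1 - cmod z) / 2 \<le> poisson_kernel z \<xi>"
proof -
  have d: "cmod (\<xi> - z) \<le> 1 + cmod z"
    using norm_triangle_ineq4[of \<xi> z] assms by simp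
  have "\<xi> \<noteq> z"
    using assms by auto
  have "(1 - cmod z) / 2 \<le> (1 - cmod z) / (1 + cmod z)"
    using assms by (intro divide_left_mono) (auto intro: add_pos_nonneg)
  also have "\<dots> = (1 - (cmod z)\<^sup>2) / (1 + cmod z)\<^sup>2"
  proof -
    have "1 - (cmod z)\<^sup>2 = (1 - cmod z) * (1 + cmod z)"
      by (simp add: power2_eq_square algebra_simps)
    moreover have "1 + cmod z \<noteq> 0"
      by (smt (verit) norm_ge_zero)
    ultimately show ?thesis
      by (simp add: power2_eq_square)
  qed
  also have "\<dots> \<le> (1 - (cmod z)\<^sup>2) / (cmod (\<xi> - z))\<^sup>2"
    using assms d \<open>\<xi> \<noteq> z\<close> by (intro divide_left_mono power_mono mult_pos_pos zero_less_power) (auto simp: abs_square_le_1 add_pos_nonneg)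
  finally show ?thesis
    by (simp add: poisson_kernel_def)
qed

lemma measurable_poisson_kernel [measurable]: "poisson_kernel z \<in> borel_measurable borel"
  unfolding poisson_kernel_def[abs_def] by measurable

lemma measurable_circle_borel:
  "\<phi> \<in> borel_measurable borel \<Longrightarrow> \<phi> \<in> borel_measurable circle_measure"
  by (simp add: measurable_restrict_space1 measurable_cong_sets[OF sets_circle_measure refl])

lemma measurable_id_circle [measurable]: "(\<lambda>\<xi>::complex. \<xi>) \<in> borel_measurable circle_measure"
  by (rule measurable_circle_borel) simp

lemma measurable_cnj_circle [measurable]: "cnj \<in> borel_measurable circle_measure"
  by (intro continuous_on_imp_measurable_circle continuous_intros)

text \<open>On the circle \<open>cnj \<xi>\<close> = 1 / \<xi>. So the kernel is the Cauchy factor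
  \<open>\<xi> / (\<xi> - z)\<close> times a function of \<xi> that extends holomorphically across
  the closed disc, and Poisson's formula reduces to Cauchy's.\<close>

lemma poisson_kernel_cauchy:
  assumes "cmod z < 1" "cmod \<xi> = 1"
  shows "of_real (poisson_kernel z \<xi>) = (1 - of_real ((cmod z)\<^sup>2)) / (1 - cnj z * \<xi>) * \<xi> / (\<xi> - z)"
proof -
  have "\<xi> \<noteq> z"
    using assms by auto
  have x: "\<xi> * cnj \<xi> = 1"
    using assms by (simp add: complex_norm_square[symmetric])
  have "of_real ((cmod (\<xi> - z))\<^sup>2) = (\<xi> - z) * (cnj \<xi> - cnj z)"
    by (simp only: complex_norm_square complex_cnj_diff)
  moreover have "\<xi> * (cnj \<xi> - cnj z) = 1 - cnj z * \<xi>"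
    using x by (simp add: algebra_simps)
  moreover have "\<xi> \<noteq> 0" "cnj \<xi> \<noteq> cnj z"
    using assms \<open>\<xi> \<noteq> z\<close> by auto
  ultimately have e: "of_real ((cmod (\<xi> - z))\<^sup>2) * \<xi> = (\<xi> - z) * (1 - cnj z * \<xi>)" and ne: "1 - cnj z * \<xi> \<noteq> 0"
    by (metis mult.assoc mult.commute, metis mult_eq_0_iff right_minus_eq)
  have "complex_of_real (poisson_kernel z \<xi>) = (1 - of_real ((cmod z)\<^sup>2)) / of_real ((cmod (\<xi> - z))\<^sup>2)"
    by (simp add: poisson_kernel_def)
  also have "\<dots> = (1 - of_real ((cmod z)\<^sup>2)) * \<xi> / (of_real ((cmod (\<xi> - z))\<^sup>2) * \<xi>)"
    using \<open>\<xi> \<noteq> 0\<close> by simp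
  also have "\<dots> = (1 - of_real ((cmod z)\<^sup>2)) / (1 - cnj z * \<xi>) * \<xi> / (\<xi> - z)"
    unfolding e by (simp add: mult.commute)
  finally show ?thesis .
qed

text \<open>Harmonic measure of the disc seen from \<open>z\<close>. As a measure in its own right
  it can be pushed forward by boundary maps, and Poisson integrals become expectations.\<close>

definition harm :: "complex \<Rightarrow> complex measure" where
  "harm z = density circle_measure (\<lambda>\<xi>. ennreal (poisson_kernel z \<xi>))"

lemma space_harm [simp]: "space (harm z) = sphere 0 1"
  by (simp add: harm_def)

lemma sets_harm [simp, measurable_cong]: "sets (harm z) = sets (restrict_space borel (sphere 0 1))"
  by (simp add: harm_def)

lemma harm_0: "harm 0 = circle_measure"
proof -
  have "harm 0 = density circle_measure (\<lambda>_. 1)"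
    unfolding harm_def by (rule density_cong)
      (auto intro!: measurable_compose[OF measurable_circle_borel[OF measurable_poisson_kernel] measurable_ennreal])
  then show ?thesis
    by (simp add: density_1)
qed

lemma measurable_poisson_kernel_circle [measurable]:
  "poisson_kernel z \<in> borel_measurable circle_measure"
  by (rule measurable_circle_borel[OF measurable_poisson_kernel])

lemma AE_harm: "AE \<xi> in circle_measure. Q \<xi> \<Longrightarrow> AE \<xi> in harm z. Q \<xi>"
  unfolding harm_def by (subst AE_density) auto

lemma nn_integral_harm:
  "\<phi> \<in> borel_measurable circle_measure \<Longrightarrow>
    (\<integral>\<^sup>+\<xi>. \<phi> \<xi> \<partial>harm z) = (\<integral>\<^sup>+\<xi>. ennreal (poisson_kernel z \<xi>) * \<phi> \<xi> \<partial>circle_measure)"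
  unfolding harm_def by (subst nn_integral_density) auto

lemma integral_harm:
  fixes \<phi> :: "complex \<Rightarrow> 'a::{banach, second_countable_topology}"
  assumes "cmod z < 1" "\<phi> \<in> borel_measurable circle_measure"
  shows "(\<integral>\<xi>. \<phi> \<xi> \<partial>harm z) = (\<integral>\<xi>. poisson_kernel z \<xi> *\<^sub>R \<phi> \<xi> \<partial>circle_measure)"
  unfolding harm_def using assms by (subst integral_density) (auto simp: poisson_kernel_nonneg)

lemma integral_harm_holomorphic:
  assumes cont: "continuous_on (cball 0 1) h" and hol: "h holomorphic_on ball 0 1" and z: "cmod z < 1"
  shows "(\<integral>\<xi>. h \<xi> \<partial>harm z) = h z"
proof -
  \<comment> \<open>The factor beside \<open>h\<close> has no pole in the closed disc and equals 1
    at \<open>z\<close>, so Cauchy's formula for \<open>H\<close> returns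
    \<open>h z\<close>.\<close>
  define H where "H w = h w * ((1 - of_real ((cmod z)\<^sup>2)) / (1 - cnj z * w))" for w
  have ne: "1 - cnj z * w \<noteq> 0" if "cmod w \<le> 1" for w
  proof -
    have "cmod (cnj z * w) < 1"
      using z that mult_left_le[of "cmod w" "cmod z"] by (auto simp: norm_mult)
    then show ?thesis
      by auto
  qed
  have "(\<integral>\<xi>. h \<xi> \<partial>harm z) = (\<integral>\<xi>. poisson_kernel z \<xi> *\<^sub>R h \<xi> \<partial>circle_measure)"
    by (intro integral_harm z continuous_on_imp_measurable_circle continuous_on_subset[OF cont]) auto
  also have "\<dots> = (\<integral>\<xi>. H \<xi> * \<xi> / (\<xi> - z) \<partial>circle_measure)"
    using z by (intro Bochner_Integration.integral_cong)
      (auto simp: H_def scaleR_conv_of_real poisson_kernel_cauchy)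
  also have "\<dots> = H z"
    using ne by (intro circle_cauchy_integral z)
      (auto simp: H_def intro!: continuous_intros holomorphic_intros cont hol)
  also have "\<dots> = h z"
    using ne[of z] z by (simp add: H_def complex_norm_square mult.commute del: of_real_power)
  finally show ?thesis .
qed

lemma prob_space_harm:
  assumes z: "cmod z < 1"
  shows "prob_space (harm z)"
proof
  have 1: "(\<integral>\<xi>. poisson_kernel z \<xi> *\<^sub>R (1::complex) \<partial>circle_measure) = 1"
    using integral_harm_holomorphic[of "\<lambda>_. 1" z] z by (subst integral_harm[symmetric]) auto
  have i: "integrable circle_measure (poisson_kernel z)"
    using z by (intro circle.integrable_const_bound[of _ "2 / (1 - cmod z)"] AE_I2)
      (auto simp: poisson_kernel_nonneg poisson_kernel_le)
  have "(\<integral>\<xi>. poisson_kernel z \<xi> \<partial>circle_measure) = 1"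
    using 1 by (simp add: scaleR_conv_of_real)
  then have "(\<integral>\<^sup>+\<xi>. ennreal (poisson_kernel z \<xi>) \<partial>circle_measure) = 1"
    using i z by (subst nn_integral_eq_integral) (auto simp: poisson_kernel_nonneg)
  moreover have "emeasure (harm z) (space (harm z)) =
      (\<integral>\<^sup>+\<xi>. ennreal (poisson_kernel z \<xi>) * indicator (space circle_measure) \<xi> \<partial>circle_measure)"
    unfolding harm_def by (subst emeasure_density) (auto simp flip: space_circle_measure sets_circle_measure)
  moreover have "\<dots> = (\<integral>\<^sup>+\<xi>. ennreal (poisson_kernel z \<xi>) \<partial>circle_measure)"
    by (rule nn_integral_cong) auto
  ultimately show "emeasure (harm z) (space (harm z)) = 1"
    by simp
qed

text \<open>Measurability and dominated convergence want a sequence of radii instead of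
  \<open>at_left 1\<close>; the shift by 2 keeps every radius in [1/2, 1).\<close>

lemma filterlim_radii: "filterlim (\<lambda>n. 1 - inverse (real (n + 2))) (at_left 1) sequentially"
proof -
  have "(\<lambda>n. inverse (real (n + 2))) \<longlonglongrightarrow> 0"
    using LIMSEQ_Suc[OF LIMSEQ_inverse_real_of_nat] by simp
  then have "(\<lambda>n. 1 - inverse (real (n + 2))) \<longlonglongrightarrow> 1"
    using tendsto_diff[OF tendsto_const[of 1]] by fastforce
  then show ?thesis
    unfolding filterlim_at by (auto intro!: always_eventually)
qed

lemma has_radial_limit_sequentially:
  "has_radial_limit g \<xi> l \<Longrightarrow> (\<lambda>n. g (of_real (1 - inverse (real (n + 2))) * \<xi>)) \<longlonglongrightarrow> l"
  unfolding has_radial_limit_def using filterlim_compose[OF _ filterlim_radii] by blast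

text \<open>The dilates of \<open>h\<close> are continuous up to the circle, where Poisson's formula
  is already available; boundedness lets the radius tend to 1 under the integral.\<close>

lemma integral_harm_radial_limit:
  assumes hol: "h holomorphic_on ball 0 1" and bd: "\<And>w. cmod w < 1 \<Longrightarrow> cmod (h w) \<le> B"
    and meas: "h' \<in> borel_measurable circle_measure"
    and lim: "AE \<xi> in circle_measure. has_radial_limit h \<xi> (h' \<xi>)"
    and z: "cmod z < 1"
  shows "(\<integral>\<xi>. h' \<xi> \<partial>harm z) = h z"
proof -
  interpret prob_space "harm z"
    by (rule prob_space_harm[OF z])
  define r where "r n = 1 - inverse (real (n + 2))" for n
  have r: "0 < r n" "r n < 1" for n
    by (auto simp: r_def field_simps)
  have lt: "cmod (of_real (r n) * w) < 1" if "cmod w \<le> 1" for n w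
  proof -
    have "r n * cmod w \<le> r n"
      using that less_imp_le[OF r(1)] by (rule mult_left_le)
    with r[of n] show ?thesis
      by (simp add: norm_mult le_less_trans[OF _ r(2)[of n]] del: mult_le_cancel_left1)
  qed
  from lt have maps: "(\<lambda>w. complex_of_real (r n) * w) ` cball 0 1 \<subseteq> ball 0 1" for n
    by (intro image_subsetI) (simp only: mem_cball_0 mem_ball_0)
  have cont: "continuous_on (cball 0 1) (\<lambda>w. h (of_real (r n) * w))" for n
    by (rule continuous_on_compose2[OF holomorphic_on_imp_continuous_on[OF hol] _ maps])
       (intro continuous_intros)
  have hol': "(\<lambda>w. h (of_real (r n) * w)) holomorphic_on ball 0 1" for n
    using holomorphic_on_compose_gen[of "\<lambda>w. of_real (r n) * w" "ball 0 1" h "ball 0 1"] hol maps[of n]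
    by (force simp: o_def intro!: holomorphic_intros)
  have "h (of_real (r n) * z) = (\<integral>\<xi>. h (of_real (r n) * \<xi>) \<partial>harm z)" for n
    by (rule integral_harm_holomorphic[OF cont hol' z, symmetric])
  moreover have "(\<lambda>n. \<integral>\<xi>. h (of_real (r n) * \<xi>) \<partial>harm z) \<longlonglongrightarrow> (\<integral>\<xi>. h' \<xi> \<partial>harm z)"
  proof (rule integral_dominated_convergence[where w="\<lambda>_. B"])
    show "h' \<in> borel_measurable (harm z)"
      using meas by measurable
    show "(\<lambda>\<xi>. h (of_real (r n) * \<xi>)) \<in> borel_measurable (harm z)" for n
      using continuous_on_imp_measurable_circle[OF continuous_on_subset[OF cont[of n], of "sphere 0 1"]]
      by (simp add: measurable_def harm_def)
    show "AE \<xi> in harm z. (\<lambda>n. h (of_real (r n) * \<xi>)) \<longlonglongrightarrow> h' \<xi>"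
      by (rule AE_harm) (use lim in eventually_elim, auto simp: r_def dest: has_radial_limit_sequentially)
    show "AE \<xi> in harm z. cmod (h (of_real (r n) * \<xi>)) \<le> B" for n
      by (intro AE_I2 bd lt) auto
  qed auto
  moreover have "(\<lambda>n. h (of_real (r n) * z)) \<longlonglongrightarrow> h z"
  proof -
    have "isCont h z"
      using z by (intro field_differentiable_imp_continuous_at holomorphic_on_imp_differentiable_at[OF hol]) auto
    moreover have "(\<lambda>n. of_real (r n) * z) \<longlonglongrightarrow> z"
    proof -
      have "has_radial_limit (\<lambda>w. w) z z"
        unfolding has_radial_limit_def by (rule tendsto_eq_intros refl | simp)+
      from has_radial_limit_sequentially[OF this] show ?thesis
        by (simp only: r_def)
    qed
    ultimately show ?thesis
      by (rule isCont_tendsto_compose)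
  qed
  ultimately show ?thesis
    using LIMSEQ_unique by auto
qed

section \<open>Series of reverse martingale differences\<close>

lemma borel_measurable_cnj [measurable (raw)]:
  "f \<in> borel_measurable M \<Longrightarrow> (\<lambda>x. cnj (f x)) \<in> borel_measurable M"
  by (rule borel_measurable_continuous_on[where f=cnj]) (intro continuous_intros)

lemma borel_measurable_of_bool [measurable (raw)]:
  "Measurable.pred M P \<Longrightarrow> (\<lambda>x. of_bool (P x) :: 'b :: {topological_space, zero_neq_one}) \<in> borel_measurable M"
  unfolding of_bool_def by measurable

lemma cmod_add_squared: "(cmod (u + v))\<^sup>2 = (cmod u)\<^sup>2 + (cmod v)\<^sup>2 + 2 * Re (u * cnj v)"
  unfolding cmod_power2 by (simp add: power2_eq_square algebra_simps)

text \<open>\<open>orthogonal\<close> is E(X | T) = 0, tested on bounded functions of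
  \<open>T\<close> so that no conditional expectation has to be formed. As \<open>T\<close>
  preserves \<open>M\<close>, the functions \<open>X \<circ> T ^^ j\<close> are reverse martingale
  differences for the decreasing sigma-algebras generated by the \<open>T ^^ j\<close>.\<close>

locale reverse_martingale_difference = prob_space M for M :: "'a measure" +
  fixes T :: "'a \<Rightarrow> 'a" and X :: "'a \<Rightarrow> complex" and B :: real
  assumes measurable_T [measurable]: "T \<in> measurable M M"
    and distr_T: "distr M M T = M"
    and measurable_X [measurable]: "X \<in> borel_measurable M"
    and bounded_X: "x \<in> space M \<Longrightarrow> cmod (X x) \<le> B"
    and orthogonal: "G \<in> borel_measurable M \<Longrightarrow> (\<And>x. x \<in> space M \<Longrightarrow> cmod (G x) \<le> K) \<Longrightarrow>
           (\<integral>x. X x * G (T x) \<partial>M) = 0"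
begin

lemma integral_comp_T:
  fixes g :: "'a \<Rightarrow> 'b::{banach, second_countable_topology}"
  assumes "g \<in> borel_measurable M"
  shows "(\<integral>x. g (T x) \<partial>M) = (\<integral>x. g x \<partial>M)"
  using integral_distr[OF measurable_T assms] by (simp add: distr_T)

lemma T_space [simp]: "x \<in> space M \<Longrightarrow> T x \<in> space M"
  using measurable_space[OF measurable_T] .

lemma measurable_T_pow [measurable]: "(T ^^ n) \<in> measurable M M"
  by (induction n) (auto simp: id_def)

lemma distr_T_pow: "distr M M (T ^^ n) = M"
proof (induction n)
  case (Suc n)
  have "distr M M (T ^^ Suc n) = distr (distr M M (T ^^ n)) M T"
    by (subst distr_distr) auto
  with Suc show ?case
    by (simp only: distr_T)
qed (simp add: id_def distr_id)

section \<open>Partial sums, their second moments and their maximal inequality\<close>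

definition S :: "(nat \<Rightarrow> complex) \<Rightarrow> nat \<Rightarrow> 'a \<Rightarrow> complex" where
  "S c L x = (\<Sum>j<L. c j * X ((T ^^ j) x))"

lemma S_0 [simp]: "S c 0 x = 0"
  by (simp add: S_def)

lemma S_Suc: "S c (Suc L) x = c 0 * X x + S (\<lambda>j. c (Suc j)) L (T x)"
  unfolding S_def sum.lessThan_Suc_shift by (simp add: funpow_Suc_right del: funpow.simps)

lemma measurable_S [measurable]: "S c L \<in> borel_measurable M"
  unfolding S_def[abs_def] by measurable

lemma bounded_S: "x \<in> space M \<Longrightarrow> cmod (S c L x) \<le> (\<Sum>j<L. cmod (c j)) * B"
proof (induction L arbitrary: c x)
  case (Suc L)
  have "cmod (S c (Suc L) x) \<le> cmod (c 0) * cmod (X x) + cmod (S (\<lambda>j. c (Suc j)) L (T x))"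
    unfolding S_Suc by (metis norm_mult norm_triangle_ineq)
  also have "\<dots> \<le> cmod (c 0) * B + (\<Sum>j<L. cmod (c (Suc j))) * B"
    using Suc by (intro add_mono mult_left_mono bounded_X) auto
  finally show ?case
    by (simp add: sum.lessThan_Suc_shift algebra_simps del: sum.lessThan_Suc)
qed simp

lemma bounded_S': "\<exists>K. \<forall>x\<in>space M. cmod (S c L x) \<le> K"
  using bounded_S by blast

lemma integrable_bounded:
  fixes g :: "'a \<Rightarrow> 'b::{banach, second_countable_topology}"
  assumes "g \<in> borel_measurable M" "\<And>x. x \<in> space M \<Longrightarrow> norm (g x) \<le> K"
  shows "integrable M g"
  using assms by (intro integrable_const_bound[of _ K] AE_I2)

text \<open>
  \<open>hit \<epsilon> L c x\<close> says that some sum of the terms \<open>i, \<dots>, L - 1\<close> has modulus at least \<open>\<epsilon>\<close>.  The recursion splits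
  off the term \<open>0\<close>, since all the others are functions of \<^term>\<open>T x\<close>.
\<close>

primrec hit :: "real \<Rightarrow> nat \<Rightarrow> (nat \<Rightarrow> complex) \<Rightarrow> 'a \<Rightarrow> bool" where
  "hit \<epsilon> 0 c x = False"
| "hit \<epsilon> (Suc L) c x = (hit \<epsilon> L (\<lambda>j. c (Suc j)) (T x) \<or> \<epsilon> \<le> cmod (S c (Suc L) x))"

lemma measurable_hit [measurable]: "Measurable.pred M (hit \<epsilon> L c)"
proof (induction L arbitrary: c)
  case (Suc L)
  note [measurable] = Suc
  show ?case unfolding hit.simps[abs_def] by measurable
qed (simp add: hit.simps[abs_def])

text \<open>For \<open>i > 0\<close> the term 0 cancels in the difference, leaving a difference of
  the shifted sums at \<open>T x\<close>; for \<open>i = 0\<close> the difference is the full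
  sum.\<close>

lemma hitI:
  assumes "\<epsilon> > 0" "i \<le> L" "\<epsilon> \<le> cmod (S c L x - S c i x)"
  shows "hit \<epsilon> L c x"
  using assms(2,3)
proof (induction L arbitrary: c i x)
  case 0
  then show ?case using assms(1) by simp
next
  case (Suc L)
  show ?case
  proof (cases i)
    case 0
    then show ?thesis using Suc by simp
  next
    case (Suc i')
    then show ?thesis
      using Suc.IH[of i' "\<lambda>j. c (Suc j)" "T x"] Suc.prems by (simp add: S_Suc)
  qed
qed

text \<open>The mixed term of |a X + s \<circ> T|^2, with \<open>G\<close> the conjugate of s,
  possibly cut off to an event; so it serves both the second moment and the maximal
  inequality.\<close>

lemma cross_term:
  assumes [measurable]: "G \<in> borel_measurable M" and "\<And>x. x \<in> space M \<Longrightarrow> cmod (G x) \<le> K"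
  shows "(\<integral>x. 2 * Re (a * X x * G (T x)) \<partial>M) = 0"
    and "integrable M (\<lambda>x. 2 * Re (a * X x * G (T x)))"
proof -
  have int: "integrable M (\<lambda>x. X x * G (T x))"
    using assms(2) bounded_X by (intro integrable_bounded[of _ "B * K"]) 
      (auto simp: norm_mult intro!: mult_mono order_trans[OF norm_ge_zero bounded_X])
  then have int': "integrable M (\<lambda>x. a * X x * G (T x))"
    by (simp add: mult.assoc)
  then show "integrable M (\<lambda>x. 2 * Re (a * X x * G (T x)))"
    by (intro integrable_mult_right integrable_Re)
  have "(\<integral>x. a * X x * G (T x) \<partial>M) = 0"
    using orthogonal[OF assms] by (simp add: mult.assoc)
  then show "(\<integral>x. 2 * Re (a * X x * G (T x)) \<partial>M) = 0"
    by (simp only: integral_mult_right_zero integral_Re[OF int']) simp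
qed

lemma integrable_S_sq [simp]: "integrable M (\<lambda>x. (cmod (S c L x))\<^sup>2)"
proof -
  obtain K where K: "\<forall>x\<in>space M. cmod (S c L x) \<le> K"
    using bounded_S' by blast
  then show ?thesis
    by (intro integrable_bounded[of _ "K\<^sup>2"]) (auto intro!: power_mono)
qed

lemma integrable_X_sq [simp]: "integrable M (\<lambda>x. (cmod (X x))\<^sup>2)"
  by (intro integrable_bounded[of _ "B\<^sup>2"]) (auto intro!: power_mono bounded_X)

lemma integral_S_sq: "(\<integral>x. (cmod (S c L x))\<^sup>2 \<partial>M) = (\<Sum>j<L. (cmod (c j))\<^sup>2) * (\<integral>x. (cmod (X x))\<^sup>2 \<partial>M)"
proof (induction L arbitrary: c)
  case (Suc L)
  define s where "s = S (\<lambda>j. c (Suc j)) L"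
  have [measurable]: "s \<in> borel_measurable M"
    by (simp add: s_def)
  obtain K where K: "\<forall>x\<in>space M. cmod (s x) \<le> K"
    using bounded_S' unfolding s_def by blast
  have ints: "integrable M (\<lambda>x. (cmod (s x))\<^sup>2)"
    by (simp add: s_def)
  then have ints': "integrable M (\<lambda>x. (cmod (s (T x)))\<^sup>2)"
    using integrable_distr[of T M M "\<lambda>x. (cmod (s x))\<^sup>2"] by (simp add: distr_T)
  have cr: "(\<integral>x. 2 * Re (c 0 * X x * cnj (s (T x))) \<partial>M) = 0"
       "integrable M (\<lambda>x. 2 * Re (c 0 * X x * cnj (s (T x))))"
    by (rule cross_term[where K=K]; use K in simp)+
  have "(\<integral>x. (cmod (S c (Suc L) x))\<^sup>2 \<partial>M) =
     (\<integral>x. (cmod (c 0))\<^sup>2 * (cmod (X x))\<^sup>2 + (cmod (s (T x)))\<^sup>2 + 2 * Re (c 0 * X x * cnj (s (T x))) \<partial>M)"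
    unfolding S_Suc cmod_add_squared s_def by (simp add: norm_mult power_mult_distrib)
  also have "\<dots> = (cmod (c 0))\<^sup>2 * (\<integral>x. (cmod (X x))\<^sup>2 \<partial>M) + (\<integral>x. (cmod (s (T x)))\<^sup>2 \<partial>M) + 0"
    by (subst Bochner_Integration.integral_add Bochner_Integration.integral_add[OF _ ints'])+ (use cr ints' in auto)
  also have "(\<integral>x. (cmod (s (T x)))\<^sup>2 \<partial>M) = (\<integral>x. (cmod (s x))\<^sup>2 \<partial>M)"
    by (rule integral_comp_T) measurable
  also have "\<dots> = (\<Sum>j<L. (cmod (c (Suc j)))\<^sup>2) * (\<integral>x. (cmod (X x))\<^sup>2 \<partial>M)"
    unfolding s_def by (rule Suc)
  finally show ?case
    by (simp add: sum.lessThan_Suc_shift algebra_simps del: sum.lessThan_Suc)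
qed simp

lemma integrable_hit_mult:
  assumes "integrable M g"
  shows "integrable M (\<lambda>x. of_bool (hit \<epsilon> L c x) * (g x :: real))"
  using assms borel_measurable_integrable[OF assms] by (elim Bochner_Integration.integrable_bound) auto

text \<open>An integrated form of Doob's argument. On the points already hit after one shift, adding
  the orthogonal term 0 cannot lower the integral of |S|^2; points hit only by the full sum have |S|
  \<ge> \<epsilon> and contribute a nonnegative amount. The induction replaces first hitting
  times.\<close>

lemma hit_maximal:
  assumes "\<epsilon> > 0"
  shows "0 \<le> (\<integral>x. of_bool (hit \<epsilon> L c x) * ((cmod (S c L x))\<^sup>2 - \<epsilon>\<^sup>2) \<partial>M)"
proof (induction L arbitrary: c)
  case (Suc L)
  define s where "s = S (\<lambda>j. c (Suc j)) L"
  define H where "H = hit \<epsilon> L (\<lambda>j. c (Suc j))"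
  have [measurable]: "s \<in> borel_measurable M" "Measurable.pred M H"
    by (simp_all add: s_def H_def)
  obtain K where K: "\<forall>x\<in>space M. cmod (s x) \<le> K"
    using bounded_S' unfolding s_def by blast
  have ints: "integrable M (\<lambda>x. of_bool (H x) * ((cmod (s x))\<^sup>2 - \<epsilon>\<^sup>2))"
    unfolding H_def by (intro integrable_hit_mult) (simp add: s_def)
  then have ints': "integrable M (\<lambda>x. of_bool (H (T x)) * ((cmod (s (T x)))\<^sup>2 - \<epsilon>\<^sup>2))"
    using integrable_distr[of T M M "\<lambda>x. of_bool (H x) * ((cmod (s x))\<^sup>2 - \<epsilon>\<^sup>2)"] by (simp add: distr_T)
  have "cmod (of_bool (H x) * cnj (s x)) \<le> K" if "x \<in> space M" for x
    using K that order_trans[OF norm_ge_zero] by (auto simp: norm_mult) 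
  then have cr: "(\<integral>x. 2 * Re (c 0 * X x * (of_bool (H (T x)) * cnj (s (T x)))) \<partial>M) = 0"
       "integrable M (\<lambda>x. 2 * Re (c 0 * X x * (of_bool (H (T x)) * cnj (s (T x)))))"
    using cross_term[where K=K and G="\<lambda>x. of_bool (H x) * cnj (s x)" and a="c 0"]
    by (simp_all del: times_complex.sel)
  have "0 \<le> (\<integral>x. of_bool (H x) * ((cmod (s x))\<^sup>2 - \<epsilon>\<^sup>2) \<partial>M)"
    unfolding H_def s_def by (rule Suc)
  also have "\<dots> = (\<integral>x. of_bool (H (T x)) * ((cmod (s (T x)))\<^sup>2 - \<epsilon>\<^sup>2) \<partial>M)"
    by (rule integral_comp_T[symmetric]) measurable
  also have "\<dots> = (\<integral>x. of_bool (H (T x)) * ((cmod (s (T x)))\<^sup>2 - \<epsilon>\<^sup>2)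
                   + 2 * Re (c 0 * X x * (of_bool (H (T x)) * cnj (s (T x)))) \<partial>M)"
    by (subst Bochner_Integration.integral_add[OF ints' cr(2)]) (simp only: cr(1))
  also have "\<dots> \<le> (\<integral>x. of_bool (hit \<epsilon> (Suc L) c x) * ((cmod (S c (Suc L) x))\<^sup>2 - \<epsilon>\<^sup>2) \<partial>M)"
  proof (intro integral_mono Bochner_Integration.integrable_add ints' cr(2) integrable_hit_mult)
    fix x
    show "of_bool (H (T x)) * ((cmod (s (T x)))\<^sup>2 - \<epsilon>\<^sup>2)
          + 2 * Re (c 0 * X x * (of_bool (H (T x)) * cnj (s (T x))))
       \<le> of_bool (hit \<epsilon> (Suc L) c x) * ((cmod (S c (Suc L) x))\<^sup>2 - \<epsilon>\<^sup>2)"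
    proof (cases "H (T x)")
      case True
      then have "hit \<epsilon> (Suc L) c x"
        by (simp add: H_def)
      with True show ?thesis
        unfolding S_Suc cmod_add_squared s_def[symmetric] by simp
    next
      case False
      then show ?thesis
        using assms by (auto simp: H_def power_mono intro!: mult_nonneg_nonneg)
    qed
  qed simp
  finally show ?case .
qed simp

lemma prob_hit:
  assumes "\<epsilon> > 0"
  shows "\<epsilon>\<^sup>2 * prob {x \<in> space M. hit \<epsilon> L c x} \<le> (\<Sum>j<L. (cmod (c j))\<^sup>2) * (\<integral>x. (cmod (X x))\<^sup>2 \<partial>M)"
proof -
  have i1: "integrable M (\<lambda>x. of_bool (hit \<epsilon> L c x) * \<epsilon>\<^sup>2)"
    by (rule integrable_hit_mult) simp
  have i2: "integrable M (\<lambda>x. of_bool (hit \<epsilon> L c x) * (cmod (S c L x))\<^sup>2)"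
    by (rule integrable_hit_mult) simp
  have "prob {x \<in> space M. hit \<epsilon> L c x} = (\<integral>x. indicator {x \<in> space M. hit \<epsilon> L c x} x \<partial>M)"
    by simp
  also have "\<dots> = (\<integral>x. of_bool (hit \<epsilon> L c x) \<partial>M)"
    by (rule Bochner_Integration.integral_cong) auto
  finally have "\<epsilon>\<^sup>2 * prob {x \<in> space M. hit \<epsilon> L c x} = (\<integral>x. of_bool (hit \<epsilon> L c x) * \<epsilon>\<^sup>2 \<partial>M)"
    by simp
  also have "\<dots> \<le> (\<integral>x. of_bool (hit \<epsilon> L c x) * (cmod (S c L x))\<^sup>2 \<partial>M)"
    using hit_maximal[OF assms, of L c] i1 i2 by (simp add: right_diff_distrib)
  also have "\<dots> \<le> (\<integral>x. (cmod (S c L x))\<^sup>2 \<partial>M)"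
    by (intro integral_mono i2) auto
  also note integral_S_sq
  finally show ?thesis .
qed

text \<open>The reverse martingale controls the blocks \<open>S c L - S c i\<close> that end at L,
  but convergence concerns initial sums. Since \<open>S c i\<close> is the difference of the blocks
  starting at 0 and at i, a value 2 \<epsilon> forces one of them to reach \<epsilon>.\<close>

lemma prob_oscillation:
  assumes "\<epsilon> > 0" and sum: "summable (\<lambda>j. (cmod (c j))\<^sup>2)"
  shows "\<epsilon>\<^sup>2 * prob {x \<in> space M. \<exists>L. 2 * \<epsilon> \<le> cmod (S c L x)} \<le>
           (\<Sum>j. (cmod (c j))\<^sup>2) * (\<integral>x. (cmod (X x))\<^sup>2 \<partial>M)"
proof -
  define A where "A L = {x \<in> space M. \<exists>i\<le>L. 2 * \<epsilon> \<le> cmod (S c i x)}" for L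
  have A [measurable]: "A L \<in> sets M" for L
    unfolding A_def by measurable
  have le: "\<epsilon>\<^sup>2 * prob (A L) \<le> (\<Sum>j. (cmod (c j))\<^sup>2) * (\<integral>x. (cmod (X x))\<^sup>2 \<partial>M)" for L
  proof -
    have "A L \<subseteq> {x \<in> space M. hit \<epsilon> L c x}"
    proof
      fix x assume "x \<in> A L"
      then obtain i where i: "i \<le> L" "2 * \<epsilon> \<le> cmod (S c i x)" and x: "x \<in> space M"
        by (auto simp: A_def)
      have "cmod (S c i x) \<le> cmod (S c L x - S c 0 x) + cmod (S c L x - S c i x)"
        using norm_triangle_ineq4[of "S c L x" "S c L x - S c i x"] by simp
      with i have "\<epsilon> \<le> cmod (S c L x - S c 0 x) \<or> \<epsilon> \<le> cmod (S c L x - S c i x)"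
        by linarith
      then show "x \<in> {x \<in> space M. hit \<epsilon> L c x}"
        using hitI[OF assms(1)] i(1) x by blast
    qed
    then have "prob (A L) \<le> prob {x \<in> space M. hit \<epsilon> L c x}"
      by (intro finite_measure_mono) auto
    then have "\<epsilon>\<^sup>2 * prob (A L) \<le> (\<Sum>j<L. (cmod (c j))\<^sup>2) * (\<integral>x. (cmod (X x))\<^sup>2 \<partial>M)"
      using prob_hit[OF assms(1), of L c] mult_left_mono[of _ _ "\<epsilon>\<^sup>2"] by (meson order_trans zero_le_power2)
    also have "\<dots> \<le> (\<Sum>j. (cmod (c j))\<^sup>2) * (\<integral>x. (cmod (X x))\<^sup>2 \<partial>M)"
      using sum by (intro mult_right_mono sum_le_suminf) auto
    finally show ?thesis .
  qed
  have "(\<lambda>L. prob (A L)) \<longlonglongrightarrow> prob (\<Union>L. A L)"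
    by (intro finite_Lim_measure_incseq incseq_SucI) (auto simp: A_def le_Suc_eq)
  then have "(\<lambda>L. \<epsilon>\<^sup>2 * prob (A L)) \<longlonglongrightarrow> \<epsilon>\<^sup>2 * prob (\<Union>L. A L)"
    by (intro tendsto_intros)
  then have "\<epsilon>\<^sup>2 * prob (\<Union>L. A L) \<le> (\<Sum>j. (cmod (c j))\<^sup>2) * (\<integral>x. (cmod (X x))\<^sup>2 \<partial>M)"
    by (rule LIMSEQ_le_const2) (use le in auto)
  moreover have "(\<Union>L. A L) = {x \<in> space M. \<exists>L. 2 * \<epsilon> \<le> cmod (S c L x)}"
    by (auto simp: A_def)
  ultimately show ?thesis
    by simp
qed

lemma S_add: "S c (N + L) x - S c N x = S (\<lambda>j. c (N + j)) L ((T ^^ N) x)"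
proof -
  have "S c (N + L) x = S c N x + (\<Sum>j<L. c (N + j) * X ((T ^^ (N + j)) x))"
    unfolding S_def by (induction L) (auto simp: algebra_simps)
  then show ?thesis
    unfolding S_def by (simp add: funpow_add add.commute[of N] comp_def)
qed

theorem AE_summable:
  assumes sum: "summable (\<lambda>j. (cmod (b j))\<^sup>2)"
  shows "AE x in M. summable (\<lambda>j. b j * X ((T ^^ j) x))"
proof -
  have *: "AE x in M. \<exists>N. \<forall>L. cmod (S b (N + L) x - S b N x) < e" if "e > 0" for e
  proof -
    define D where "D N = {x \<in> space M. \<exists>L. e \<le> cmod (S (\<lambda>j. b (N + j)) L x)}" for N
    have [measurable]: "D N \<in> sets M" for N
      unfolding D_def by measurable
    define Z where "Z = {x \<in> space M. \<forall>N. \<exists>L. e \<le> cmod (S b (N + L) x - S b N x)}"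
    have [measurable]: "Z \<in> sets M"
      unfolding Z_def by measurable
    define K where "K = (\<integral>x. (cmod (X x))\<^sup>2 \<partial>M)"
    have le: "(e/2)\<^sup>2 * prob Z \<le> (\<Sum>j. (cmod (b (j + N)))\<^sup>2) * K" for N
    proof -
      \<comment> \<open>The sums after N are those of the shifted coefficients at
        \<open>(T ^^ N) x\<close>, and \<open>T ^^ N\<close> preserves \<open>M\<close>; so
        \<open>prob Z\<close> is bounded through arbitrarily late tails of the coefficients.\<close>
      have "Z \<subseteq> (T ^^ N) -` D N \<inter> space M"
        using measurable_space[OF measurable_T_pow, of _ N] by (auto simp: Z_def D_def S_add)
      then have "prob Z \<le> prob ((T ^^ N) -` D N \<inter> space M)"
        by (intro finite_measure_mono) auto
      also have "\<dots> = prob (D N)"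
        using measure_distr[of "T ^^ N" M M "D N"] by (simp add: distr_T_pow)
      finally have "(e/2)\<^sup>2 * prob Z \<le> (e/2)\<^sup>2 * prob (D N)"
        by (intro mult_left_mono) auto
      also have "\<dots> \<le> (\<Sum>j. (cmod (b (N + j)))\<^sup>2) * K"
        using prob_oscillation[of "e/2" "\<lambda>j. b (N + j)"] that sum summable_iff_shift[of "\<lambda>j. (cmod (b j))\<^sup>2" N]
        by (simp add: K_def D_def add.commute)
      finally show ?thesis
        by (simp add: add.commute)
    qed
    have "(\<lambda>N. (\<Sum>j. (cmod (b (j + N)))\<^sup>2) * K) \<longlonglongrightarrow> 0 * K"
      by (intro tendsto_intros suminf_exist_split2 sum)
    then have "(e/2)\<^sup>2 * prob Z \<le> 0 * K"
      by (rule LIMSEQ_le_const) (use le in auto)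
    then have "prob Z = 0"
      using that measure_nonneg[of M Z] by (simp add: mult_le_0_iff not_le)
    then have "Z \<in> null_sets M"
      by (auto simp: emeasure_eq_measure)
    then show ?thesis
      by (rule AE_I') (auto simp: Z_def simp flip: not_le)
  qed
  have "AE x in M. \<forall>k::nat. \<exists>N. \<forall>L. cmod (S b (N + L) x - S b N x) < inverse (Suc k)"
    unfolding AE_all_countable using * by auto
  then show ?thesis
  proof eventually_elim
    case (elim x)
    have "Cauchy (\<lambda>n. S b n x)"
      unfolding Cauchy_altdef2
    proof (intro allI impI)
      fix e :: real assume "e > 0"
      then obtain k where k: "inverse (real (Suc k)) < e"
        using reals_Archimedean by blast
      from elim obtain N where "\<forall>L. cmod (S b (N + L) x - S b N x) < inverse (Suc k)"
        by blast
      then have "\<forall>n\<ge>N. dist (S b n x) (S b N x) < e"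
        using k by (metis dist_norm le_Suc_ex less_trans)
      then show "\<exists>N. \<forall>n\<ge>N. dist (S b n x) (S b N x) < e"
        by blast
    qed
    then show ?case
      unfolding summable_iff_convergent S_def by (simp add: Cauchy_convergent_iff)
  qed
qed

end

section \<open>The maximal function\<close>

lemma sin_ge_quarter:
  assumes "0 \<le> x" "x \<le> pi / 2"
  shows "x / 4 \<le> sin x"
proof (cases "x \<le> pi / 3")
  case True
  show ?thesis
  proof (cases "x = 0")
    case False
    then obtain c where c: "0 < c" "c < x" "sin x - sin 0 = (x - 0) * cos c"
      using MVT2[of 0 x sin cos] assms by (auto intro!: derivative_eq_intros)
    have "cos (pi / 3) \<le> cos c"
      using c True by (intro cos_monotone_0_pi_le) auto
    then have "x * (1/2) \<le> x * cos c"
      using assms by (intro mult_left_mono) (auto simp: cos_60)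
    then show ?thesis
      using c assms by simp
  qed simp
next
  case False
  have "sin (pi/3) \<le> sin x"
    using False assms by (intro sin_monotone_2pi_le) auto
  moreover have "(1/2::real) \<le> sqrt 3 / 2"
    by simp
  ultimately show ?thesis
    using assms pi_half_less_two unfolding sin_60 by linarith
qed

lemma cmod_cis_diff: "cmod (cis s - cis t) = 2 * \<bar>sin ((s - t) / 2)\<bar>"
proof -
  have "cis s - cis t = cis t * (cis (s - t) - 1)"
    by (simp add: algebra_simps cis_mult)
  then have "cmod (cis s - cis t) = cmod (cis (s - t) - 1)"
    by (simp add: norm_mult)
  then show ?thesis
    using dist_exp_i_1[of "s - t"] by (simp add: cis_conv_exp)
qed

text \<open>The wrap-around case: for small t the half-angle x is close to \<pi>, so s and p lie
  near opposite ends of the parameter interval and are close only modulo 2 \<pi>.\<close>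

lemma angle_near:
  fixes p s t x :: real
  assumes "\<bar>s - p\<bar> / 2 = x" "pi - x \<le> 2 * t" "0 \<le> s" "s \<le> 2 * pi" "0 \<le> p" "p < 2 * pi"
  shows "\<bar>s - (p + 2*pi)\<bar> \<le> 4 * t \<or> \<bar>s - (p - 2*pi)\<bar> \<le> 4 * t"
proof (cases "s \<ge> p")
  case True
  then have "\<bar>s - (p + 2*pi)\<bar> = p + 2 * pi - s" "x = (s - p) / 2"
    using assms by auto
  then show ?thesis using assms by simp
next
  case False
  then have "\<bar>s - (p - 2*pi)\<bar> = s - (p - 2 * pi)" "x = (p - s) / 2"
    using assms by auto
  then show ?thesis using assms by simp
qed

text \<open>A chord of length at most t gives sin x \<le> t / 2 for the half-angle x, hence x \<le>
  2 t by \<open>sin_ge_quarter\<close>, or the same for \<pi> - x. The angles thus lie in three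
  intervals of length 8 t, two of them catching the wrap-around, and 24 t / (2 \<pi>) \<le> 6
  t.\<close>

lemma emeasure_circle_cball:
  assumes "cmod \<xi> = 1" "t > 0"
  shows "emeasure circle_measure (sphere 0 1 \<inter> cball \<xi> t) \<le> ennreal (6 * t)"
proof -
  define p where "p = Arg2pi \<xi>"
  have p: "\<xi> = cis p" "0 \<le> p" "p < 2 * pi"
    using Arg2pi[of \<xi>] assms by (auto simp: p_def cis_conv_exp is_Arg_def)
  have m: "sphere 0 1 \<inter> cball \<xi> t \<in> sets circle_measure"
    by (auto simp: sets_restrict_space)
  have sub: "cis s \<in> cball \<xi> t \<and> s \<in> {0..2*pi} \<Longrightarrow> s \<in> cball p (4*t) \<union> cball (p + 2*pi) (4*t) \<union> cball (p - 2*pi) (4*t)" for s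
  proof -
    assume s: "cis s \<in> cball \<xi> t \<and> s \<in> {0..2*pi}"
    define x where "x = \<bar>s - p\<bar> / 2"
    have x: "0 \<le> x" "x \<le> pi"
      using s p by (auto simp: x_def)
    have "\<bar>sin ((s - p) / 2)\<bar> = \<bar>sin x\<bar>"
    proof (cases "s \<ge> p")
      case False
      then have "(s - p) / 2 = - x"
        by (simp add: x_def field_simps)
      then show ?thesis
        by simp
    qed (simp add: x_def)
    then have sx: "sin x \<le> t / 2"
      using s p cmod_cis_diff[of s p] sin_ge_zero[OF x] by (simp add: dist_norm norm_minus_commute)
    show ?thesis
    proof (cases "x \<le> pi / 2")
      case True
      then have "x \<le> 2 * t"
        using sin_ge_quarter[of x] x sx by linarith
      then show ?thesis
        by (auto simp: x_def dist_real_def)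
    next
      case False
      then have "pi - x \<le> 2 * t"
        using sin_ge_quarter[of "pi - x"] x sx by simp
      then have "\<bar>s - (p + 2*pi)\<bar> \<le> 4 * t \<or> \<bar>s - (p - 2*pi)\<bar> \<le> 4 * t"
        using s p by (intro angle_near[OF x_def[symmetric]]) auto
      then show ?thesis
        by (auto simp: dist_real_def abs_minus_commute)
    qed
  qed
  have "emeasure circle_measure (sphere 0 1 \<inter> cball \<xi> t) =
      (\<integral>\<^sup>+\<eta>. indicator (sphere 0 1 \<inter> cball \<xi> t) \<eta> \<partial>circle_measure)"
    using m by simp
  also have "\<dots> = (\<integral>\<^sup>+s. indicator (sphere 0 1 \<inter> cball \<xi> t) (cis s) * indicator {0..2*pi} s \<partial>lborel) / ennreal (2*pi)"
    using m by (intro nn_integral_circle_measure) auto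
  also have "\<dots> \<le> (\<integral>\<^sup>+s. indicator (cball p (4*t) \<union> cball (p + 2*pi) (4*t) \<union> cball (p - 2*pi) (4*t)) s \<partial>lborel) / ennreal (2*pi)"
    using sub by (intro divide_right_mono_ennreal nn_integral_mono) (auto simp: indicator_def)
  also have "\<dots> = emeasure lborel (cball p (4*t) \<union> cball (p + 2*pi) (4*t) \<union> cball (p - 2*pi) (4*t)) / ennreal (2*pi)"
    by simp
  also have "\<dots> \<le> (emeasure lborel (cball p (4*t)) + emeasure lborel (cball (p + 2*pi) (4*t)) + emeasure lborel (cball (p - 2*pi) (4*t))) / ennreal (2*pi)"
    by (intro divide_right_mono_ennreal order_trans[OF emeasure_subadditive] add_mono emeasure_subadditive) auto
  also have "\<dots> = ennreal (24 * t) / ennreal (2*pi)"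
    using assms by (simp add: cball_eq_atLeastAtMost ennreal_plus[symmetric] del: ennreal_plus)
  also have "\<dots> = ennreal (24 * t / (2 * pi))"
    using assms by (intro divide_ennreal) auto
  also have "\<dots> \<le> ennreal (6 * t)"
    using assms pi_ge_two by (intro ennreal_leI) (auto simp: field_simps)
  finally show ?thesis .
qed

section \<open>Vitali covering and the weak type inequality\<close>

lemma emeasure_UN_le:
  assumes [simp]: "countable I" and [measurable]: "\<And>i. i \<in> I \<Longrightarrow> X i \<in> sets M"
  shows "emeasure M (\<Union>(X ` I)) \<le> (\<integral>\<^sup>+i. emeasure M (X i) \<partial>count_space I)"
proof -
  have [measurable]: "\<Union>(X ` I) \<in> sets M"
    by (intro sets.countable_UN') auto
  have "emeasure M (\<Union>(X ` I)) = (\<integral>\<^sup>+x. indicator (\<Union>(X ` I)) x \<partial>M)"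
    by simp
  also have "\<dots> \<le> (\<integral>\<^sup>+x. \<integral>\<^sup>+i. indicator (X i) x \<partial>count_space I \<partial>M)"
  proof (rule nn_integral_mono)
    fix x
    show "indicator (\<Union>(X ` I)) x \<le> (\<integral>\<^sup>+i. indicator (X i) x \<partial>count_space I)"
    proof (cases "x \<in> \<Union>(X ` I)")
      case True
      then obtain i where i: "i \<in> I" "x \<in> X i" by auto
      have "(1::ennreal) = (\<integral>\<^sup>+j. indicator {i} j \<partial>count_space I)"
        using i by simp
      also have "\<dots> \<le> (\<integral>\<^sup>+i. indicator (X i) x \<partial>count_space I)"
        using i by (intro nn_integral_mono) (auto simp: indicator_def)
      finally show ?thesis using True by simp
    qed simp
  qed
  also have "\<dots> = (\<integral>\<^sup>+i. \<integral>\<^sup>+x. indicator (X i) x \<partial>M \<partial>count_space I)"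
    by (rule nn_integral_count_space_nn_integral) auto
  also have "\<dots> = (\<integral>\<^sup>+i. emeasure M (X i) \<partial>count_space I)"
    by (intro nn_integral_cong) auto
  finally show ?thesis .
qed

text \<open>The Hardy-Littlewood inequality with a measurable set \<open>N\<close> covering the
  superlevel set of the maximal function, whose own measurability is then not at issue.
  \<open>N\<close> is a union of five-fold enlarged Vitali balls, and 30 is 5 times the 6 of
  \<open>emeasure_circle_cball\<close>. Averages are taken relative to the radius t, not to the arc
  measure.\<close>

lemma weak_type_maximal:
  fixes h :: "complex \<Rightarrow> ennreal"
  assumes h: "h \<in> borel_measurable circle_measure" and fin: "(\<integral>\<^sup>+\<eta>. h \<eta> \<partial>circle_measure) = ennreal I" "I \<ge> 0"
    and l: "l > 0"
  obtains N where "N \<in> sets circle_measure" "emeasure circle_measure N \<le> ennreal (30 * I / l)"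
    "\<And>\<xi> t. cmod \<xi> = 1 \<Longrightarrow> t > 0 \<Longrightarrow> \<xi> \<notin> N \<Longrightarrow> (\<integral>\<^sup>+\<eta>. h \<eta> * indicator (cball \<xi> t) \<eta> \<partial>circle_measure) \<le> ennreal (l * t)"
proof -
  define K where "K = {(\<xi>, t). cmod \<xi> = 1 \<and> t > 0 \<and> ennreal (l * t) < (\<integral>\<^sup>+\<eta>. h \<eta> * indicator (cball \<xi> t) \<eta> \<partial>circle_measure)}"
  \<comment> \<open>Vitali's lemma asks for bounded radii; the finite integral of \<open>h\<close>
    provides the bound.\<close>
  have bd: "t \<le> I / l" if "(\<xi>, t) \<in> K" for \<xi> t
  proof -
    have "ennreal (l * t) < (\<integral>\<^sup>+\<eta>. h \<eta> * indicator (cball \<xi> t) \<eta> \<partial>circle_measure)"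
      using that by (auto simp: K_def)
    also have "\<dots> \<le> (\<integral>\<^sup>+\<eta>. h \<eta> \<partial>circle_measure)"
      by (intro nn_integral_mono) (auto simp: indicator_def)
    finally have "l * t < I"
      using fin l that by (auto simp: K_def ennreal_less_iff)
    then show ?thesis
      using l by (simp add: field_simps)
  qed
  have bd': "0 < snd i \<and> snd i \<le> I / l" if "i \<in> K" for i
    using that bd[of "fst i" "snd i"] by (simp add: K_def case_prod_unfold)
  have sub: "fst ` K \<subseteq> (\<Union>i\<in>K. cball (fst i) (snd i))"
  proof (rule image_subsetI)
    fix i assume "i \<in> K"
    moreover from bd'[OF this] have "fst i \<in> cball (fst i) (snd i)"
      by simp
    ultimately show "fst i \<in> (\<Union>i\<in>K. cball (fst i) (snd i))"
      by blast
  qed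
  obtain C where C: "countable C" "C \<subseteq> K"
     "pairwise (\<lambda>i j. disjnt (cball (fst i) (snd i)) (cball (fst j) (snd j))) C"
     "fst ` K \<subseteq> (\<Union>i\<in>C. cball (fst i) (5 * snd i))"
    by (rule Vitali_covering_lemma_cballs[OF sub bd'])
  \<comment> \<open>As a measure, \<open>Q\<close> adds up over the disjoint Vitali balls and stays
    below its total mass \<open>I\<close>.\<close>
  define Q where "Q = density circle_measure h"
  have m: "sphere 0 1 \<inter> cball x t \<in> sets circle_measure" for x t
    by (auto simp: sets_restrict_space)
  define N where "N = (\<Union>i\<in>C. sphere 0 1 \<inter> cball (fst i) (5 * snd i))"
  have N: "N \<in> sets circle_measure"
    unfolding N_def using C(1) m by (intro sets.countable_UN') auto
  have Qm: "emeasure Q (sphere 0 1 \<inter> cball x t) = (\<integral>\<^sup>+\<eta>. h \<eta> * indicator (cball x t) \<eta> \<partial>circle_measure)" for x t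
    unfolding Q_def using m h by (subst emeasure_density) (auto intro!: nn_integral_cong simp: indicator_def)
  have "emeasure circle_measure N \<le> (\<integral>\<^sup>+i. emeasure circle_measure (sphere 0 1 \<inter> cball (fst i) (5 * snd i)) \<partial>count_space C)"
    unfolding N_def by (intro emeasure_UN_le C m)
  also have "\<dots> \<le> (\<integral>\<^sup>+i. ennreal (30 / l) * emeasure Q (sphere 0 1 \<inter> cball (fst i) (snd i)) \<partial>count_space C)"
  proof (rule nn_integral_mono)
    fix i assume "i \<in> space (count_space C)"
    then have i: "i \<in> K"
      using C by auto
    have "emeasure circle_measure (sphere 0 1 \<inter> cball (fst i) (5 * snd i)) \<le> ennreal (6 * (5 * snd i))"
      using i by (intro emeasure_circle_cball) (auto simp: K_def)
    also have "\<dots> = ennreal (30 / l) * ennreal (l * snd i)"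
      using l i by (subst ennreal_mult[symmetric]) (auto simp: K_def field_simps)
    also have "\<dots> \<le> ennreal (30 / l) * emeasure Q (sphere 0 1 \<inter> cball (fst i) (snd i))"
      using i by (intro mult_left_mono) (auto simp: Qm K_def)
    finally show "emeasure circle_measure (sphere 0 1 \<inter> cball (fst i) (5 * snd i)) \<le> \<dots>" .
  qed
  also have "\<dots> = ennreal (30 / l) * (\<integral>\<^sup>+i. emeasure Q (sphere 0 1 \<inter> cball (fst i) (snd i)) \<partial>count_space C)"
    by (rule nn_integral_cmult) auto
  also have "(\<integral>\<^sup>+i. emeasure Q (sphere 0 1 \<inter> cball (fst i) (snd i)) \<partial>count_space C)
     = emeasure Q (\<Union>i\<in>C. sphere 0 1 \<inter> cball (fst i) (snd i))"
  proof (intro emeasure_UN_countable[symmetric] C)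
    show "disjoint_family_on (\<lambda>i. sphere 0 1 \<inter> cball (fst i) (snd i)) C"
      unfolding disjoint_family_on_def
    proof (intro ballI impI)
      fix i j assume "i \<in> C" "j \<in> C" "i \<noteq> j"
      then have "disjnt (cball (fst i) (snd i)) (cball (fst j) (snd j))"
        using C(3) by (simp add: pairwise_def)
      then show "sphere 0 1 \<inter> cball (fst i) (snd i) \<inter> (sphere 0 1 \<inter> cball (fst j) (snd j)) = {}"
        unfolding disjnt_def by blast
    qed
  qed (use m in \<open>auto simp: Q_def\<close>)
  also have "\<dots> \<le> emeasure Q (space Q)"
    by (rule emeasure_space)
  also have "\<dots> = (\<integral>\<^sup>+\<eta>. h \<eta> * indicator (space circle_measure) \<eta> \<partial>circle_measure)"
    unfolding Q_def space_density by (intro emeasure_density h sets.top)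
  also have "\<dots> = (\<integral>\<^sup>+\<eta>. h \<eta> \<partial>circle_measure)"
    by (intro nn_integral_cong) auto
  also have "\<dots> = ennreal I"
    by (rule fin)
  also have "ennreal (30 / l) * ennreal I = ennreal (30 * I / l)"
    using l fin by (subst ennreal_mult[symmetric]) auto
  finally have le: "emeasure circle_measure N \<le> ennreal (30 * I / l)"
    by (simp add: mult_left_mono)
  show ?thesis
  proof (rule that[OF N le])
    fix \<xi> :: complex and t :: real
    assume *: "cmod \<xi> = 1" "t > 0" "\<xi> \<notin> N"
    show "(\<integral>\<^sup>+\<eta>. h \<eta> * indicator (cball \<xi> t) \<eta> \<partial>circle_measure) \<le> ennreal (l * t)"
    proof (rule ccontr)
      assume "\<not> ?thesis"
      then have "(\<xi>, t) \<in> K"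
        using * by (auto simp: K_def)
      then have "\<xi> \<in> (\<Union>i\<in>C. cball (fst i) (5 * snd i))"
        using C(4) by force
      then show False
        using * by (auto simp: N_def)
    qed
  qed
qed

section \<open>Domination of Poisson integrals by the maximal function\<close>

lemma le_suminf_ennreal: "f k \<le> (\<Sum>k. f k :: ennreal)"
  using sum_le_suminf[OF summableI, of "{k}" f] by simp

text \<open>Put d = 1 - r and sort \<eta> by the least k with |\<eta> - \<xi>| \<le> 2^k d. For k =
  0 the kernel is at most 2 / d. For k > 0 minimality gives |\<eta> - r \<xi>| \<ge> 2^k d / 4, and
  2 d / (2^k d / 4)^2 is the coefficient 32 / (4^k d).\<close>

lemma poisson_kernel_radial_le:
  assumes "cmod \<xi> = 1" "cmod \<eta> = 1" "0 \<le> r" "r < 1"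
  shows "ennreal (poisson_kernel (of_real r * \<xi>) \<eta>) \<le>
     (\<Sum>k. ennreal (32 / (4 ^ k * (1 - r))) * indicator (cball \<xi> (2 ^ k * (1 - r))) \<eta>)"
proof -
  define d where "d = 1 - r"
  define D where "D = cmod (\<eta> - \<xi>)"
  define R where "R = cmod (\<eta> - of_real r * \<xi>)"
  have d: "0 < d" "d \<le> 1"
    using assms by (auto simp: d_def)
  have nr: "cmod (of_real r * \<xi>) = r"
    using assms by (simp add: norm_mult)
  have R1: "d \<le> R"
    using norm_triangle_ineq2[of \<eta> "of_real r * \<xi>"] nr assms by (simp add: R_def d_def)
  have "\<xi> - of_real r * \<xi> = of_real d * \<xi>"
    by (simp add: d_def algebra_simps)
  then have "cmod (\<xi> - of_real r * \<xi>) = d"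
    using assms d by (simp add: norm_mult)
  then have "D \<le> R + d"
    using norm_triangle_ineq[of "\<eta> - of_real r * \<xi>" "of_real r * \<xi> - \<xi>"]
    by (simp add: D_def R_def norm_minus_commute)
  with R1 have R2: "D \<le> 2 * R"
    by simp
  have num: "1 - r\<^sup>2 \<le> 2 * d"
    using zero_le_power2[of "1 - r"] by (simp add: d_def power2_eq_square algebra_simps)
  have P: "poisson_kernel (of_real r * \<xi>) \<eta> \<le> 2 * d / s\<^sup>2" if "0 < s" "s \<le> R" for s
  proof -
    have "poisson_kernel (of_real r * \<xi>) \<eta> = (1 - r\<^sup>2) / R\<^sup>2"
      by (simp add: poisson_kernel_def nr R_def)
    also have "\<dots> \<le> 2 * d / s\<^sup>2"
      using num that d by (intro frac_le power_mono) auto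
    finally show ?thesis .
  qed
  have "\<exists>k. D \<le> 2 ^ k * d \<and> poisson_kernel (of_real r * \<xi>) \<eta> \<le> 32 / (4 ^ k * d)"
  proof (cases "D \<le> d")
    case True
    have "poisson_kernel (of_real r * \<xi>) \<eta> \<le> 2 * d / d\<^sup>2"
      using R1 d by (intro P) auto
    also have "\<dots> \<le> 32 / d"
      using d by (simp add: power2_eq_square divide_simps)
    finally show ?thesis
      using True by (intro exI[of _ 0]) simp
  next
    case False
    obtain k0 :: nat where "D / d < 2 ^ k0"
      using real_arch_pow[of 2 "D / d"] by auto
    then have ex: "D \<le> 2 ^ k0 * d"
      using d by (simp add: field_simps)
    define k where "k = (LEAST k. D \<le> 2 ^ k * d)"
    have k: "D \<le> 2 ^ k * d"
      unfolding k_def using ex by (rule LeastI)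
    with False obtain j where j: "k = Suc j"
      by (cases k) auto
    have "\<not> D \<le> 2 ^ j * d"
      using not_less_Least[of j "\<lambda>k. D \<le> 2 ^ k * d"] j by (simp add: k_def)
    then have "2 ^ j * d / 2 \<le> R"
      using R2 by simp
    then have "poisson_kernel (of_real r * \<xi>) \<eta> \<le> 2 * d / (2 ^ j * d / 2)\<^sup>2"
      using d by (intro P) auto
    also have "\<dots> = 32 / (4 ^ k * d)"
      using d by (simp add: j power2_eq_square power_mult_distrib field_simps flip: power_mult_distrib)
    finally show ?thesis
      using k by blast
  qed
  then obtain k where k: "D \<le> 2 ^ k * d" "poisson_kernel (of_real r * \<xi>) \<eta> \<le> 32 / (4 ^ k * d)"
    by blast
  let ?f = "\<lambda>k. ennreal (32 / (4 ^ k * (1 - r))) * indicator (cball \<xi> (2 ^ k * (1 - r))) \<eta>"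
  have "ennreal (poisson_kernel (of_real r * \<xi>) \<eta>) \<le> ?f k"
    using k by (auto simp: d_def D_def dist_norm norm_minus_commute intro!: ennreal_leI)
  also have "\<dots> \<le> (\<Sum>k. ?f k)"
    by (rule le_suminf_ennreal)
  finally show ?thesis .
qed

text \<open>The ball of index k has radius 2^k (1 - r), so with its coefficient it contributes at
  most 32 l / 2^k; the geometric series sums to 64 l.\<close>

lemma nn_integral_harm_radial_le:
  fixes h :: "complex \<Rightarrow> ennreal"
  assumes [measurable]: "h \<in> borel_measurable circle_measure" and \<xi>: "cmod \<xi> = 1" and r: "0 \<le> r" "r < 1" and l: "0 \<le> l"
    and max: "\<And>t. t > 0 \<Longrightarrow> (\<integral>\<^sup>+\<eta>. h \<eta> * indicator (cball \<xi> t) \<eta> \<partial>circle_measure) \<le> ennreal (l * t)"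
  shows "(\<integral>\<^sup>+\<eta>. h \<eta> \<partial>harm (of_real r * \<xi>)) \<le> ennreal (64 * l)"
proof -
  let ?c = "\<lambda>k::nat. ennreal (32 / (4 ^ k * (1 - r)))"
  let ?b = "\<lambda>k::nat. cball \<xi> (2 ^ k * (1 - r))"
  have m [measurable]: "(\<lambda>\<eta>. indicator (?b k) \<eta> :: ennreal) \<in> borel_measurable circle_measure" for k
    by (intro measurable_circle_borel borel_measurable_indicator) auto
  have "(\<integral>\<^sup>+\<eta>. h \<eta> \<partial>harm (of_real r * \<xi>)) = (\<integral>\<^sup>+\<eta>. ennreal (poisson_kernel (of_real r * \<xi>) \<eta>) * h \<eta> \<partial>circle_measure)"
    by (rule nn_integral_harm) measurable
  also have "\<dots> \<le> (\<integral>\<^sup>+\<eta>. (\<Sum>k. ?c k * indicator (?b k) \<eta>) * h \<eta> \<partial>circle_measure)"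
    using \<xi> r by (intro nn_integral_mono mult_right_mono poisson_kernel_radial_le) auto
  also have "\<dots> = (\<integral>\<^sup>+\<eta>. (\<Sum>k. ?c k * (h \<eta> * indicator (?b k) \<eta>)) \<partial>circle_measure)"
    by (intro nn_integral_cong) (simp add: ennreal_suminf_multc[symmetric] mult_ac)
  also have "\<dots> = (\<Sum>k. \<integral>\<^sup>+\<eta>. ?c k * (h \<eta> * indicator (?b k) \<eta>) \<partial>circle_measure)"
    by (rule nn_integral_suminf) measurable
  also have "\<dots> = (\<Sum>k. ?c k * (\<integral>\<^sup>+\<eta>. h \<eta> * indicator (?b k) \<eta> \<partial>circle_measure))"
    by (subst nn_integral_cmult) measurable
  also have "\<dots> \<le> (\<Sum>k. ennreal (32 * l * (1 / 2) ^ k))"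
  proof (intro suminf_le allI)
    fix k
    have "?c k * (\<integral>\<^sup>+\<eta>. h \<eta> * indicator (?b k) \<eta> \<partial>circle_measure) \<le> ?c k * ennreal (l * (2 ^ k * (1 - r)))"
      using r by (intro mult_left_mono max) auto
    also have "\<dots> = ennreal (32 / (4 ^ k * (1 - r)) * (l * (2 ^ k * (1 - r))))"
      using r l by (subst ennreal_mult) auto
    also have "32 / (4 ^ k * (1 - r)) * (l * (2 ^ k * (1 - r))) = 32 * l * (2 ^ k / 4 ^ k)"
      using r by (simp add: field_simps)
    also have "(2 ^ k / 4 ^ k :: real) = (1 / 2) ^ k"
      by (simp add: power_divide[symmetric])
    finally show "?c k * (\<integral>\<^sup>+\<eta>. h \<eta> * indicator (?b k) \<eta> \<partial>circle_measure) \<le> ennreal (32 * l * (1 / 2) ^ k)" .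
  qed auto
  also have "\<dots> = ennreal (64 * l)"
  proof -
    have "(\<lambda>k. 32 * l * (1 / 2) ^ k) sums (32 * l * (1 / (1 - 1 / 2)))"
      by (intro sums_mult geometric_sums) auto
    then show ?thesis
      using l by (intro suminf_ennreal_eq) auto
  qed
  finally show ?thesis .
qed

text \<open>This reduces non-tangential maximal functions to radial ones.\<close>

lemma poisson_kernel_stolz_le:
  assumes z: "z \<in> stolz_region \<alpha> \<xi>" and \<xi>: "cmod \<xi> = 1" and \<eta>: "cmod \<eta> = 1"
  shows "poisson_kernel z \<eta> \<le> (\<alpha> + 2)\<^sup>2 * poisson_kernel (of_real (cmod z) * \<xi>) \<eta>"
proof -
  define w where "w = of_real (cmod z) * \<xi>"
  have z': "cmod z < 1" "cmod (z - \<xi>) < \<alpha> * (1 - cmod z)"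
    using z by (auto simp: stolz_region_def)
  have w: "cmod w = cmod z"
    using \<xi> by (simp add: w_def norm_mult)
  have "\<xi> - w = of_real (1 - cmod z) * \<xi>"
    by (simp add: w_def algebra_simps)
  then have "cmod (\<xi> - w) = 1 - cmod z"
    using \<xi> z' by (simp only: norm_mult norm_of_real) simp
  moreover have d: "1 - cmod z \<le> cmod (\<eta> - z)"
    using norm_triangle_ineq2[of \<eta> z] \<eta> by simp
  moreover have "cmod (\<eta> - w) \<le> cmod (\<eta> - z) + cmod (z - \<xi>) + cmod (\<xi> - w)"
    using norm_triangle_ineq[of "\<eta> - z" "z - \<xi>"] norm_triangle_ineq[of "\<eta> - \<xi>" "\<xi> - w"] by simp
  ultimately have "cmod (\<eta> - w) \<le> cmod (\<eta> - z) + \<alpha> * (1 - cmod z) + (1 - cmod z)"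
    using z' by simp
  moreover have "0 < \<alpha>"
    using z' norm_ge_zero[of "z - \<xi>"] by (smt (verit) mult_nonpos_nonneg)
  moreover have "\<alpha> * (1 - cmod z) \<le> \<alpha> * cmod (\<eta> - z)"
    using d \<open>0 < \<alpha>\<close> by (intro mult_left_mono) auto
  ultimately have le: "cmod (\<eta> - w) \<le> (\<alpha> + 2) * cmod (\<eta> - z)"
    using d by (simp add: algebra_simps)
  have pos: "0 < cmod (\<eta> - z)" "0 < cmod (\<eta> - w)"
    using z' w \<eta> by auto
  have "1 / (cmod (\<eta> - z))\<^sup>2 \<le> (\<alpha> + 2)\<^sup>2 / (cmod (\<eta> - w))\<^sup>2"
  proof -
    have "(cmod (\<eta> - w))\<^sup>2 \<le> (\<alpha> + 2)\<^sup>2 * (cmod (\<eta> - z))\<^sup>2"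
      using power_mono[OF le, of 2] by (simp add: power_mult_distrib)
    then show ?thesis
      using pos by (simp add: divide_simps mult.commute)
  qed
  then have "(1 - (cmod z)\<^sup>2) * (1 / (cmod (\<eta> - z))\<^sup>2) \<le> (1 - (cmod z)\<^sup>2) * ((\<alpha> + 2)\<^sup>2 / (cmod (\<eta> - w))\<^sup>2)"
    using z' by (intro mult_left_mono) (auto simp: abs_square_le_1)
  then show ?thesis
    unfolding poisson_kernel_def w_def[symmetric] w by (simp add: mult_ac)
qed

section \<open>Fatou's theorem\<close>

text \<open>Continuous functions that decrease to the indicator of a nonempty closed set; they link
  continuous test functions with closed sets. As \<open>infdist\<close> to the empty set is 0, the
  bumps of \<open>{}\<close> are constantly 1, so that case is treated apart.\<close>

definition closed_bump :: "complex set \<Rightarrow> nat \<Rightarrow> complex \<Rightarrow> real" where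
  "closed_bump K n x = max 0 (1 - real n * infdist x K)"

lemma continuous_on_closed_bump [continuous_intros]: "continuous_on A (closed_bump K n)"
  unfolding closed_bump_def by (intro continuous_intros)

lemma closed_bump_bounds: "0 \<le> closed_bump K n x" "closed_bump K n x \<le> 1"
  using infdist_nonneg[of x K] by (auto simp: closed_bump_def)

lemma closed_bump_tendsto:
  assumes "closed K" "K \<noteq> {}"
  shows "(\<lambda>n. closed_bump K n x) \<longlonglongrightarrow> indicator K x"
proof (cases "x \<in> K")
  case True
  then show ?thesis
    using assms by (simp add: closed_bump_def in_closed_iff_infdist_zero)
next
  case False
  then have "infdist x K > 0"
    using assms by (simp add: infdist_pos_not_in_closed)
  then obtain n0 :: nat where n0: "1 < real n0 * infdist x K"
    using reals_Archimedean3[of "infdist x K"] by blast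
  have "eventually (\<lambda>n. closed_bump K n x = 0) sequentially"
    using eventually_ge_at_top[of n0]
  proof eventually_elim
    case (elim n)
    then have "real n0 * infdist x K \<le> real n * infdist x K"
      using \<open>infdist x K > 0\<close> by simp
    with n0 show ?case
      by (simp add: closed_bump_def)
  qed
  then show ?thesis
    using False by (simp add: tendsto_eventually)
qed

section \<open>Density of the continuous functions in L1 of the circle\<close>

lemma bounded_continuous_circle:
  assumes "continuous_on (sphere 0 1) (g :: complex \<Rightarrow> 'b::real_normed_vector)"
  obtains B where "B \<ge> 0" "\<And>\<xi>. cmod \<xi> = 1 \<Longrightarrow> norm (g \<xi>) \<le> B"
proof -
  have "bounded (g ` sphere 0 1)"
    using assms by (intro compact_imp_bounded compact_continuous_image) auto
  then obtain B where B: "\<forall>x\<in>g ` sphere 0 1. norm x \<le> B"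
    by (auto simp: bounded_iff)
  show ?thesis
    by (rule that[of "max B 0"]) (use B in \<open>auto simp: le_max_iff_disj\<close>)
qed

lemma integrable_continuous_circle:
  assumes "continuous_on (sphere 0 1) (g :: complex \<Rightarrow> 'b::{banach, second_countable_topology})"
  shows "integrable circle_measure g"
proof -
  obtain B where "\<And>\<xi>. cmod \<xi> = 1 \<Longrightarrow> norm (g \<xi>) \<le> B"
    using bounded_continuous_circle[OF assms] by metis
  then show ?thesis
    by (intro circle.integrable_const_bound[of _ B] AE_I2 continuous_on_imp_measurable_circle assms) auto
qed

text \<open>Inner regularity reduces an indicator to that of a compact set, which the bumps of this
  set approximate; addition and dominated convergence extend this to all integrable
  functions.\<close>

lemma continuous_dense_circle:
  fixes u :: "complex \<Rightarrow> complex"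
  assumes "integrable circle_measure u" "e > 0"
  shows "\<exists>g. continuous_on (sphere 0 1) g \<and> (\<integral>\<xi>. cmod (u \<xi> - g \<xi>) \<partial>circle_measure) < e"
  using assms
proof (induction u arbitrary: e rule: integrable_induct)
  case (base A c)
  \<comment> \<open>Inner regularity is applied to a Borel measure on the whole plane, so the circle
    measure is carried there first.\<close>
  define Q where "Q = distr circle_measure borel (\<lambda>x. x)"
  have id: "(\<lambda>x. x) \<in> measurable circle_measure borel"
    by (rule measurable_circle_borel) simp
  have A: "A \<in> sets borel" "A \<subseteq> sphere 0 1"
    using base sets.sets_into_space[OF base(1)] by (auto simp: sets_restrict_space)
  have Q: "emeasure Q B = emeasure circle_measure (B \<inter> sphere 0 1)" if "B \<in> sets borel" for B
    unfolding Q_def using that by (subst emeasure_distr[OF id]) (auto simp: Int_commute)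
  \<comment> \<open>The total error will be at most 2 d |c|; the summand 1 keeps the denominator
    positive when c = 0.\<close>
  define d where "d = e / (2 * (cmod c + 1))"
  have d: "d > 0"
    unfolding d_def using base by (intro divide_pos_pos) (auto intro: add_nonneg_pos)
  have dc: "d * cmod c < e / 2"
  proof -
    have "cmod c + 1 > 0"
      by (intro add_nonneg_pos) auto
    then have "d * (cmod c + 1) = e / 2"
      by (simp add: d_def field_simps)
    then show ?thesis
      using d by (simp add: algebra_simps)
  qed
  have "emeasure Q A = (SUP K\<in>{K. K \<subseteq> A \<and> compact K}. emeasure Q K)"
    using A by (intro inner_regular) (auto simp: Q_def Q[unfolded Q_def] space_borel)
  moreover have "emeasure Q A < \<infinity>"
    using A by (simp add: Q less_top[symmetric])
  ultimately obtain K where K: "K \<subseteq> A" "compact K" "emeasure Q A < emeasure Q K + ennreal d"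
  proof -
    assume a: "emeasure Q A = (SUP K\<in>{K. K \<subseteq> A \<and> compact K}. emeasure Q K)" "emeasure Q A < \<infinity>"
    obtain K where "K \<in> {K. K \<subseteq> A \<and> compact K}" "emeasure Q A < emeasure Q K + ennreal d"
    proof -
      have "{} \<in> {K. K \<subseteq> A \<and> compact K}"
        by simp
      then have "{K. K \<subseteq> A \<and> compact K} \<noteq> {}"
        by blast
      from SUP_approx_ennreal[OF d this a(1)] a(2) that show thesis
        by (auto simp: less_top[symmetric])
    qed
    then show ?thesis
      using that by auto
  qed
  have Kb: "K \<in> sets borel"
    using K by (simp add: borel_compact)
  have Ks: "K \<in> sets circle_measure"
    using Kb K A by (auto simp: sets_restrict_space)
  have "emeasure circle_measure A < emeasure circle_measure K + ennreal d"
    using K A Kb by (simp add: Q Int_absorb2 subset_trans[OF K(1) A(2)])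
  then have mAK: "measure circle_measure A < measure circle_measure K + d"
    using d by (simp add: circle.emeasure_eq_measure ennreal_less_iff flip: ennreal_plus)
  have "\<exists>g. continuous_on (sphere 0 1) g \<and> (\<integral>\<xi>. \<bar>indicator K \<xi> - g \<xi>\<bar> \<partial>circle_measure) < d"
  proof (cases "K = {}")
    case True
    then show ?thesis
      using d by (intro exI[of _ "\<lambda>_. 0::real"]) auto
  next
    case False
    have "(\<lambda>n. \<integral>\<xi>. \<bar>indicator K \<xi> - closed_bump K n \<xi>\<bar> \<partial>circle_measure) \<longlonglongrightarrow> (\<integral>\<xi>. 0 \<partial>circle_measure)"
    proof (rule integral_dominated_convergence[where w="\<lambda>_. 1"])
      show "AE \<xi> in circle_measure. (\<lambda>n. \<bar>indicator K \<xi> - closed_bump K n \<xi>\<bar>) \<longlonglongrightarrow> 0"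
      proof (rule AE_I2)
        fix \<xi>
        show "(\<lambda>n. \<bar>indicator K \<xi> - closed_bump K n \<xi>\<bar>) \<longlonglongrightarrow> 0"
          using tendsto_rabs[OF tendsto_diff[OF tendsto_const closed_bump_tendsto[OF compact_imp_closed[OF K(2)] False]],
              of "indicator K \<xi>" \<xi>] by simp
      qed
      show "AE \<xi> in circle_measure. norm \<bar>indicator K \<xi> - closed_bump K n \<xi>\<bar> \<le> 1" for n
      proof (rule AE_I2)
        fix \<xi>
        show "norm \<bar>indicator K \<xi> - closed_bump K n \<xi>\<bar> \<le> 1"
          using closed_bump_bounds[of K n \<xi>] by (auto simp: indicator_def)
      qed
      have "closed_bump K n \<in> borel_measurable circle_measure" for n
        by (intro continuous_on_imp_measurable_circle continuous_intros)
      then show "(\<lambda>\<xi>. \<bar>indicator K \<xi> - closed_bump K n \<xi>\<bar>) \<in> borel_measurable circle_measure" for n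
        using Ks by measurable
    qed auto
    then have "\<forall>\<^sub>F n in sequentially. (\<integral>\<xi>. \<bar>indicator K \<xi> - closed_bump K n \<xi>\<bar> \<partial>circle_measure) < d"
      using d by (intro order_tendstoD) auto
    then obtain n where "(\<integral>\<xi>. \<bar>indicator K \<xi> - closed_bump K n \<xi>\<bar> \<partial>circle_measure) < d"
      by (auto simp: eventually_sequentially)
    then show ?thesis
      by (intro exI[of _ "closed_bump K n"]) (auto intro!: continuous_intros)
  qed
  then obtain g where g: "continuous_on (sphere 0 1) g" "(\<integral>\<xi>. \<bar>indicator K \<xi> - g \<xi>\<bar> \<partial>circle_measure) < d"
    by blast
  note ig = integrable_continuous_circle[OF g(1)]
  have iK: "integrable circle_measure (\<lambda>\<xi>. indicator K \<xi> :: real)"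
    using Ks by (simp add: circle.integrable_const_bound[of _ 1])
  have iA: "integrable circle_measure (\<lambda>\<xi>. indicator A \<xi> :: real)"
    using base by simp
  have "(\<integral>\<xi>. \<bar>indicator A \<xi> - g \<xi>\<bar> \<partial>circle_measure) \<le>
      (\<integral>\<xi>. (indicator A \<xi> - indicator K \<xi>) + \<bar>indicator K \<xi> - g \<xi>\<bar> \<partial>circle_measure)"
    using K(1) iA iK ig by (intro integral_mono) (auto simp: indicator_def)
  also have "\<dots> = measure circle_measure A - measure circle_measure K + (\<integral>\<xi>. \<bar>indicator K \<xi> - g \<xi>\<bar> \<partial>circle_measure)"
    using iA iK ig base(1) Ks Int_absorb2[OF A(2)] Int_absorb2[OF subset_trans[OF K(1) A(2)]]
    by (simp del: sets_circle_measure)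
  also have "\<dots> \<le> 2 * d"
    using mAK g(2) by simp
  finally have le: "(\<integral>\<xi>. \<bar>indicator A \<xi> - g \<xi>\<bar> \<partial>circle_measure) \<le> 2 * d" .
  have "(\<integral>\<xi>. cmod (indicator A \<xi> *\<^sub>R c - of_real (g \<xi>) * c) \<partial>circle_measure) = (\<integral>\<xi>. \<bar>indicator A \<xi> - g \<xi>\<bar> * cmod c \<partial>circle_measure)"
    by (intro Bochner_Integration.integral_cong refl)
      (simp add: scaleR_conv_of_real norm_mult flip: left_diff_distrib of_real_diff)
  also have "\<dots> = (\<integral>\<xi>. \<bar>indicator A \<xi> - g \<xi>\<bar> \<partial>circle_measure) * cmod c"
    by simp
  also have "\<dots> \<le> 2 * d * cmod c"
    using le by (intro mult_right_mono) auto
  also have "\<dots> < e"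
    using dc by simp
  finally show ?case
    using g(1) by (intro exI[of _ "\<lambda>\<xi>. of_real (g \<xi>) * c"]) (auto intro!: continuous_intros)
next
  case (add f g)
  obtain F where F: "continuous_on (sphere 0 1) F" "(\<integral>\<xi>. cmod (f \<xi> - F \<xi>) \<partial>circle_measure) < e/2"
    using add.IH(1)[of "e/2"] add.prems by auto
  obtain G where G: "continuous_on (sphere 0 1) G" "(\<integral>\<xi>. cmod (g \<xi> - G \<xi>) \<partial>circle_measure) < e/2"
    using add.IH(2)[of "e/2"] add.prems by auto
  have i: "integrable circle_measure F" "integrable circle_measure G" 
    using F G by (auto intro: integrable_continuous_circle)
  have "(\<integral>\<xi>. cmod (f \<xi> + g \<xi> - (F \<xi> + G \<xi>)) \<partial>circle_measure) \<le> (\<integral>\<xi>. cmod (f \<xi> - F \<xi>) + cmod (g \<xi> - G \<xi>) \<partial>circle_measure)"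
    using i add by (intro integral_mono) (auto simp: add_diff_add norm_triangle_ineq)
  also have "\<dots> < e"
    using i add F G by (subst Bochner_Integration.integral_add) auto
  finally show ?case
    using F G by (intro exI[of _ "\<lambda>\<xi>. F \<xi> + G \<xi>"]) (auto intro!: continuous_intros)
next
  case (lim u s)
  have "(\<lambda>i. \<integral>\<xi>. cmod (u \<xi> - s i \<xi>) \<partial>circle_measure) \<longlonglongrightarrow> (\<integral>\<xi>. 0 \<partial>circle_measure)"
  \<comment> \<open>The approximants of the induction rule satisfy |s i| \<le> 2 |u|, whence the
    majorant 3 |u|.\<close>
  proof (rule integral_dominated_convergence[where w="\<lambda>\<xi>. 3 * cmod (u \<xi>)"])
    show "AE \<xi> in circle_measure. (\<lambda>i. cmod (u \<xi> - s i \<xi>)) \<longlonglongrightarrow> 0"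
      using lim.hyps(2) by (intro AE_I2) (auto intro!: tendsto_eq_intros)
    show "AE \<xi> in circle_measure. norm (cmod (u \<xi> - s i \<xi>)) \<le> 3 * cmod (u \<xi>)" for i
    proof (rule AE_I2)
      fix \<xi> assume "\<xi> \<in> space circle_measure"
      then show "norm (cmod (u \<xi> - s i \<xi>)) \<le> 3 * cmod (u \<xi>)"
        using lim.hyps(3)[of \<xi> i] norm_triangle_ineq4[of "u \<xi>" "s i \<xi>"] by simp
    qed
  qed (use lim in auto)
  then have "\<forall>\<^sub>F i in sequentially. (\<integral>\<xi>. cmod (u \<xi> - s i \<xi>) \<partial>circle_measure) < e/2"
    using lim.prems by (intro order_tendstoD) auto
  then obtain i where i: "(\<integral>\<xi>. cmod (u \<xi> - s i \<xi>) \<partial>circle_measure) < e/2"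
    by (auto simp: eventually_sequentially)
  obtain G where G: "continuous_on (sphere 0 1) G" "(\<integral>\<xi>. cmod (s i \<xi> - G \<xi>) \<partial>circle_measure) < e/2"
    using lim.IH[of "e/2" i] lim.prems by auto
  have "(\<integral>\<xi>. cmod (u \<xi> - G \<xi>) \<partial>circle_measure) \<le> (\<integral>\<xi>. cmod (u \<xi> - s i \<xi>) + cmod (s i \<xi> - G \<xi>) \<partial>circle_measure)"
  proof (rule integral_mono)
    show "cmod (u \<xi> - G \<xi>) \<le> cmod (u \<xi> - s i \<xi>) + cmod (s i \<xi> - G \<xi>)" for \<xi>
      using norm_triangle_ineq[of "u \<xi> - s i \<xi>" "s i \<xi> - G \<xi>"] by simp
  qed (use lim G integrable_continuous_circle[OF G(1)] in auto)
  also have "\<dots> < e"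
    using i G lim integrable_continuous_circle[OF G(1)] by (subst Bochner_Integration.integral_add) auto
  finally show ?case
    using G by blast
qed

section \<open>Boundary behaviour of Poisson integrals\<close>

lemma measurable_harm_iff [simp]: "u \<in> borel_measurable (harm z) \<longleftrightarrow> u \<in> borel_measurable circle_measure"
  by (simp add: harm_def)

lemma integrable_harm:
  fixes u :: "complex \<Rightarrow> 'b::{banach, second_countable_topology}"
  assumes "integrable circle_measure u" "cmod z < 1"
  shows "integrable (harm z) u"
proof -
  have "integrable circle_measure (\<lambda>\<xi>. poisson_kernel z \<xi> *\<^sub>R u \<xi>)"
  proof (rule Bochner_Integration.integrable_bound)
    show "integrable circle_measure (\<lambda>\<xi>. (2 / (1 - cmod z)) *\<^sub>R u \<xi>)"
      using assms by simp
    show "(\<lambda>\<xi>. poisson_kernel z \<xi> *\<^sub>R u \<xi>) \<in> borel_measurable circle_measure"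
      using assms borel_measurable_integrable by (intro borel_measurable_scaleR) auto
    show "AE \<xi> in circle_measure. norm (poisson_kernel z \<xi> *\<^sub>R u \<xi>) \<le> norm ((2 / (1 - cmod z)) *\<^sub>R u \<xi>)"
    proof (rule AE_I2)
      fix \<xi> assume "\<xi> \<in> space circle_measure"
      then have "poisson_kernel z \<xi> * norm (u \<xi>) \<le> 2 / (1 - cmod z) * norm (u \<xi>)"
        using assms(2) by (intro mult_right_mono poisson_kernel_le) auto
      then show "norm (poisson_kernel z \<xi> *\<^sub>R u \<xi>) \<le> norm ((2 / (1 - cmod z)) *\<^sub>R u \<xi>)"
        using assms(2) poisson_kernel_nonneg[OF assms(2), of \<xi>] by simp
    qed
  qed
  then show ?thesis
    unfolding harm_def using assms
    by (subst integrable_density) (auto simp: poisson_kernel_nonneg)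
qed

lemma tendsto_poisson_integral_continuous:
  fixes g :: "complex \<Rightarrow> complex"
  assumes g: "continuous_on (sphere 0 1) g" and \<xi>: "cmod \<xi> = 1"
  shows "((\<lambda>z. \<integral>\<eta>. g \<eta> \<partial>harm z) \<longlongrightarrow> g \<xi>) (at \<xi> within ball 0 1)"
proof (rule tendstoI)
  fix e :: real assume "e > 0"
  obtain B where B: "B \<ge> 0" "\<And>\<xi>. cmod \<xi> = 1 \<Longrightarrow> cmod (g \<xi>) \<le> B"
    using bounded_continuous_circle[OF g] by metis
  obtain d where d: "d > 0" "\<And>\<eta>. cmod \<eta> = 1 \<Longrightarrow> dist \<eta> \<xi> < d \<Longrightarrow> dist (g \<eta>) (g \<xi>) < e / 2"
    using g \<xi> \<open>e > 0\<close> unfolding continuous_on_iff by (metis half_gt_zero mem_sphere_0)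
  \<comment> \<open>With \<delta> = |z - \<xi>|, points \<eta> far from \<xi> cost at most 16 B
    \<delta> / d^2, since there |\<eta> - z| \<ge> d / 2 and 1 - |z|^2 \<le> 2 \<delta>. The second
    entry of the minimum makes this less than e / 2; B + 1 keeps its denominator positive.\<close>
  define s where "s = min (d / 2) (e * d\<^sup>2 / (32 * (B + 1)))"
  have s: "s > 0"
    using B d \<open>e > 0\<close> by (auto simp: s_def)
  have "dist (\<integral>\<eta>. g \<eta> \<partial>harm z) (g \<xi>) < e" if z: "z \<in> ball 0 1" "dist z \<xi> < s" for z
  proof -
    have z1: "cmod z < 1"
      using z by simp
    interpret hz: prob_space "harm z"
      by (rule prob_space_harm[OF z1])
    have ig: "integrable (harm z) g"
      by (intro integrable_harm integrable_continuous_circle g z1)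
    have num: "1 - (cmod z)\<^sup>2 \<le> 2 * dist z \<xi>"
    proof -
      have "1 - cmod z \<le> dist z \<xi>"
        using norm_triangle_ineq2[of \<xi> z] \<xi> by (simp add: dist_norm norm_minus_commute)
      moreover have "1 - (cmod z)\<^sup>2 \<le> 2 * (1 - cmod z)"
        using zero_le_power2[of "1 - cmod z"] by (simp add: power2_eq_square algebra_simps)
      ultimately show ?thesis by simp
    qed
    have pt: "poisson_kernel z \<eta> * cmod (g \<eta> - g \<xi>) \<le> e / 2 * poisson_kernel z \<eta> + 16 * B * dist z \<xi> / d\<^sup>2"
      if \<eta>: "cmod \<eta> = 1" for \<eta>
    proof (cases "dist \<eta> \<xi> < d")
      case True
      then have "cmod (g \<eta> - g \<xi>) \<le> e / 2"
        using d(2)[OF \<eta> True] by (simp add: dist_norm)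
      then have "poisson_kernel z \<eta> * cmod (g \<eta> - g \<xi>) \<le> poisson_kernel z \<eta> * (e / 2)"
        by (intro mult_left_mono poisson_kernel_nonneg z1)
      moreover have "0 \<le> 16 * B * dist z \<xi> / d\<^sup>2"
        using B by simp
      ultimately show ?thesis
        by (simp add: mult.commute)
    next
      case False
      then have "d / 2 \<le> cmod (\<eta> - z)"
        using z(2) dist_triangle2[of \<eta> \<xi> z] unfolding s_def by (simp add: dist_norm norm_minus_commute)
      then have "poisson_kernel z \<eta> \<le> 2 * dist z \<xi> / (d / 2)\<^sup>2"
        unfolding poisson_kernel_def using d num by (intro frac_le power_mono) auto
      moreover have "cmod (g \<eta> - g \<xi>) \<le> 2 * B"
        using B(2)[OF \<eta>] B(2)[OF \<xi>] norm_triangle_ineq4[of "g \<eta>" "g \<xi>"] by simp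
      ultimately have "poisson_kernel z \<eta> * cmod (g \<eta> - g \<xi>) \<le> 2 * dist z \<xi> / (d / 2)\<^sup>2 * (2 * B)"
        using z1 B by (intro mult_mono) auto
      also have "\<dots> = 16 * B * dist z \<xi> / d\<^sup>2"
        by (simp add: power2_eq_square field_simps)
      also have "\<dots> \<le> e / 2 * poisson_kernel z \<eta> + 16 * B * dist z \<xi> / d\<^sup>2"
        using \<open>e > 0\<close> poisson_kernel_nonneg[OF z1] by simp
      finally show ?thesis .
    qed
    have iP: "integrable circle_measure (poisson_kernel z)" and P1: "(\<integral>\<eta>. poisson_kernel z \<eta> \<partial>circle_measure) = 1"
    proof -
      show "integrable circle_measure (poisson_kernel z)"
        using z1 by (intro circle.integrable_const_bound[of _ "2 / (1 - cmod z)"] AE_I2)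
          (auto simp: poisson_kernel_nonneg poisson_kernel_le)
      have "(\<integral>\<eta>. 1 \<partial>harm z) = (1::real)"
        using hz.prob_space by simp
      then show "(\<integral>\<eta>. poisson_kernel z \<eta> \<partial>circle_measure) = 1"
        using integral_harm[OF z1, of "\<lambda>_. 1::real"] by simp
    qed
    have "dist (\<integral>\<eta>. g \<eta> \<partial>harm z) (g \<xi>) = cmod (\<integral>\<eta>. g \<eta> - g \<xi> \<partial>harm z)"
      using ig hz.prob_space by (simp add: dist_norm)
    also have "\<dots> \<le> (\<integral>\<eta>. cmod (g \<eta> - g \<xi>) \<partial>harm z)"
      by (rule integral_norm_bound)
    also have "\<dots> = (\<integral>\<eta>. poisson_kernel z \<eta> * cmod (g \<eta> - g \<xi>) \<partial>circle_measure)"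
      using continuous_on_imp_measurable_circle[OF g] by (subst integral_harm[OF z1]) auto
    also have "\<dots> \<le> (\<integral>\<eta>. e / 2 * poisson_kernel z \<eta> + 16 * B * dist z \<xi> / d\<^sup>2 \<partial>circle_measure)"
    proof (rule integral_mono)
      have "integrable (harm z) (\<lambda>\<eta>. cmod (g \<eta> - g \<xi>))"
        using ig by simp
      then show "integrable circle_measure (\<lambda>\<eta>. poisson_kernel z \<eta> * cmod (g \<eta> - g \<xi>))"
        unfolding harm_def using continuous_on_imp_measurable_circle[OF g] z1
        by (subst (asm) integrable_density) (auto simp: poisson_kernel_nonneg)
    qed (use iP pt in auto)
    also have "\<dots> = e / 2 + 16 * B * dist z \<xi> / d\<^sup>2"
      using iP P1 circle.prob_space by simp
    also have "\<dots> < e"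
    proof -
      have "dist z \<xi> < e * d\<^sup>2 / (32 * (B + 1))"
        using z(2) by (simp add: s_def)
      then have "(32 * (B + 1)) * dist z \<xi> < e * d\<^sup>2"
        using B by (simp add: pos_less_divide_eq mult.commute)
      moreover have "32 * B * dist z \<xi> \<le> 32 * (B + 1) * dist z \<xi>"
        by (intro mult_right_mono) auto
      ultimately have "16 * B * dist z \<xi> < e / 2 * d\<^sup>2"
        by simp
      then show ?thesis
        using d by (simp add: divide_simps)
    qed
    finally show ?thesis .
  qed
  then show "\<forall>\<^sub>F z in at \<xi> within ball 0 1. dist (\<integral>\<eta>. g \<eta> \<partial>harm z) (g \<xi>) < e"
    unfolding eventually_at using s by blast
qed

text \<open>Only measurable covers of the failures of \<open>Q\<close> are asked for, so the failure
  set itself need not be shown measurable beforehand.\<close>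

lemma (in prob_space) AE_if_small_exceptional_sets:
  assumes "\<And>d. d > 0 \<Longrightarrow> \<exists>N\<in>sets M. emeasure M N \<le> ennreal d \<and> (\<forall>x\<in>space M. x \<notin> N \<longrightarrow> Q x)"
  shows "AE x in M. Q x"
proof -
  have "\<exists>N\<in>sets M. emeasure M N \<le> ennreal (inverse (Suc n)) \<and> (\<forall>x\<in>space M. x \<notin> N \<longrightarrow> Q x)" for n
    by (intro assms) simp
  then obtain N where N: "\<And>n. N n \<in> sets M" "\<And>n. emeasure M (N n) \<le> ennreal (inverse (Suc n))"
      "\<And>n x. x \<in> space M \<Longrightarrow> x \<notin> N n \<Longrightarrow> Q x"
    by metis
  have Z: "(\<Inter>n. N n) \<in> sets M"
    using N by (intro sets.countable_INT) auto
  have "prob (\<Inter>n. N n) \<le> inverse (Suc n)" for n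
  proof -
    have "prob (\<Inter>n. N n) \<le> prob (N n)"
      using N by (intro finite_measure_mono) auto
    also have "\<dots> \<le> inverse (Suc n)"
      using N(2)[of n] by (simp add: emeasure_eq_measure)
    finally show ?thesis .
  qed
  then have "prob (\<Inter>n. N n) \<le> 0"
    by (intro LIMSEQ_le_const[OF LIMSEQ_inverse_real_of_nat]) auto
  then have "prob (\<Inter>n. N n) = 0"
    using measure_nonneg[of M "\<Inter>n. N n"] by linarith
  then have "(\<Inter>n. N n) \<in> null_sets M"
    using Z by (simp add: null_sets_def emeasure_eq_measure)
  then show ?thesis
    by (rule AE_I') (use N(3) in auto)
qed

text \<open>Split u into a continuous g and a part u - g that is small in L1. The Poisson integral
  of g converges at every boundary point, and that of u - g is controlled on the whole Stolz region
  by the maximal function of |u - g|. Off a small set, three errors of at most e / 4 remain.\<close>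

lemma AE_nontangential_close:
  fixes u :: "complex \<Rightarrow> complex"
  assumes u: "integrable circle_measure u" and e: "e > 0" and \<alpha>: "\<alpha> > 0"
  shows "AE \<xi> in circle_measure. \<forall>\<^sub>F z in at \<xi> within stolz_region \<alpha> \<xi>. dist (\<integral>\<eta>. u \<eta> \<partial>harm z) (u \<xi>) < e"
proof (rule circle.AE_if_small_exceptional_sets)
  fix d :: real assume "d > 0"
  \<comment> \<open>Comparing the Stolz region with the radius costs (\<alpha> + 2)^2, and the
    dyadic sum costs 64; at this level the Poisson integral of \<open>h\<close> is at most e /
    4.\<close>
  define l where "l = e / (256 * (\<alpha> + 2)\<^sup>2)"
  have l: "l > 0" "(\<alpha> + 2)\<^sup>2 * (64 * l) = e / 4"
    using e \<alpha> by (auto simp: l_def)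
  \<comment> \<open>\<open>I * (30 / l + 4 / e)\<close> will bound the exceptional set: 30 I / l
    comes from the weak type inequality, 4 I / e from Markov's.\<close>
  have c: "30 / l + 4 / e > 0"
    using l e by (intro add_pos_pos) auto
  obtain g where g: "continuous_on (sphere 0 1) g"
    and gI: "(\<integral>\<xi>. cmod (u \<xi> - g \<xi>) \<partial>circle_measure) < d / (30 / l + 4 / e)"
    using continuous_dense_circle[OF u, of "d / (30 / l + 4 / e)"] c \<open>d > 0\<close> by auto
  define I where "I = (\<integral>\<xi>. cmod (u \<xi> - g \<xi>) \<partial>circle_measure)"
  have I: "I \<ge> 0" "I * (30 / l + 4 / e) < d"
    using gI c by (auto simp: I_def pos_less_divide_eq)
  have ig: "integrable circle_measure g"
    by (rule integrable_continuous_circle[OF g])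
  have um [measurable]: "u \<in> borel_measurable circle_measure" and gm [measurable]: "g \<in> borel_measurable circle_measure"
    using u ig by auto
  define h where "h \<xi> = ennreal (cmod (u \<xi> - g \<xi>))" for \<xi>
  have h: "h \<in> borel_measurable circle_measure"
    unfolding h_def[abs_def] by measurable
  have hI: "(\<integral>\<^sup>+\<xi>. h \<xi> \<partial>circle_measure) = ennreal I"
    unfolding h_def I_def using u ig by (intro nn_integral_eq_integral) auto
  obtain N1 where N1: "N1 \<in> sets circle_measure" "emeasure circle_measure N1 \<le> ennreal (30 * I / l)"
    "\<And>\<xi> t. cmod \<xi> = 1 \<Longrightarrow> t > 0 \<Longrightarrow> \<xi> \<notin> N1 \<Longrightarrow>
        (\<integral>\<^sup>+\<eta>. h \<eta> * indicator (cball \<xi> t) \<eta> \<partial>circle_measure) \<le> ennreal (l * t)"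
    using weak_type_maximal[OF h hI I(1) l(1)] by metis
  define N2 where "N2 = {\<xi> \<in> space circle_measure. e / 4 \<le> cmod (u \<xi> - g \<xi>)}"
  have N2: "N2 \<in> sets circle_measure"
    unfolding N2_def by measurable
  have "measure circle_measure N2 \<le> I / (e / 4)"
    unfolding N2_def I_def using u ig e by (intro integral_Markov_inequality_measure[where A="{}"]) auto
  then have N2': "emeasure circle_measure N2 \<le> ennreal (4 * I / e)"
    by (simp add: circle.emeasure_eq_measure ennreal_leI mult.commute)
  show "\<exists>N\<in>sets circle_measure. emeasure circle_measure N \<le> ennreal d \<and> (\<forall>\<xi>\<in>space circle_measure. \<xi> \<notin> N \<longrightarrow>
      (\<forall>\<^sub>F z in at \<xi> within stolz_region \<alpha> \<xi>. dist (\<integral>\<eta>. u \<eta> \<partial>harm z) (u \<xi>) < e))"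
  proof (intro bexI[of _ "N1 \<union> N2"] conjI ballI impI)
    show "N1 \<union> N2 \<in> sets circle_measure"
      using N1 N2 by blast
    have "emeasure circle_measure (N1 \<union> N2) \<le> ennreal (30 * I / l) + ennreal (4 * I / e)"
      using N1 N2 N2' by (intro order_trans[OF emeasure_subadditive] add_mono) auto
    also have "\<dots> = ennreal (I * (30 / l + 4 / e))"
      using I l e by (subst ennreal_plus[symmetric]) (auto simp: algebra_simps)
    also have "\<dots> \<le> ennreal d"
      using I by (intro ennreal_leI) auto
    finally show "emeasure circle_measure (N1 \<union> N2) \<le> ennreal d" .
  next
    fix \<xi> assume "\<xi> \<in> space circle_measure" and nN: "\<xi> \<notin> N1 \<union> N2"
    then have \<xi>: "cmod \<xi> = 1" and close: "cmod (u \<xi> - g \<xi>) < e / 4"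
      by (auto simp: N2_def)
    have "at \<xi> within stolz_region \<alpha> \<xi> \<le> at \<xi> within ball 0 1"
      by (intro at_le) (auto simp: stolz_region_def)
    then have lim: "((\<lambda>z. \<integral>\<eta>. g \<eta> \<partial>harm z) \<longlongrightarrow> g \<xi>) (at \<xi> within stolz_region \<alpha> \<xi>)"
      using tendsto_poisson_integral_continuous[OF g \<xi>] by (rule tendsto_mono)
    have "\<forall>\<^sub>F z in at \<xi> within stolz_region \<alpha> \<xi>. dist (\<integral>\<eta>. g \<eta> \<partial>harm z) (g \<xi>) < e / 4"
      using e by (intro tendstoD[OF lim]) auto
    moreover have "\<forall>\<^sub>F z in at \<xi> within stolz_region \<alpha> \<xi>. z \<in> stolz_region \<alpha> \<xi>"
      by (simp add: eventually_at_filter)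
    ultimately show "\<forall>\<^sub>F z in at \<xi> within stolz_region \<alpha> \<xi>. dist (\<integral>\<eta>. u \<eta> \<partial>harm z) (u \<xi>) < e"
    proof eventually_elim
      case (elim z)
      then have z: "cmod z < 1"
        by (auto simp: stolz_region_def)
      have iu': "integrable (harm z) u" and ig': "integrable (harm z) g"
        using u ig z by (auto intro: integrable_harm)
      have "ennreal (cmod (\<integral>\<eta>. u \<eta> - g \<eta> \<partial>harm z)) \<le> (\<integral>\<^sup>+\<eta>. h \<eta> \<partial>harm z)"
        unfolding h_def using iu' ig' by (intro integral_norm_bound_ennreal) auto
      also have "\<dots> = (\<integral>\<^sup>+\<eta>. ennreal (poisson_kernel z \<eta>) * h \<eta> \<partial>circle_measure)"
        by (rule nn_integral_harm[OF h])
      also have "\<dots> \<le> (\<integral>\<^sup>+\<eta>. ennreal ((\<alpha> + 2)\<^sup>2) * (ennreal (poisson_kernel (of_real (cmod z) * \<xi>) \<eta>) * h \<eta>) \<partial>circle_measure)"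
      proof (rule nn_integral_mono)
        fix \<eta> assume "\<eta> \<in> space circle_measure"
        then have "ennreal (poisson_kernel z \<eta>) \<le> ennreal ((\<alpha> + 2)\<^sup>2 * poisson_kernel (of_real (cmod z) * \<xi>) \<eta>)"
          using elim(2) \<xi> by (intro ennreal_leI poisson_kernel_stolz_le) auto
        then show "ennreal (poisson_kernel z \<eta>) * h \<eta> \<le> ennreal ((\<alpha> + 2)\<^sup>2) * (ennreal (poisson_kernel (of_real (cmod z) * \<xi>) \<eta>) * h \<eta>)"
          by (simp add: ennreal_mult' mult.assoc[symmetric] mult_right_mono)
      qed
      also have "\<dots> = ennreal ((\<alpha> + 2)\<^sup>2) * (\<integral>\<^sup>+\<eta>. h \<eta> \<partial>harm (of_real (cmod z) * \<xi>))"
        unfolding nn_integral_harm[OF h]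
        by (intro nn_integral_cmult borel_measurable_times_ennreal h
            measurable_compose[OF measurable_poisson_kernel_circle measurable_ennreal])
      also have "\<dots> \<le> ennreal ((\<alpha> + 2)\<^sup>2) * ennreal (64 * l)"
        using z l \<xi> nN by (intro mult_left_mono nn_integral_harm_radial_le h N1(3)) auto
      also have "\<dots> = ennreal (e / 4)"
        using l by (subst ennreal_mult[symmetric]) auto
      finally have "cmod (\<integral>\<eta>. u \<eta> - g \<eta> \<partial>harm z) \<le> e / 4"
        using e by simp
      then have "dist (\<integral>\<eta>. u \<eta> \<partial>harm z) (\<integral>\<eta>. g \<eta> \<partial>harm z) \<le> e / 4"
        using iu' ig' by (simp add: dist_norm)
      then show ?case
        using elim(1) close dist_triangle[of "\<integral>\<eta>. u \<eta> \<partial>harm z" "u \<xi>" "\<integral>\<eta>. g \<eta> \<partial>harm z"] 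
          dist_triangle[of "\<integral>\<eta>. g \<eta> \<partial>harm z" "u \<xi>" "g \<xi>"] e
        by (simp add: dist_norm norm_minus_commute)
    qed
  qed
qed

text \<open>Countably many apertures and tolerances are enough, because Stolz regions grow with the
  aperture; so a countable union of null sets is discarded.\<close>

theorem fatou_nontangential_limit:
  fixes u :: "complex \<Rightarrow> complex"
  assumes u: "integrable circle_measure u"
  shows "AE \<xi> in circle_measure. has_nontangential_limit (\<lambda>z. \<integral>\<eta>. u \<eta> \<partial>harm z) \<xi> (u \<xi>)"
proof -
  have "AE \<xi> in circle_measure. \<forall>k n. \<forall>\<^sub>F z in at \<xi> within stolz_region (real (Suc k)) \<xi>.
      dist (\<integral>\<eta>. u \<eta> \<partial>harm z) (u \<xi>) < inverse (real (Suc n))"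
    unfolding AE_all_countable by (intro allI AE_nontangential_close u) auto
  then show ?thesis
  proof eventually_elim
    case (elim \<xi>)
    show ?case
      unfolding has_nontangential_limit_def
    proof (intro allI impI tendstoI)
      fix \<alpha> e :: real assume "\<alpha> > 1" "e > 0"
      obtain n where n: "inverse (real (Suc n)) < e"
        using reals_Archimedean \<open>e > 0\<close> by blast
      obtain k where "\<alpha> \<le> real k"
        using real_arch_simple by blast
      then have k: "\<alpha> \<le> real (Suc k)"
        by simp
      have sub: "stolz_region \<alpha> \<xi> \<subseteq> stolz_region (real (Suc k)) \<xi>"
      proof
        fix z assume z: "z \<in> stolz_region \<alpha> \<xi>"
        then have "\<alpha> * (1 - cmod z) \<le> real (Suc k) * (1 - cmod z)"
          using k by (intro mult_right_mono) (auto simp: stolz_region_def)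
        with z show "z \<in> stolz_region (real (Suc k)) \<xi>"
          by (auto simp only: stolz_region_def mem_Collect_eq intro: less_le_trans)
      qed
      have "\<forall>\<^sub>F z in at \<xi> within stolz_region (real (Suc k)) \<xi>. dist (\<integral>\<eta>. u \<eta> \<partial>harm z) (u \<xi>) < e"
      proof -
        have "\<forall>\<^sub>F z in at \<xi> within stolz_region (real (Suc k)) \<xi>. dist (\<integral>\<eta>. u \<eta> \<partial>harm z) (u \<xi>) < inverse (real (Suc n))"
          using elim by blast
        then show ?thesis
          by (rule eventually_mono) (use n in linarith)
      qed
      then show "\<forall>\<^sub>F z in at \<xi> within stolz_region \<alpha> \<xi>. dist (\<integral>\<eta>. u \<eta> \<partial>harm z) (u \<xi>) < e"
        using at_le[OF sub, of \<xi>] by (auto simp: le_filter_def)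
    qed
  qed
qed

section \<open>Boundary maps of inner functions\<close>

text \<open>Real trigonometric polynomials: under the real part the powers \<xi>^k with k \<ge> 0
  are enough, and the inductive form lets equality of moments extend by induction.\<close>

inductive trig_poly :: "(complex \<Rightarrow> real) \<Rightarrow> bool" where
  mono: "trig_poly (\<lambda>\<xi>. Re (c * \<xi> ^ k))"
| add: "trig_poly g \<Longrightarrow> trig_poly h \<Longrightarrow> trig_poly (\<lambda>\<xi>. g \<xi> + h \<xi>)"

lemma trig_poly_continuous: "trig_poly g \<Longrightarrow> continuous_on A g"
  by (induction rule: trig_poly.induct) (auto intro!: continuous_intros)

lemma mult_power_cnj:
  assumes "cmod \<xi> = 1" "k \<le> j"
  shows "\<xi> ^ j * cnj \<xi> ^ k = \<xi> ^ (j - k)"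
proof -
  have "\<xi> ^ j = \<xi> ^ (j - k) * \<xi> ^ k"
    using assms by (simp flip: power_add)
  moreover have "\<xi> ^ k * cnj \<xi> ^ k = 1"
    using assms by (simp add: complex_norm_square[symmetric] flip: power_mult_distrib)
  ultimately show ?thesis
    by (simp add: mult.assoc)
qed

lemma Re_mult_Re: "Re a * Re b = Re (a * b) / 2 + Re (a * cnj b) / 2"
  by (simp add: field_simps)

text \<open>From 2 Re a Re b = Re (a b) + Re (a cnj b). On the circle the second product contains a
  single power of \<xi>, after conjugating it as a whole when k > j, which keeps its real
  part.\<close>

lemma trig_poly_mono_mult:
  "\<exists>p. trig_poly p \<and> (\<forall>\<xi>\<in>sphere 0 1. Re (c * \<xi> ^ j) * Re (d * \<xi> ^ k) = p \<xi>)"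
proof -
  define q where "q \<xi> = (if k \<le> j then Re (c * cnj d / 2 * \<xi> ^ (j - k)) else Re (cnj c * d / 2 * \<xi> ^ (k - j)))" for \<xi>
  have q: "trig_poly q"
    unfolding q_def by (cases "k \<le> j") (simp_all only: if_True if_False trig_poly.mono)
  have "Re (c * \<xi> ^ j) * Re (d * \<xi> ^ k) = Re (c * d / 2 * \<xi> ^ (j + k)) + q \<xi>" if "cmod \<xi> = 1" for \<xi>
  proof -
    have "Re (c * \<xi> ^ j * cnj (d * \<xi> ^ k)) / 2 = q \<xi>"
    proof (cases "k \<le> j")
      case True
      have "c * \<xi> ^ j * cnj (d * \<xi> ^ k) = c * cnj d * (\<xi> ^ j * cnj \<xi> ^ k)"
        by simp
      also have "\<dots> = 2 * (c * cnj d / 2 * \<xi> ^ (j - k))"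
        unfolding mult_power_cnj[OF that True] by simp
      finally show ?thesis
        using True by (simp only: q_def if_True) simp
    next
      case False
      have "cnj (c * \<xi> ^ j * cnj (d * \<xi> ^ k)) = cnj c * d * (\<xi> ^ k * cnj \<xi> ^ j)"
        by simp
      also have "\<dots> = 2 * (cnj c * d / 2 * \<xi> ^ (k - j))"
        using mult_power_cnj[OF that, of j k] False by simp
      finally have "Re (c * \<xi> ^ j * cnj (d * \<xi> ^ k)) = Re (2 * (cnj c * d / 2 * \<xi> ^ (k - j)))"
        by (metis cnj.simps(1))
      then show ?thesis
        using False by (simp only: q_def if_False) simp
    qed
    moreover have "Re (c * \<xi> ^ j * (d * \<xi> ^ k)) / 2 = Re (c * d / 2 * \<xi> ^ (j + k))"
    proof -
      have "c * \<xi> ^ j * (d * \<xi> ^ k) = 2 * (c * d / 2 * \<xi> ^ (j + k))"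
        by (simp add: power_add)
      then show ?thesis
        by (simp only:) simp
    qed
    ultimately show ?thesis
      unfolding Re_mult_Re[of "c * \<xi> ^ j"] by simp
  qed
  then show ?thesis
    by (intro exI[of _ "\<lambda>\<xi>. Re (c * d / 2 * \<xi> ^ (j + k)) + q \<xi>"] conjI trig_poly.add trig_poly.mono q) simp
qed

text \<open>Products of these polynomials are again such polynomials only on the circle, where
  \<open>cnj \<xi>\<close> = 1 / \<xi>; the algebra for Stone-Weierstrass therefore consists of
  functions that agree with one there.\<close>

definition trig_like :: "(complex \<Rightarrow> real) \<Rightarrow> bool" where
  "trig_like g \<longleftrightarrow> (\<exists>p. trig_poly p \<and> (\<forall>\<xi>\<in>sphere 0 1. g \<xi> = p \<xi>))"

lemma trig_like_add: "trig_like g \<Longrightarrow> trig_like h \<Longrightarrow> trig_like (\<lambda>\<xi>. g \<xi> + h \<xi>)"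
  unfolding trig_like_def by (elim exE conjE) (rule exI, rule conjI, erule (1) trig_poly.add, simp)

lemma trig_like_mult:
  assumes "trig_like g" "trig_like h"
  shows "trig_like (\<lambda>\<xi>. g \<xi> * h \<xi>)"
proof -
  have 1: "trig_like (\<lambda>\<xi>. Re (c * \<xi> ^ j) * q \<xi>)" if "trig_poly q" for q c j
    using that
  proof (induction rule: trig_poly.induct)
    case (mono d k)
    show ?case
      unfolding trig_like_def by (rule trig_poly_mono_mult)
  next
    case (add g h)
    then show ?case
      using trig_like_add[OF add(3,4)] by (simp add: distrib_left)
  qed
  have 2: "trig_like (\<lambda>\<xi>. p \<xi> * q \<xi>)" if "trig_poly p" "trig_poly q" for p q
    using that(1)
  proof (induction rule: trig_poly.induct)
    case (add g h)
    then show ?case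
      using trig_like_add[OF add(3,4)] by (simp add: distrib_right)
  qed (rule 1[OF that(2)])
  from assms obtain p q where "trig_poly p" "\<forall>\<xi>\<in>sphere 0 1. g \<xi> = p \<xi>" "trig_poly q" "\<forall>\<xi>\<in>sphere 0 1. h \<xi> = q \<xi>"
    unfolding trig_like_def by blast
  then show ?thesis
    using 2[of p q] unfolding trig_like_def by auto
qed

lemma trig_poly_dense:
  fixes g :: "complex \<Rightarrow> real"
  assumes "continuous_on (sphere 0 1) g" "e > 0"
  obtains p where "trig_poly p" "\<And>\<xi>. cmod \<xi> = 1 \<Longrightarrow> \<bar>g \<xi> - p \<xi>\<bar> < e"
proof -
  have "\<exists>h. trig_like h \<and> (\<forall>x\<in>sphere 0 1. \<bar>g x - h x\<bar> < e)"
  proof (rule Stone_Weierstrass_HOL[OF compact_sphere])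
    show "trig_like (\<lambda>x. c)" for c
      unfolding trig_like_def using trig_poly.mono[of "of_real c" 0] by auto
    show "continuous_on (sphere 0 1) h" if "trig_like h" for h
      using that trig_poly_continuous unfolding trig_like_def by (metis continuous_on_cong)
    fix x y :: complex assume "x \<in> sphere 0 1 \<and> y \<in> sphere 0 1 \<and> x \<noteq> y"
    then have "Re x \<noteq> Re y \<or> Im x \<noteq> Im y"
      by (auto simp: complex_eq_iff)
    moreover have "trig_like (\<lambda>x. Re x)" "trig_like (\<lambda>x. Im x)"
      unfolding trig_like_def using trig_poly.mono[of 1 1] trig_poly.mono[of "-\<i>" 1] by auto
    ultimately show "\<exists>f. trig_like f \<and> f x \<noteq> f y"
      by blast
  qed (use assms trig_like_add trig_like_mult in auto)
  then show ?thesis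
    using that unfolding trig_like_def by (metis mem_sphere_0)
qed

section \<open>Measures on the circle are determined by their moments\<close>

lemma integrable_continuous_on_circle_measure:
  fixes g :: "complex \<Rightarrow> 'b::{banach, second_countable_topology}"
  assumes "finite_measure M" "sets M = sets circle_measure" "continuous_on (sphere 0 1) g"
  shows "integrable M g"
proof -
  interpret finite_measure M by fact
  have sp: "space M = sphere 0 1"
    using sets_eq_imp_space_eq[OF assms(2)] by simp
  obtain B where "\<And>\<xi>. cmod \<xi> = 1 \<Longrightarrow> norm (g \<xi>) \<le> B"
    using bounded_continuous_circle[OF assms(3)] by metis
  moreover have "g \<in> borel_measurable M"
    using continuous_on_imp_measurable_circle[OF assms(3)] measurable_cong_sets[OF assms(2) refl] by blast
  ultimately show ?thesis
    by (intro integrable_const_bound[of _ B] AE_I2) (auto simp: sp)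
qed

text \<open>Through their bumps, continuous test functions fix the measure of every closed set, and
  closed sets form a generator of the Borel sets that is stable under intersection.\<close>

lemma circle_measure_eqI_continuous:
  assumes M: "finite_measure M" "sets M = sets circle_measure"
    and N: "finite_measure N" "sets N = sets circle_measure"
    and eq: "\<And>g :: complex \<Rightarrow> real. continuous_on (sphere 0 1) g \<Longrightarrow> (\<integral>\<xi>. g \<xi> \<partial>M) = (\<integral>\<xi>. g \<xi> \<partial>N)"
  shows "M = N"
proof -
  define D where "D Q = distr Q borel (\<lambda>x::complex. x)" for Q
  have sp: "space Q = sphere 0 1" if "sets Q = sets circle_measure" for Q
    using sets_eq_imp_space_eq[OF that] by simp
  have id: "(\<lambda>x. x) \<in> measurable Q borel" if "sets Q = sets circle_measure" for Q
    unfolding measurable_cong_sets[OF that refl] by (rule measurable_circle_borel) simp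
  have D: "emeasure (D Q) A = emeasure Q (A \<inter> sphere 0 1)" if "sets Q = sets circle_measure" "A \<in> sets borel" for Q A
    unfolding D_def using that id[OF that(1)] by (subst emeasure_distr) (auto simp: sp[OF that(1)])
  have lim: "(\<lambda>n. \<integral>\<xi>. closed_bump K n \<xi> \<partial>Q) \<longlonglongrightarrow> measure Q (K \<inter> sphere 0 1)"
    if Q: "finite_measure Q" "sets Q = sets circle_measure" and K: "closed K" "K \<noteq> {}" for Q K
  proof -
    interpret finite_measure Q by fact
    have Ks: "K \<inter> sphere 0 1 \<in> sets Q"
      using K Q by (auto simp: sets_restrict_space)
    have "(\<lambda>n. \<integral>\<xi>. closed_bump K n \<xi> \<partial>Q) \<longlonglongrightarrow> (\<integral>\<xi>. indicator (K \<inter> sphere 0 1) \<xi> \<partial>Q)"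
    proof (rule integral_dominated_convergence[where w="\<lambda>_. 1"])
      show "AE \<xi> in Q. (\<lambda>n. closed_bump K n \<xi>) \<longlonglongrightarrow> indicator (K \<inter> sphere 0 1) \<xi>"
      proof (rule AE_I2)
        fix \<xi> assume "\<xi> \<in> space Q"
        then have "indicator (K \<inter> sphere 0 1) \<xi> = (indicator K \<xi> :: real)"
          using Q by (auto simp: sp indicator_def)
        then show "(\<lambda>n. closed_bump K n \<xi>) \<longlonglongrightarrow> indicator (K \<inter> sphere 0 1) \<xi>"
          using closed_bump_tendsto[OF K] by simp
      qed
      show "closed_bump K n \<in> borel_measurable Q" for n
        by (intro borel_measurable_integrable integrable_continuous_on_circle_measure Q continuous_intros)
    qed (use Ks closed_bump_bounds[of K] in \<open>auto simp: abs_le_iff\<close>)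
    then show ?thesis
      using Ks sets.sets_into_space[OF Ks] by (simp add: Int_absorb2)
  qed
  have "D M = D N"
  proof (rule measure_eqI_generator_eq[where E="{K. closed K}" and \<Omega>=UNIV and A="\<lambda>_. UNIV"])
    show "Int_stable {K :: complex set. closed K}"
      by (auto simp: Int_stable_def)
    show "sets (D M) = sigma_sets UNIV {K. closed K}" "sets (D N) = sigma_sets UNIV {K. closed K}"
      by (simp_all add: D_def borel_eq_closed)
    fix K :: "complex set" assume "K \<in> {K. closed K}"
    then have K: "closed K" by simp
    show "emeasure (D M) K = emeasure (D N) K"
    proof (cases "K = {}")
      case False
      have "measure M (K \<inter> sphere 0 1) = measure N (K \<inter> sphere 0 1)"
        using lim[OF M K False] lim[OF N K False] eq[OF continuous_on_closed_bump]
        by (simp add: LIMSEQ_unique)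
      then show ?thesis
        using M N K by (simp add: D finite_measure.emeasure_eq_measure)
    qed simp
  next
    show "emeasure (D M) UNIV \<noteq> \<infinity>" for i :: nat
      using M finite_measure.emeasure_finite[OF M(1)] by (simp add: D)
  qed auto
  show ?thesis
  proof (rule measure_eqI)
    fix A assume "A \<in> sets M"
    then have "A \<in> sets borel" "A \<inter> sphere 0 1 = A"
      using M by (auto simp: sets_restrict_space)
    then show "emeasure M A = emeasure N A"
      using D[OF M(2), of A] D[OF N(2), of A] \<open>D M = D N\<close> by simp
  qed (use M N in simp)
qed

text \<open>Moments with k \<ge> 0 suffice because the measures are positive: the negative ones are
  their conjugates. This is what makes holomorphic functions sufficient as test functions for the
  push-forward.\<close>

lemma circle_measure_eqI_moments:
  assumes M: "prob_space M" "sets M = sets circle_measure"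
    and N: "prob_space N" "sets N = sets circle_measure"
    and eq: "\<And>k::nat. (\<integral>\<xi>. \<xi> ^ k \<partial>M) = (\<integral>\<xi>. \<xi> ^ k \<partial>N)"
  shows "M = N"
proof (rule circle_measure_eqI_continuous[OF _ M(2) _ N(2)])
  interpret M: prob_space M by fact
  interpret N: prob_space N by fact
  show fM: "finite_measure M" and fN: "finite_measure N"
    by unfold_locales
  have sp: "space M = sphere 0 1" "space N = sphere 0 1"
    using sets_eq_imp_space_eq[OF M(2)] sets_eq_imp_space_eq[OF N(2)] by simp_all
  note iM = integrable_continuous_on_circle_measure[OF fM M(2)] and iN = integrable_continuous_on_circle_measure[OF fN N(2)]
  fix g :: "complex \<Rightarrow> real" assume g: "continuous_on (sphere 0 1) g"
  have trig: "(\<integral>\<xi>. p \<xi> \<partial>M) = (\<integral>\<xi>. p \<xi> \<partial>N)" if "trig_poly p" for p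
    using that
  proof (induction rule: trig_poly.induct)
    case (mono c k)
    have i: "integrable M (\<lambda>\<xi>. c * \<xi> ^ k)" "integrable N (\<lambda>\<xi>. c * \<xi> ^ k)"
      by (intro iM iN continuous_intros)+
    show ?case
      unfolding integral_Re[OF i(1)] integral_Re[OF i(2)] by (simp add: eq)
  next
    case (add g h)
    have i: "integrable M g" "integrable M h" "integrable N g" "integrable N h"
      by (intro iM iN trig_poly_continuous add.hyps)+
    show ?case
      unfolding Bochner_Integration.integral_add[OF i(1,2)] Bochner_Integration.integral_add[OF i(3,4)] add.IH ..
  qed
  have "\<bar>(\<integral>\<xi>. g \<xi> \<partial>M) - (\<integral>\<xi>. g \<xi> \<partial>N)\<bar> \<le> e" if "e > 0" for e
  proof -
    obtain p where p: "trig_poly p" "\<And>\<xi>. cmod \<xi> = 1 \<Longrightarrow> \<bar>g \<xi> - p \<xi>\<bar> < e / 2"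
      using trig_poly_dense[OF g, of "e / 2"] \<open>e > 0\<close> by auto
    have i: "integrable M g" "integrable M p" "integrable N g" "integrable N p"
      by (intro iM iN trig_poly_continuous g p(1))+
    have *: "\<bar>(\<integral>\<xi>. g \<xi> \<partial>Q) - (\<integral>\<xi>. p \<xi> \<partial>Q)\<bar> \<le> e / 2"
      if "prob_space Q" "integrable Q g" "integrable Q p" "space Q = sphere 0 1" for Q
    proof -
      interpret Q: prob_space Q by fact
      have "\<bar>(\<integral>\<xi>. g \<xi> \<partial>Q) - (\<integral>\<xi>. p \<xi> \<partial>Q)\<bar> = \<bar>\<integral>\<xi>. g \<xi> - p \<xi> \<partial>Q\<bar>"
        using that by simp
      also have "\<dots> \<le> (\<integral>\<xi>. \<bar>g \<xi> - p \<xi>\<bar> \<partial>Q)"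
        by (rule integral_abs_bound)
      also have "\<dots> \<le> (\<integral>\<xi>. e / 2 \<partial>Q)"
      proof (rule integral_mono)
        show "\<bar>g \<xi> - p \<xi>\<bar> \<le> e / 2" if "\<xi> \<in> space Q" for \<xi>
          using p(2)[of \<xi>] that \<open>space Q = sphere 0 1\<close> by simp
      qed (use that in auto)
      finally show ?thesis
        by (simp add: Q.prob_space)
    qed
    from *[OF M(1) i(1,2) sp(1)] *[OF N(1) i(3,4) sp(2)] trig[OF p(1)] show ?thesis
      by linarith
  qed
  then have "\<bar>(\<integral>\<xi>. g \<xi> \<partial>M) - (\<integral>\<xi>. g \<xi> \<partial>N)\<bar> \<le> 0"
    by (rule dense_ge)
  then show "(\<integral>\<xi>. g \<xi> \<partial>M) = (\<integral>\<xi>. g \<xi> \<partial>N)"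
    by simp
qed

text \<open>The value \<open>1\<close> at exceptional points makes the boundary map a total measurable self-map of the circle.\<close>

definition boundary_map :: "(complex \<Rightarrow> complex) \<Rightarrow> complex \<Rightarrow> complex" where
  "boundary_map f \<xi> =
     (let l = lim (\<lambda>n. f (of_real (1 - inverse (real (n + 2))) * \<xi>)) in if cmod l = 1 then l else 1)"

lemma cmod_boundary_map [simp]: "cmod (boundary_map f \<xi>) = 1"
  by (simp add: boundary_map_def Let_def)

lemma cmod_radii_less: "cmod \<xi> = 1 \<Longrightarrow> cmod (of_real (1 - inverse (real (n + 2))) * \<xi>) < 1"
  by (simp add: norm_mult del: of_real_diff of_real_inverse of_real_add of_real_of_nat_eq)
     (simp add: abs_if field_simps)

section \<open>Push-forward of harmonic measure by the boundary map\<close>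

lemma inner_functionD:
  assumes "inner_function f"
  shows "f holomorphic_on ball 0 1" "\<And>z. cmod z < 1 \<Longrightarrow> cmod (f z) < 1"
    "AE \<xi> in circle_measure. \<exists>l. has_radial_limit f \<xi> l \<and> cmod l = 1"
  using assms unfolding inner_function_def by (blast, simp_all add: image_subset_iff)

lemma measurable_boundary_map:
  assumes "f holomorphic_on ball 0 1"
  shows "boundary_map f \<in> measurable circle_measure circle_measure"
proof -
  have "continuous_on (sphere 0 1) (\<lambda>\<xi>. f (of_real (1 - inverse (real (n + 2))) * \<xi>))" for n
    by (rule continuous_on_compose2[OF holomorphic_on_imp_continuous_on[OF assms]])
       (use cmod_radii_less[of _ n] in \<open>auto intro!: continuous_intros\<close>)
  then have [measurable]: "(\<lambda>\<xi>. f (of_real (1 - inverse (real (n + 2))) * \<xi>)) \<in> borel_measurable circle_measure" for n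
    by (rule continuous_on_imp_measurable_circle)
  have [measurable]: "(\<lambda>\<xi>. lim (\<lambda>n. f (of_real (1 - inverse (real (n + 2))) * \<xi>))) \<in> borel_measurable circle_measure"
    by (rule borel_measurable_lim_metric) measurable
  have "boundary_map f \<in> borel_measurable circle_measure"
    unfolding boundary_map_def[abs_def] Let_def by measurable
  then have "boundary_map f \<in> measurable circle_measure (restrict_space borel (sphere 0 1))"
    by (intro measurable_restrict_space2) auto
  then show ?thesis
    by measurable
qed

lemma boundary_map_radial_limit:
  assumes "inner_function f"
  shows "AE \<xi> in circle_measure. has_radial_limit f \<xi> (boundary_map f \<xi>)"
  using inner_functionD(3)[OF assms]
proof eventually_elim
  case (elim \<xi>)
  then obtain l where l: "has_radial_limit f \<xi> l" "cmod l = 1"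
    by blast
  then have "lim (\<lambda>n. f (of_real (1 - inverse (real (n + 2))) * \<xi>)) = l"
    by (intro limI has_radial_limit_sequentially)
  with l show ?case
    unfolding boundary_map_def Let_def by simp
qed

lemma has_radial_limit_continuous:
  assumes "has_radial_limit f \<xi> l" "isCont \<phi> l"
  shows "has_radial_limit (\<lambda>z. \<phi> (f z)) \<xi> (\<phi> l)"
  using assms unfolding has_radial_limit_def by (simp add: isCont_tendsto_compose[where g=\<phi>])

text \<open>The pointwise power of f is bounded and holomorphic with boundary values
  \<open>boundary_map f \<xi> ^ k\<close>; so its mean under \<open>harm z\<close> is
  \<open>f z ^ k\<close>, which is the k-th moment of \<open>harm (f z)\<close>.\<close>

theorem distr_harm_boundary_map:
  assumes f: "inner_function f" and z: "cmod z < 1"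
  shows "distr (harm z) circle_measure (boundary_map f) = harm (f z)"
proof (rule circle_measure_eqI_moments)
  note mb = measurable_boundary_map[OF inner_functionD(1)[OF f]]
  have mb': "boundary_map f \<in> measurable (harm z) circle_measure"
    using mb by (simp add: harm_def)
  have fz: "cmod (f z) < 1"
    by (rule inner_functionD(2)[OF f z])
  show "prob_space (distr (harm z) circle_measure (boundary_map f))"
    by (intro prob_space.prob_space_distr prob_space_harm z mb')
  show "prob_space (harm (f z))"
    by (intro prob_space_harm fz)
  fix k :: nat
  have mk: "(\<lambda>\<xi>. \<xi> ^ k :: complex) \<in> borel_measurable circle_measure"
    by (intro measurable_circle_borel) simp
  have "(\<integral>\<xi>. \<xi> ^ k \<partial>distr (harm z) circle_measure (boundary_map f)) = (\<integral>\<xi>. boundary_map f \<xi> ^ k \<partial>harm z)"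
    by (rule integral_distr[OF mb' mk])
  also have "\<dots> = f z ^ k"
  proof (rule integral_harm_radial_limit[where B=1, OF _ _ _ _ z])
    show "(\<lambda>z. f z ^ k) holomorphic_on ball 0 1"
      by (intro holomorphic_intros inner_functionD[OF f])
    show "cmod (f w ^ k) \<le> 1" if "cmod w < 1" for w
      using inner_functionD(2)[OF f that] by (simp add: norm_power power_le_one)
    show "(\<lambda>\<xi>. boundary_map f \<xi> ^ k) \<in> borel_measurable circle_measure"
      using measurable_compose[OF mb mk] .
    show "AE \<xi> in circle_measure. has_radial_limit (\<lambda>z. f z ^ k) \<xi> (boundary_map f \<xi> ^ k)"
      using boundary_map_radial_limit[OF f]
      by eventually_elim (rule has_radial_limit_continuous[where \<phi>="\<lambda>w. w ^ k"], auto)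
  qed
  also have "\<dots> = (\<integral>\<xi>. \<xi> ^ k \<partial>harm (f z))"
    by (rule integral_harm_holomorphic[symmetric, OF _ _ fz]) (auto intro!: continuous_intros holomorphic_intros)
  finally show "(\<integral>\<xi>. \<xi> ^ k \<partial>distr (harm z) circle_measure (boundary_map f)) = (\<integral>\<xi>. \<xi> ^ k \<partial>harm (f z))" .
qed auto

section \<open>Iterates and their correlations\<close>

lemma integrable_harm_bounded:
  fixes u :: "complex \<Rightarrow> 'b::{banach, second_countable_topology}"
  assumes "u \<in> borel_measurable circle_measure" "\<And>\<xi>. cmod \<xi> = 1 \<Longrightarrow> norm (u \<xi>) \<le> B" "cmod z < 1"
  shows "integrable (harm z) u"
  using assms by (intro integrable_harm circle.integrable_const_bound[of _ B] AE_I2) auto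

section \<open>The derivative of harmonic measure at the origin\<close>

lemma poisson_kernel_minus_1:
  assumes "cmod \<xi> = 1" "\<xi> \<noteq> z"
  shows "poisson_kernel z \<xi> - 1 = 2 * Re (cnj z * (\<xi> - z)) / (cmod (\<xi> - z))\<^sup>2"
proof -
  have "1 = (cmod (\<xi> - z + z))\<^sup>2"
    using assms by simp
  also have "\<dots> = (cmod (\<xi> - z))\<^sup>2 + (cmod z)\<^sup>2 + 2 * Re ((\<xi> - z) * cnj z)"
    by (rule cmod_add_squared)
  finally have "1 - (cmod z)\<^sup>2 = (cmod (\<xi> - z))\<^sup>2 + 2 * Re (cnj z * (\<xi> - z))"
    by (simp add: mult.commute)
  then show ?thesis
    using assms unfolding poisson_kernel_def by (simp add: add_divide_distrib)
qed

text \<open>The derivative at 0 of the Poisson integral of \<open>G\<close> in the direction v; the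
  kernel contributes 2 Re (cnj v \<xi>). Points \<open>Z n\<close> that approach 0 only
  asymptotically along v are allowed, because the image under f of a sequence on a ray is of this
  kind.\<close>

lemma poisson_kernel_derivative_limit:
  fixes G :: "complex \<Rightarrow> complex" and Z :: "nat \<Rightarrow> complex" and s :: "nat \<Rightarrow> real"
  assumes [measurable]: "G \<in> borel_measurable circle_measure" and G: "\<And>\<xi>. cmod \<xi> = 1 \<Longrightarrow> cmod (G \<xi>) \<le> K"
    and Z: "Z \<longlonglongrightarrow> 0" "\<And>n. cmod (Z n) \<le> 1/2" and sZ: "(\<lambda>n. s n * Z n) \<longlonglongrightarrow> v"
  shows "(\<lambda>n. s n * ((\<integral>\<xi>. G \<xi> \<partial>harm (Z n)) - (\<integral>\<xi>. G \<xi> \<partial>circle_measure)))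
           \<longlonglongrightarrow> (\<integral>\<xi>. of_real (2 * Re (cnj v * \<xi>)) * G \<xi> \<partial>circle_measure)"
proof -
  have Z1: "cmod (Z n) < 1" for n
    using Z(2)[of n] by simp
  have iG: "integrable circle_measure G"
    using G by (intro circle.integrable_const_bound[of _ K] AE_I2) auto
  have iPG: "integrable circle_measure (\<lambda>\<xi>. poisson_kernel (Z n) \<xi> *\<^sub>R G \<xi>)" for n
    using integrable_harm[OF iG Z1[of n]] unfolding harm_def
    by (subst (asm) integrable_density) (auto simp: poisson_kernel_nonneg Z1)
  have eq: "s n * ((\<integral>\<xi>. G \<xi> \<partial>harm (Z n)) - (\<integral>\<xi>. G \<xi> \<partial>circle_measure)) =
      (\<integral>\<xi>. of_real (s n * (poisson_kernel (Z n) \<xi> - 1)) * G \<xi> \<partial>circle_measure)" for n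
  proof -
    have "(\<integral>\<xi>. G \<xi> \<partial>harm (Z n)) - (\<integral>\<xi>. G \<xi> \<partial>circle_measure) =
        (\<integral>\<xi>. poisson_kernel (Z n) \<xi> *\<^sub>R G \<xi> - G \<xi> \<partial>circle_measure)"
      using iPG iG by (subst integral_harm[OF Z1]) auto
    also have "s n * \<dots> = (\<integral>\<xi>. s n * (poisson_kernel (Z n) \<xi> *\<^sub>R G \<xi> - G \<xi>) \<partial>circle_measure)"
      by (rule integral_mult_right_zero[symmetric])
    also have "\<dots> = (\<integral>\<xi>. of_real (s n * (poisson_kernel (Z n) \<xi> - 1)) * G \<xi> \<partial>circle_measure)"
      by (intro Bochner_Integration.integral_cong) (auto simp: scaleR_conv_of_real algebra_simps)
    finally show ?thesis .
  qed
  obtain A where A: "\<And>n. cmod (s n * Z n) \<le> A"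
    using convergent_imp_Bseq[OF convergentI[OF sZ]] unfolding Bseq_def by metis
  then have A0: "0 \<le> A"
    using norm_ge_zero order_trans by blast
  have far: "1/2 \<le> cmod (\<xi> - Z n)" if "cmod \<xi> = 1" for \<xi> n
    using norm_triangle_ineq2[of \<xi> "Z n"] that Z(2)[of n] by simp
  have K: "s n * (poisson_kernel (Z n) \<xi> - 1) = 2 * Re (cnj (s n * Z n) * (\<xi> - Z n)) / (cmod (\<xi> - Z n))\<^sup>2"
    if "cmod \<xi> = 1" for n \<xi>
  proof -
    have "\<xi> \<noteq> Z n"
      using far[OF that, of n] by auto
    have "Re (cnj (s n * Z n) * (\<xi> - Z n)) = s n * Re (cnj (Z n) * (\<xi> - Z n))"
      by (simp add: algebra_simps)
    then show ?thesis
      unfolding poisson_kernel_minus_1[OF that \<open>\<xi> \<noteq> Z n\<close>] by (simp only: times_divide_eq_right) (simp only: mult_ac)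
  qed
  have bd: "\<bar>s n * (poisson_kernel (Z n) \<xi> - 1)\<bar> \<le> 4 * A" if "cmod \<xi> = 1" for n \<xi>
  proof -
    define D where "D = cmod (\<xi> - Z n)"
    have D: "1/2 \<le> D"
      using far[OF that] by (simp add: D_def)
    define R where "R = Re (cnj (s n * Z n) * (\<xi> - Z n))"
    have "\<bar>R\<bar> \<le> cmod (cnj (s n * Z n) * (\<xi> - Z n))"
      unfolding R_def by (rule abs_Re_le_cmod)
    also have "\<dots> \<le> A * D"
      using A[of n] unfolding norm_mult complex_mod_cnj D_def by (intro mult_right_mono) (auto simp: norm_mult)
    finally have "2 * \<bar>R\<bar> / D\<^sup>2 \<le> 2 * (A * D) / D\<^sup>2"
      by (intro divide_right_mono) auto
    then have "\<bar>s n * (poisson_kernel (Z n) \<xi> - 1)\<bar> \<le> 2 * (A * D) / D\<^sup>2"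
      unfolding K[OF that] D_def[symmetric] R_def[symmetric] by (simp add: abs_mult)
    also have "\<dots> = 2 * A / D"
      using D by (simp add: power2_eq_square)
    also have "\<dots> \<le> 2 * A / (1/2)"
      using A0 D by (intro divide_left_mono) auto
    finally show ?thesis by simp
  qed
  have "(\<lambda>n. \<integral>\<xi>. of_real (s n * (poisson_kernel (Z n) \<xi> - 1)) * G \<xi> \<partial>circle_measure)
      \<longlonglongrightarrow> (\<integral>\<xi>. of_real (2 * Re (cnj v * \<xi>)) * G \<xi> \<partial>circle_measure)"
  proof (rule integral_dominated_convergence[where w="\<lambda>_. 4 * A * K"])
    have "(\<lambda>\<xi>. 2 * Re (cnj v * \<xi>)) \<in> borel_measurable circle_measure"
      by (intro continuous_on_imp_measurable_circle continuous_intros)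
    then show "(\<lambda>\<xi>. of_real (2 * Re (cnj v * \<xi>)) * G \<xi>) \<in> borel_measurable circle_measure"
      by measurable
    show "(\<lambda>\<xi>. of_real (s n * (poisson_kernel (Z n) \<xi> - 1)) * G \<xi>) \<in> borel_measurable circle_measure" for n
      by measurable
    show "AE \<xi> in circle_measure. (\<lambda>n. of_real (s n * (poisson_kernel (Z n) \<xi> - 1)) * G \<xi>)
        \<longlonglongrightarrow> of_real (2 * Re (cnj v * \<xi>)) * G \<xi>"
    proof (rule AE_I2)
      fix \<xi> assume "\<xi> \<in> space circle_measure"
      then have \<xi>: "cmod \<xi> = 1" by simp
      have "(\<lambda>n. 2 * Re (cnj (s n * Z n) * (\<xi> - Z n)) / (cmod (\<xi> - Z n))\<^sup>2) \<longlonglongrightarrow> 2 * Re (cnj v * (\<xi> - 0)) / (cmod (\<xi> - 0))\<^sup>2"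
        using \<xi> by (intro tendsto_intros Z sZ) auto
      then have "(\<lambda>n. s n * (poisson_kernel (Z n) \<xi> - 1)) \<longlonglongrightarrow> 2 * Re (cnj v * \<xi>)"
        unfolding K[OF \<xi>] using \<xi> by simp
      then show "(\<lambda>n. of_real (s n * (poisson_kernel (Z n) \<xi> - 1)) * G \<xi>)
        \<longlonglongrightarrow> of_real (2 * Re (cnj v * \<xi>)) * G \<xi>"
        by (rule tendsto_mult[OF tendsto_of_real tendsto_const])
    qed
    show "AE \<xi> in circle_measure. cmod (of_real (s n * (poisson_kernel (Z n) \<xi> - 1)) * G \<xi>) \<le> 4 * A * K" for n
    proof (rule AE_I2)
      fix \<xi> assume "\<xi> \<in> space circle_measure"
      then show "cmod (of_real (s n * (poisson_kernel (Z n) \<xi> - 1)) * G \<xi>) \<le> 4 * A * K"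
        unfolding norm_mult norm_of_real using bd[of \<xi> n] G[of \<xi>] A0 by (intro mult_mono) auto
    qed
  qed auto
  then show ?thesis
    unfolding eq .
qed

section \<open>From non-tangential to radial limits\<close>

lemma has_nontangential_limit_cong:
  assumes "\<And>z. cmod z < 1 \<Longrightarrow> g z = h z"
  shows "has_nontangential_limit g \<xi> l \<longleftrightarrow> has_nontangential_limit h \<xi> l"
  unfolding has_nontangential_limit_def
  by (intro all_cong1 imp_cong refl filterlim_cong) (auto simp: eventually_at_filter stolz_region_def assms)

lemma radius_tendsto_stolz:
  assumes "cmod \<xi> = 1"
  shows "LIM r (at_left (1::real)). of_real r * \<xi> :> at \<xi> within stolz_region 2 \<xi>"
  unfolding filterlim_at
proof
  show "((\<lambda>r. of_real r * \<xi>) \<longlongrightarrow> \<xi>) (at_left (1::real))"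
    by (rule tendsto_eq_intros refl | simp)+
  have "eventually (\<lambda>r. r \<in> {0<..<1::real}) (at_left 1)"
    by (rule eventually_at_left_real) simp
  then show "\<forall>\<^sub>F r in at_left (1::real). of_real r * \<xi> \<in> stolz_region 2 \<xi> \<and> of_real r * \<xi> \<noteq> \<xi>"
  proof eventually_elim
    case (elim r)
    have "of_real r * \<xi> - \<xi> = of_real (r - 1) * \<xi>"
      by (simp add: algebra_simps)
    then have "cmod (of_real r * \<xi> - \<xi>) = 1 - r"
      using elim assms(1) by (simp only: norm_mult norm_of_real) simp
    moreover have "cmod (of_real r * \<xi>) = r"
      using elim assms(1) by (simp add: norm_mult)
    ultimately show ?case
      using elim by (auto simp: stolz_region_def)
  qed
qed

lemma nontangential_imp_radial_limit:
  assumes "cmod \<xi> = 1" "has_nontangential_limit g \<xi> l"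
  shows "has_radial_limit g \<xi> l"
  unfolding has_radial_limit_def
proof (rule filterlim_compose[OF _ radius_tendsto_stolz[OF assms(1)]])
  show "(g \<longlongrightarrow> l) (at \<xi> within stolz_region 2 \<xi>)"
    using assms(2) by (simp add: has_nontangential_limit_def)
qed

locale inner_iterates =
  fixes f :: "complex \<Rightarrow> complex"
  assumes inner: "inner_function f" and zero: "f 0 = 0" and nonrot: "\<not> is_rotation f"
begin

abbreviation T :: "complex \<Rightarrow> complex" where "T \<equiv> boundary_map f"

lemmas holf = inner_functionD(1)[OF inner]
lemmas f_less = inner_functionD(2)[OF inner]
lemmas measurable_T [measurable] = measurable_boundary_map[OF holf]

lemma iter_less: "cmod z < 1 \<Longrightarrow> cmod ((f ^^ n) z) < 1"
  by (induction n) (auto intro: f_less)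

lemma iter_holomorphic: "(f ^^ n) holomorphic_on ball 0 1"
proof (induction n)
  case (Suc n)
  have "f \<circ> (f ^^ n) holomorphic_on ball 0 1"
    using iter_less by (intro holomorphic_on_compose_gen[OF Suc holf]) auto
  then show ?case by (simp add: o_def)
qed (simp add: id_def)

lemma T_pow_norm: "cmod \<xi> = 1 \<Longrightarrow> cmod ((T ^^ n) \<xi>) = 1"
  by (induction n) auto

lemma measurable_T_pow [measurable]: "(T ^^ n) \<in> measurable circle_measure circle_measure"
proof (induction n)
  case (Suc n)
  show ?case
    using measurable_comp[OF Suc measurable_T] by simp
qed (simp add: id_def)

lemma borel_measurable_T_pow [measurable]: "(T ^^ n) \<in> borel_measurable circle_measure"
  using measurable_compose[OF measurable_T_pow measurable_circle_borel[of "\<lambda>x. x"]] by simp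

lemma borel_measurable_T [measurable]: "T \<in> borel_measurable circle_measure"
  using borel_measurable_T_pow[of 1] by simp

section \<open>Harmonic measure along an orbit, and boundary values of the iterates\<close>

lemma distr_harm_T_pow: "cmod z < 1 \<Longrightarrow> distr (harm z) circle_measure (T ^^ n) = harm ((f ^^ n) z)"
proof (induction n)
  case 0
  have "distr (harm z) circle_measure (\<lambda>x. x) = distr (harm z) (harm z) (\<lambda>x. x)"
    by (rule distr_cong) auto
  then show ?case
    by (simp add: id_def distr_id)
next
  case (Suc n)
  have m: "(T ^^ n) \<in> measurable (harm z) circle_measure"
    using measurable_T_pow by (simp add: harm_def)
  have "distr (harm z) circle_measure (T ^^ Suc n) = distr (distr (harm z) circle_measure (T ^^ n)) circle_measure T"
    using distr_distr[OF measurable_T m] by simp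
  also have "\<dots> = harm ((f ^^ Suc n) z)"
    unfolding Suc.IH[OF Suc.prems] using distr_harm_boundary_map[OF inner iter_less[OF Suc.prems]] by simp
  finally show ?case .
qed

lemma integral_harm_T_pow:
  fixes u :: "complex \<Rightarrow> 'b::{banach, second_countable_topology}"
  assumes "cmod z < 1" "u \<in> borel_measurable circle_measure"
  shows "(\<integral>\<xi>. u ((T ^^ n) \<xi>) \<partial>harm z) = (\<integral>\<xi>. u \<xi> \<partial>harm ((f ^^ n) z))"
proof -
  have m: "(T ^^ n) \<in> measurable (harm z) circle_measure"
    using measurable_T_pow by (simp add: harm_def)
  have "(\<integral>\<xi>. u ((T ^^ n) \<xi>) \<partial>harm z) = (\<integral>\<xi>. u \<xi> \<partial>distr (harm z) circle_measure (T ^^ n))"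
    by (rule integral_distr[OF m assms(2), symmetric])
  then show ?thesis
    by (simp only: distr_harm_T_pow[OF assms(1)])
qed

lemma integral_harm_T_pow_id:
  assumes "cmod z < 1"
  shows "(\<integral>\<xi>. (T ^^ n) \<xi> \<partial>harm z) = (f ^^ n) z"
proof -
  have "(\<lambda>x::complex. x) \<in> borel_measurable circle_measure"
    by (rule measurable_circle_borel) simp
  then have "(\<integral>\<xi>. (T ^^ n) \<xi> \<partial>harm z) = (\<integral>\<xi>. \<xi> \<partial>harm ((f ^^ n) z))"
    by (rule integral_harm_T_pow[OF assms])
  also have "\<dots> = (f ^^ n) z"
    by (rule integral_harm_holomorphic) (auto intro!: continuous_intros holomorphic_intros iter_less assms)
  finally show ?thesis .
qed

lemma T_pow_integrable: "integrable circle_measure (T ^^ n)"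
  using T_pow_norm by (intro circle.integrable_const_bound[of _ 1] AE_I2) auto

text \<open>Radial limits do not compose, since f maps a radius to a curve that need not be a
  radius. Instead \<open>f ^^ n\<close> is the Poisson integral of \<open>T ^^ n\<close>, so Fatou's
  theorem applies.\<close>

lemma iter_nontangential_limit: "AE \<xi> in circle_measure. has_nontangential_limit (f ^^ n) \<xi> ((T ^^ n) \<xi>)"
  using fatou_nontangential_limit[OF T_pow_integrable[of n]]
proof eventually_elim
  case (elim \<xi>)
  then show ?case
    by (subst (asm) has_nontangential_limit_cong[where h="f ^^ n"]) (auto simp: integral_harm_T_pow_id)
qed

lemma iter_radial_limit: "AE \<xi> in circle_measure. has_radial_limit (f ^^ n) \<xi> ((T ^^ n) \<xi>)"
  using iter_nontangential_limit[of n] AE_space[of circle_measure]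
  by eventually_elim (auto intro: nontangential_imp_radial_limit)

section \<open>The quotient f z / z and its modulus\<close>

definition \<alpha> :: complex where "\<alpha> = deriv f 0"

definition q :: "complex \<Rightarrow> complex" where "q z = (if z = 0 then \<alpha> else f z / z)"

lemma f_eq: "f z = z * q z"
  by (simp add: q_def zero)

lemma q_holomorphic: "q holomorphic_on ball 0 1"
  by (rule pole_theorem_open_0[OF holf, of 0]) (auto simp: q_def zero \<alpha>_def)

lemma schwarz: "cmod z < 1 \<Longrightarrow> cmod (f z) \<le> cmod z" and \<alpha>_less: "cmod \<alpha> < 1"
proof -
  show "cmod (f z) \<le> cmod z" if "cmod z < 1"
    using Schwarz_Lemma(1)[OF holf zero f_less] that by blast
  have le: "cmod \<alpha> \<le> 1"
    unfolding \<alpha>_def by (rule Schwarz_Lemma(2)[OF holf zero f_less, where \<xi>=0]) auto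
  show "cmod \<alpha> < 1"
  proof (rule ccontr)
    assume "\<not> cmod \<alpha> < 1"
    then have "cmod (deriv f 0) = 1"
      using le by (simp add: \<alpha>_def)
    then have "\<exists>c. (\<forall>z. cmod z < 1 \<longrightarrow> f z = c * z) \<and> cmod c = 1"
      using Schwarz_Lemma(3)[OF holf zero, where \<xi>=0] f_less by auto
    then show False
      using nonrot by (auto simp: is_rotation_def)
  qed
qed

lemma q_le_1: "cmod z < 1 \<Longrightarrow> cmod (q z) \<le> 1"
  using schwarz[of z] \<alpha>_less by (auto simp: q_def norm_divide)

text \<open>The quotient of \<open>(f ^^ k) z\<close> by z. As a product along the orbit it is
  holomorphic also at 0 and can be bounded factor by factor.\<close>

definition H :: "nat \<Rightarrow> complex \<Rightarrow> complex" where "H k z = (\<Prod>j<k. q ((f ^^ j) z))"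

lemma iter_eq: "(f ^^ k) z = z * H k z"
proof (induction k)
  case (Suc k)
  have "(f ^^ Suc k) z = (f ^^ k) z * q ((f ^^ k) z)"
    using f_eq[of "(f ^^ k) z"] by simp
  then show ?case
    by (simp add: H_def Suc.IH mult.assoc)
qed (simp add: H_def)

lemma H_holomorphic: "H k holomorphic_on ball 0 1"
proof -
  have "q \<circ> (f ^^ j) holomorphic_on ball 0 1" for j
    using iter_less by (intro holomorphic_on_compose_gen[OF iter_holomorphic q_holomorphic]) auto
  then show ?thesis
    unfolding H_def[abs_def] by (intro holomorphic_intros) (simp add: o_def)
qed

lemma H_le_1: "cmod z < 1 \<Longrightarrow> cmod (H k z) \<le> 1"
  by (induction k) (auto simp: H_def norm_mult intro!: mult_le_one q_le_1 iter_less)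

text \<open>On the circle \<open>cnj \<xi>\<close> = 1 / \<xi>, so the integrand consists of the
  radial limits of the bounded holomorphic function \<open>H k\<close>.\<close>

lemma integral_cnj_T_pow:
  assumes z: "cmod z < 1"
  shows "(\<integral>\<xi>. cnj \<xi> * (T ^^ k) \<xi> \<partial>harm z) = H k z"
proof (rule integral_harm_radial_limit[OF H_holomorphic H_le_1 _ _ z])
  show "(\<lambda>\<xi>. cnj \<xi> * (T ^^ k) \<xi>) \<in> borel_measurable circle_measure"
    by measurable
  show "AE \<xi> in circle_measure. has_radial_limit (H k) \<xi> (cnj \<xi> * (T ^^ k) \<xi>)"
    using iter_radial_limit[of k] AE_space[of circle_measure]
  proof eventually_elim
    case (elim \<xi>)
    then have \<xi>: "cmod \<xi> = 1" "\<xi> \<noteq> 0" by auto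
    have lim: "((\<lambda>r. (f ^^ k) (of_real r * \<xi>) / (of_real r * \<xi>)) \<longlongrightarrow> (T ^^ k) \<xi> / (of_real 1 * \<xi>)) (at_left 1)"
      using elim(1) \<xi> unfolding has_radial_limit_def by (intro tendsto_intros) auto
    have "eventually (\<lambda>r. r \<in> {0<..<1::real}) (at_left 1)"
      by (rule eventually_at_left_real) simp
    then have "\<forall>\<^sub>F r in at_left 1. (f ^^ k) (of_real r * \<xi>) / (of_real r * \<xi>) = H k (of_real r * \<xi>)"
      by eventually_elim (use \<xi> in \<open>simp add: iter_eq\<close>)
    moreover have "(T ^^ k) \<xi> / (of_real 1 * \<xi>) = cnj \<xi> * (T ^^ k) \<xi>"
      using \<xi> complex_norm_square[of \<xi>] by (simp add: divide_eq_eq mult_ac)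
    ultimately show ?case
      using Lim_transform_eventually[OF lim] unfolding has_radial_limit_def by simp
  qed
qed

lemma integral_T_pow_mult:
  assumes z: "cmod z < 1" and "n \<le> m"
  shows "(\<integral>\<xi>. cnj ((T ^^ n) \<xi>) * (T ^^ m) \<xi> \<partial>harm z) = H (m - n) ((f ^^ n) z)"
proof -
  have "(T ^^ m) \<xi> = (T ^^ (m - n)) ((T ^^ n) \<xi>)" for \<xi>
    using funpow_add[of "m - n" n T] \<open>n \<le> m\<close> by simp
  then have "(\<integral>\<xi>. cnj ((T ^^ n) \<xi>) * (T ^^ m) \<xi> \<partial>harm z) = (\<integral>\<xi>. cnj \<xi> * (T ^^ (m - n)) \<xi> \<partial>harm ((f ^^ n) z))"
    using integral_harm_T_pow[OF z, of "\<lambda>\<xi>. cnj \<xi> * (T ^^ (m - n)) \<xi>" n] by simp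
  then show ?thesis
    by (simp add: integral_cnj_T_pow iter_less z)
qed

text \<open>The gap 1 - |\<alpha>| at the origin, halved because the lower bound of
  \<open>poisson_kernel_ge\<close> is (1 - |z|) / 2.\<close>

definition \<kappa> :: real where "\<kappa> = (1 - cmod \<alpha>) / 2"

lemma \<kappa>: "0 < \<kappa>" "\<kappa> \<le> 1/2"
  using \<alpha>_less by (auto simp: \<kappa>_def)

text \<open>Harnack's inequality for the positive harmonic function \<^term>\<open>1 - Re (c * q z)\<close> with unimodular \<open>c\<close>.\<close>

lemma q_le:
  assumes z: "cmod z < 1"
  shows "cmod (q z) \<le> 1 - \<kappa> * (1 - cmod z)"
proof (cases "q z = 0")
  case True
  have "\<kappa> * (1 - cmod z) \<le> 1 * 1"
    using \<kappa> z by (intro mult_mono) auto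
  then show ?thesis
    using True by simp
next
  case False
  \<comment> \<open>Rotates \<open>q z\<close> to its modulus, so that the Poisson integral of
    \<open>v\<close> at z equals 1 - |q z|.\<close>
  define c where "c = cnj (q z) / cmod (q z)"
  have c: "cmod c = 1"
    using False by (simp add: c_def norm_divide)
  have cq: "c * q z = cmod (q z)"
    using False complex_norm_square[of "q z"] by (simp add: c_def power2_eq_square mult.commute divide_eq_eq)
  define v where "v \<xi> = 1 - Re (c * (cnj \<xi> * T \<xi>))" for \<xi>
  have vm [measurable]: "v \<in> borel_measurable circle_measure"
    unfolding v_def[abs_def] by measurable
  have v: "0 \<le> v \<xi>" "v \<xi> \<le> 2" if "cmod \<xi> = 1" for \<xi>
    using abs_Re_le_cmod[of "c * (cnj \<xi> * T \<xi>)"] that c unfolding v_def by (simp_all add: norm_mult)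
  have int: "(\<integral>\<xi>. v \<xi> \<partial>harm w) = 1 - Re (c * q w)" if w: "cmod w < 1" for w
  proof -
    interpret hw: prob_space "harm w"
      by (rule prob_space_harm[OF w])
    have i: "integrable (harm w) (\<lambda>\<xi>. c * (cnj \<xi> * T \<xi>))"
      using c w by (intro integrable_harm_bounded[where B=1]) (auto simp: norm_mult)
    have "(\<integral>\<xi>. c * (cnj \<xi> * T \<xi>) \<partial>harm w) = c * q w"
      using integral_cnj_T_pow[OF w, of 1] by (simp add: H_def)
    then have "(\<integral>\<xi>. Re (c * (cnj \<xi> * T \<xi>)) \<partial>harm w) = Re (c * q w)"
      by (simp only: integral_Re[OF i])
    moreover have "integrable (harm w) (\<lambda>\<xi>. Re (c * (cnj \<xi> * T \<xi>)))"
      by (rule integrable_Re[OF i])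
    ultimately show ?thesis
      unfolding v_def by (subst Bochner_Integration.integral_diff) (auto simp: hw.prob_space[unfolded space_harm])
  qed
  have iv: "integrable circle_measure v"
    using v by (intro circle.integrable_const_bound[of _ 2] AE_I2) auto
  have "(1 - cmod z) / 2 * (1 - Re (c * \<alpha>)) = (1 - cmod z) / 2 * (\<integral>\<xi>. v \<xi> \<partial>harm 0)"
    by (subst int) (auto simp: q_def)
  also have "\<dots> = (\<integral>\<xi>. (1 - cmod z) / 2 * v \<xi> \<partial>circle_measure)"
    by (simp add: harm_0)
  also have "\<dots> \<le> (\<integral>\<xi>. poisson_kernel z \<xi> *\<^sub>R v \<xi> \<partial>circle_measure)"
  proof (rule integral_mono)
    have "integrable (harm z) v"
      by (rule integrable_harm[OF iv z])
    then show "integrable circle_measure (\<lambda>\<xi>. poisson_kernel z \<xi> *\<^sub>R v \<xi>)"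
      unfolding harm_def using z by (subst (asm) integrable_density) (auto simp: poisson_kernel_nonneg)
    show "(1 - cmod z) / 2 * v \<xi> \<le> poisson_kernel z \<xi> *\<^sub>R v \<xi>" if "\<xi> \<in> space circle_measure" for \<xi>
      unfolding real_scaleR_def using that v(1)[of \<xi>] poisson_kernel_ge[OF z, of \<xi>] by (intro mult_right_mono) auto
  qed (use iv in simp)
  also have "\<dots> = (\<integral>\<xi>. v \<xi> \<partial>harm z)"
    by (rule integral_harm[OF z vm, symmetric])
  also have "\<dots> = 1 - cmod (q z)"
    using int[OF z] cq by simp
  finally have *: "(1 - cmod z) / 2 * (1 - Re (c * \<alpha>)) \<le> 1 - cmod (q z)" .
  have "Re (c * \<alpha>) \<le> cmod \<alpha>"
    using complex_Re_le_cmod[of "c * \<alpha>"] c by (simp add: norm_mult)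
  then have "(1 - cmod z) / 2 * (1 - cmod \<alpha>) \<le> (1 - cmod z) / 2 * (1 - Re (c * \<alpha>))"
    using z by (intro mult_left_mono) auto
  with * show ?thesis
    by (simp add: \<kappa>_def mult.commute)
qed

end

section \<open>Telescoping sums and Schur's test\<close>

definition damping :: "real \<Rightarrow> (nat \<Rightarrow> real) \<Rightarrow> nat \<Rightarrow> nat \<Rightarrow> real" where
  "damping c t n m = (\<Prod>j\<in>{n..<m}. 1 - c * t j)"

lemma damping_bounds:
  assumes c: "0 \<le> c" "c \<le> 1" and t: "\<And>j. 0 \<le> t j" "\<And>j. t j \<le> 1"
  shows "0 \<le> damping c t n m"
proof -
  have "c * t j \<le> 1 * 1" for j
    using c t by (intro mult_mono) auto
  then show ?thesis
    unfolding damping_def by (intro prod_nonneg) simp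
qed

text \<open>\<open>c * t m\<close> times the product up to m is the drop of the product from m to m
  + 1, and these drops telescope to at most 1; monotonicity of t gives
  \<open>t n \<le> t m\<close>.\<close>

lemma damping_row_sum:
  assumes c: "0 < c" "c \<le> 1" and t: "\<And>j. 0 \<le> t j" "\<And>j. t j \<le> 1" "\<And>j. t j \<le> t (Suc j)"
    and "n \<le> N"
  shows "(\<Sum>m\<in>{n..<N}. t n * damping c t n m) \<le> 1 / c"
proof -
  have p: "0 \<le> damping c t n m" for n m
    using damping_bounds[of c t n m] c t(1,2) by simp
  have "c * (\<Sum>m\<in>{n..<N}. t n * damping c t n m) \<le> 1 - damping c t n N"
    using \<open>n \<le> N\<close>
  proof (induction N rule: dec_induct)
    case (step N)
    have "t n \<le> t N"
      using lift_Suc_mono_le[of t, OF t(3) step(1)] .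
    then have "c * (t n * damping c t n N) \<le> c * (t N * damping c t n N)"
      using c p by (intro mult_left_mono mult_right_mono) auto
    moreover have "damping c t n (Suc N) = damping c t n N * (1 - c * t N)"
      using step by (simp add: damping_def prod.atLeastLessThan_Suc)
    ultimately show ?case
      using step by (simp add: sum.atLeastLessThan_Suc algebra_simps)
  qed (simp add: damping_def)
  then have "c * (\<Sum>m\<in>{n..<N}. t n * damping c t n m) \<le> 1"
    using p[of n N] by linarith
  then show ?thesis
    using c by (simp add: field_simps)
qed

text \<open>Raising the lower end of the product from n to n + 1 increases it by
  \<open>c * t n\<close> times the new product, hence by at least \<open>c * t n\<close> times the
  old one; the increments telescope up to the empty product 1.\<close>

lemma damping_column_sum:
  assumes c: "0 < c" "c \<le> 1" and t: "\<And>j. 0 \<le> t j" "\<And>j. t j \<le> 1"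
  shows "(\<Sum>n<m. t n * damping c t n m) \<le> 1 / c"
proof -
  have p: "0 \<le> damping c t n m" for n m
    using damping_bounds[of c t n m] c t(1,2) by simp
  have "c * (\<Sum>n<k. t n * damping c t n m) \<le> damping c t k m" if "k \<le> m" for k
    using that
  proof (induction k)
    case (Suc k)
    have eq: "damping c t k m = (1 - c * t k) * damping c t (Suc k) m"
      using Suc.prems by (simp add: damping_def prod.atLeast_Suc_lessThan)
    have "0 \<le> (c * t k)\<^sup>2 * damping c t (Suc k) m"
      using p by simp
    then have "c * (t k * damping c t k m) + damping c t k m \<le> damping c t (Suc k) m"
      unfolding eq by (simp add: algebra_simps power2_eq_square)
    then show ?case
      using Suc by (simp add: distrib_left)
  qed (use p in simp)
  from this[of m] have "c * (\<Sum>n<m. t n * damping c t n m) \<le> 1"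
    by (simp add: damping_def)
  then show ?thesis
    using c by (simp add: field_simps)
qed

text \<open>By 2 x y \<le> x^2 + y^2 and symmetry, each (a n)^2 ends up weighted by one row
  sum.\<close>

lemma symmetric_schur_test:
  fixes a :: "nat \<Rightarrow> real"
  assumes sym: "\<And>n m. M n m = M m n" and nonneg: "\<And>n m. 0 \<le> M n m"
    and row: "\<And>n. n < N \<Longrightarrow> (\<Sum>m<N. M n m) \<le> B"
  shows "(\<Sum>n<N. \<Sum>m<N. a n * a m * M n m) \<le> B * (\<Sum>n<N. (a n)\<^sup>2)"
proof -
  have "(\<Sum>n<N. \<Sum>m<N. a n * a m * M n m) \<le> (\<Sum>n<N. \<Sum>m<N. ((a n)\<^sup>2 * M n m + (a m)\<^sup>2 * M n m) / 2)"
  proof (intro sum_mono)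
    fix n m
    have "a n * a m \<le> ((a n)\<^sup>2 + (a m)\<^sup>2) / 2"
      using sum_squares_bound[of "a n" "a m"] by simp
    then have "a n * a m * M n m \<le> ((a n)\<^sup>2 + (a m)\<^sup>2) / 2 * M n m"
      by (intro mult_right_mono nonneg)
    then show "a n * a m * M n m \<le> ((a n)\<^sup>2 * M n m + (a m)\<^sup>2 * M n m) / 2"
      by (simp add: algebra_simps)
  qed
  also have "\<dots> = ((\<Sum>n<N. \<Sum>m<N. (a n)\<^sup>2 * M n m) + (\<Sum>n<N. \<Sum>m<N. (a m)\<^sup>2 * M n m)) / 2"
    by (simp add: sum.distrib sum_divide_distrib[symmetric])
  also have "(\<Sum>n<N. \<Sum>m<N. (a m)\<^sup>2 * M n m) = (\<Sum>n<N. \<Sum>m<N. (a n)\<^sup>2 * M n m)"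
    by (subst sum.swap) (simp add: sym)
  also have "((\<Sum>n<N. \<Sum>m<N. (a n)\<^sup>2 * M n m) + (\<Sum>n<N. \<Sum>m<N. (a n)\<^sup>2 * M n m)) / 2 = (\<Sum>n<N. (a n)\<^sup>2 * (\<Sum>m<N. M n m))"
    by (simp only: sum_distrib_left[symmetric]) simp
  also have "\<dots> \<le> (\<Sum>n<N. (a n)\<^sup>2 * B)"
    by (intro sum_mono mult_left_mono row) auto
  finally show ?thesis
    by (simp only: sum_distrib_right[symmetric] mult.commute[of B])
qed

context inner_iterates
begin

section \<open>Orthogonality at the origin\<close>

lemma isCont_q_0: "isCont q 0"
  by (intro field_differentiable_imp_continuous_at holomorphic_on_imp_differentiable_at[OF q_holomorphic]) auto

text \<open>Differentiating \<open>\<integral> G \<circ> T d(harm z) = \<integral> G d(harm (f z))\<close> in \<open>z\<close> at the origin.\<close>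

lemma integral_Re_mult_T:
  assumes G [measurable]: "G \<in> borel_measurable circle_measure" and bd: "\<And>\<xi>. cmod \<xi> = 1 \<Longrightarrow> cmod (G \<xi>) \<le> K"
    and v: "cmod v = 1"
  shows "(\<integral>\<xi>. of_real (2 * Re (cnj v * \<xi>)) * G (T \<xi>) \<partial>circle_measure) =
         (\<integral>\<xi>. of_real (2 * Re (cnj v * (cnj \<alpha> * T \<xi>))) * G (T \<xi>) \<partial>circle_measure)"
proof -
  define s where "s n = real (n + 2)" for n
  \<comment> \<open>These points approach 0 along the ray through v. As f z = z q z, the scaled
    images \<open>s n * f (Z n)\<close> tend to v \<alpha>, so the same derivative can be computed
    before and after applying f.\<close>
  define Z where "Z n = v / of_real (s n)" for n
  have s: "s n \<ge> 2" for n
    by (simp add: s_def)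
  have Zn: "cmod (Z n) = 1 / s n" for n
    using s[of n] v by (simp add: Z_def norm_divide)
  have Z2: "cmod (Z n) \<le> 1/2" for n
    unfolding Zn using s[of n] by (simp add: divide_simps)
  then have Z1: "cmod (Z n) < 1" for n
    using le_less_trans[of "cmod (Z n)" "1/2" 1] by simp
  have "(\<lambda>n. inverse (real (n + 2))) \<longlonglongrightarrow> 0"
    using LIMSEQ_Suc[OF LIMSEQ_inverse_real_of_nat] by simp
  then have Z0: "Z \<longlonglongrightarrow> 0"
    by (intro tendsto_norm_zero_cancel[of Z]) (simp add: Zn s_def divide_inverse)
  have sZ: "s n * Z n = v" for n
    using s[of n] by (simp add: Z_def)
  have sfZ: "s n * f (Z n) = v * q (Z n)" for n
    unfolding f_eq[of "Z n"] using sZ[of n] by (simp flip: mult.assoc)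
  have qZ: "(\<lambda>n. q (Z n)) \<longlonglongrightarrow> \<alpha>"
    using isCont_tendsto_compose[OF isCont_q_0 Z0] by (simp add: q_def)
  have fZ0: "(\<lambda>n. f (Z n)) \<longlonglongrightarrow> 0"
    using tendsto_mult[OF Z0 qZ] by (subst tendsto_cong[OF always_eventually, OF allI[OF f_eq]]) simp
  have fZ2: "cmod (f (Z n)) \<le> 1/2" for n
    using schwarz[OF Z1] Z2 order_trans by blast
  have GT [measurable]: "(\<lambda>\<xi>. G (T \<xi>)) \<in> borel_measurable circle_measure"
    by (rule measurable_compose[OF measurable_T G])
  have GTi: "(\<integral>\<xi>. G (T \<xi>) \<partial>harm z) = (\<integral>\<xi>. G \<xi> \<partial>harm (f z))" if "cmod z < 1" for z
    using integral_harm_T_pow[OF that G, of 1] by simp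
  from GTi[of 0] have GT0: "(\<integral>\<xi>. G (T \<xi>) \<partial>circle_measure) = (\<integral>\<xi>. G \<xi> \<partial>circle_measure)"
    by (simp add: zero harm_0)
  have "(\<lambda>n. s n * ((\<integral>\<xi>. G (T \<xi>) \<partial>harm (Z n)) - (\<integral>\<xi>. G (T \<xi>) \<partial>circle_measure)))
           \<longlonglongrightarrow> (\<integral>\<xi>. of_real (2 * Re (cnj v * \<xi>)) * G (T \<xi>) \<partial>circle_measure)"
    by (rule poisson_kernel_derivative_limit[OF GT bd Z0 Z2]) (simp_all add: sZ)
  moreover have "(\<lambda>n. s n * ((\<integral>\<xi>. G (T \<xi>) \<partial>harm (Z n)) - (\<integral>\<xi>. G (T \<xi>) \<partial>circle_measure)))
           \<longlonglongrightarrow> (\<integral>\<xi>. of_real (2 * Re (cnj (v * \<alpha>) * \<xi>)) * G \<xi> \<partial>circle_measure)"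
    unfolding GTi[OF Z1] GT0
    by (rule poisson_kernel_derivative_limit[OF G bd fZ0 fZ2]) (simp_all add: sfZ tendsto_mult[OF tendsto_const qZ])
  ultimately have "(\<integral>\<xi>. of_real (2 * Re (cnj v * \<xi>)) * G (T \<xi>) \<partial>circle_measure) =
      (\<integral>\<xi>. of_real (2 * Re (cnj (v * \<alpha>) * \<xi>)) * G \<xi> \<partial>circle_measure)"
    by (rule LIMSEQ_unique)
  also have "\<dots> = (\<integral>\<xi>. of_real (2 * Re (cnj (v * \<alpha>) * T \<xi>)) * G (T \<xi>) \<partial>circle_measure)"
  proof -
    have m: "(\<lambda>\<xi>. of_real (2 * Re (cnj (v * \<alpha>) * \<xi>)) * G \<xi>) \<in> borel_measurable circle_measure"
      by measurable
    show ?thesis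
      using integral_harm_T_pow[OF _ m, of 0 1] by (simp add: zero harm_0)
  qed
  finally show ?thesis
    by (simp only: complex_cnj_mult mult.assoc)
qed

text \<open>The remainder of \<xi> after subtracting its conditional expectation given
  \<open>T\<close>.\<close>

definition X :: "complex \<Rightarrow> complex" where "X \<xi> = \<xi> - cnj \<alpha> * T \<xi>"

lemma measurable_X [measurable]: "X \<in> borel_measurable circle_measure"
  unfolding X_def[abs_def] by measurable

lemma X_bound: "cmod \<xi> = 1 \<Longrightarrow> cmod (X \<xi>) \<le> 2"
  using norm_triangle_ineq4[of \<xi> "cnj \<alpha> * T \<xi>"] \<alpha>_less by (simp add: X_def norm_mult)

text \<open>\<open>integral_Re_mult_T\<close> tests only real parts; the directions v = 1 and v =
  \<i> together recover the complex identity.\<close>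

lemma X_orthogonal:
  assumes G [measurable]: "G \<in> borel_measurable circle_measure" and bd: "\<And>\<xi>. cmod \<xi> = 1 \<Longrightarrow> cmod (G \<xi>) \<le> K"
  shows "(\<integral>\<xi>. X \<xi> * G (T \<xi>) \<partial>circle_measure) = 0"
proof -
  have GT [measurable]: "(\<lambda>\<xi>. G (T \<xi>)) \<in> borel_measurable circle_measure"
    by (rule measurable_compose[OF measurable_T G])
  have int: "integrable circle_measure (\<lambda>\<xi>. of_real (2 * Re (cnj v * u \<xi>)) * G (T \<xi>))"
    if [measurable]: "u \<in> borel_measurable circle_measure" and u: "\<And>\<xi>. cmod \<xi> = 1 \<Longrightarrow> cmod (u \<xi>) \<le> 2" and v: "cmod v = 1" for u v
  proof (rule circle.integrable_const_bound[of _ "4 * K"])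
    show "AE \<xi> in circle_measure. cmod (of_real (2 * Re (cnj v * u \<xi>)) * G (T \<xi>)) \<le> 4 * K"
    proof (rule AE_I2)
      fix \<xi> assume "\<xi> \<in> space circle_measure"
      then have "\<bar>Re (cnj v * u \<xi>)\<bar> \<le> 2"
        using abs_Re_le_cmod[of "cnj v * u \<xi>"] u[of \<xi>] v by (simp add: norm_mult)
      then show "cmod (of_real (2 * Re (cnj v * u \<xi>)) * G (T \<xi>)) \<le> 4 * K"
        unfolding norm_mult norm_of_real abs_mult using bd[of "T \<xi>"] by (intro mult_mono) auto
    qed
  qed measurable
  have 0: "(\<integral>\<xi>. of_real (2 * Re (cnj v * X \<xi>)) * G (T \<xi>) \<partial>circle_measure) = 0" if v: "cmod v = 1" for v
  proof -
    have "(\<integral>\<xi>. of_real (2 * Re (cnj v * X \<xi>)) * G (T \<xi>) \<partial>circle_measure) =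
       (\<integral>\<xi>. of_real (2 * Re (cnj v * \<xi>)) * G (T \<xi>) - of_real (2 * Re (cnj v * (cnj \<alpha> * T \<xi>))) * G (T \<xi>) \<partial>circle_measure)"
      by (intro Bochner_Integration.integral_cong refl) (simp add: X_def algebra_simps)
    also have "\<dots> = (\<integral>\<xi>. of_real (2 * Re (cnj v * \<xi>)) * G (T \<xi>) \<partial>circle_measure)
        - (\<integral>\<xi>. of_real (2 * Re (cnj v * (cnj \<alpha> * T \<xi>))) * G (T \<xi>) \<partial>circle_measure)"
      using \<alpha>_less by (intro Bochner_Integration.integral_diff int v) (auto simp: norm_mult)
    also have "\<dots> = 0"
      by (simp only: integral_Re_mult_T[OF G bd v] diff_self)
    finally show ?thesis .
  qed
  have "(\<integral>\<xi>. X \<xi> * G (T \<xi>) \<partial>circle_measure) =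
     (\<integral>\<xi>. (1/2) * (of_real (2 * Re (cnj 1 * X \<xi>)) * G (T \<xi>)) + (\<i>/2) * (of_real (2 * Re (cnj \<i> * X \<xi>)) * G (T \<xi>)) \<partial>circle_measure)"
  proof (intro Bochner_Integration.integral_cong refl)
    fix \<xi>
    have "X \<xi> = (1/2) * of_real (2 * Re (cnj 1 * X \<xi>)) + (\<i>/2) * of_real (2 * Re (cnj \<i> * X \<xi>))"
      by (simp add: complex_eq_iff)
    then show "X \<xi> * G (T \<xi>) = (1/2) * (of_real (2 * Re (cnj 1 * X \<xi>)) * G (T \<xi>)) + (\<i>/2) * (of_real (2 * Re (cnj \<i> * X \<xi>)) * G (T \<xi>))"
      by (metis (no_types, lifting) distrib_right mult.assoc)
  qed
  also have "\<dots> = (1/2) * (\<integral>\<xi>. of_real (2 * Re (cnj 1 * X \<xi>)) * G (T \<xi>) \<partial>circle_measure)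
      + (\<i>/2) * (\<integral>\<xi>. of_real (2 * Re (cnj \<i> * X \<xi>)) * G (T \<xi>) \<partial>circle_measure)"
    using int[OF measurable_X X_bound norm_one] int[OF measurable_X X_bound norm_ii]
    by (subst Bochner_Integration.integral_add[OF integrable_mult_right integrable_mult_right])
       (simp_all only: integral_mult_right_zero)
  also have "\<dots> = 0"
    by (simp only: 0 norm_one norm_ii mult_zero_right add_0)
  finally show ?thesis .
qed

lemma distr_circle_T: "distr circle_measure circle_measure T = circle_measure"
  using distr_harm_boundary_map[OF inner, of 0] by (simp add: harm_0 zero)

sublocale rm: reverse_martingale_difference circle_measure T X 2
proof
  fix G K assume "G \<in> borel_measurable circle_measure" "\<And>x. x \<in> space circle_measure \<Longrightarrow> cmod (G x) \<le> K"
  then show "(\<integral>\<xi>. X \<xi> * G (T \<xi>) \<partial>circle_measure) = 0"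
    by (intro X_orthogonal[of G K]) auto
qed (auto simp: distr_circle_T X_bound)

lemma integral_X_sq_ge: "(1 - cmod \<alpha>)\<^sup>2 \<le> (\<integral>\<xi>. (cmod (X \<xi>))\<^sup>2 \<partial>circle_measure)"
proof (rule circle.integral_ge_const[OF rm.integrable_X_sq AE_I2])
  fix \<xi> assume "\<xi> \<in> space circle_measure"
  then show "(1 - cmod \<alpha>)\<^sup>2 \<le> (cmod (X \<xi>))\<^sup>2"
    using norm_triangle_ineq2[of \<xi> "cnj \<alpha> * T \<xi>"] \<alpha>_less by (intro power_mono) (auto simp: X_def norm_mult)
qed

end

section \<open>Variance under harmonic measure\<close>

lemma (in prob_space) integrable_if_square_integrable:
  fixes u :: "'a \<Rightarrow> complex"
  assumes [measurable]: "u \<in> borel_measurable M" and fin: "(\<integral>\<^sup>+x. ennreal ((cmod (u x))\<^sup>2) \<partial>M) < \<infinity>"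
  shows "integrable M u" "integrable M (\<lambda>x. (cmod (u x))\<^sup>2)"
proof -
  show i2: "integrable M (\<lambda>x. (cmod (u x))\<^sup>2)"
    using fin by (intro integrableI_nonneg) auto
  have "integrable M (\<lambda>x. cmod (u x))"
    by (rule square_integrable_imp_integrable) (use i2 in auto)
  then show "integrable M u"
    by (rule Bochner_Integration.integrable_bound) auto
qed

lemma (in prob_space) nn_integral_jensen_square:
  fixes u :: "'a \<Rightarrow> complex"
  assumes [measurable]: "u \<in> borel_measurable M"
  shows "ennreal ((cmod (\<integral>x. u x \<partial>M))\<^sup>2) \<le> (\<integral>\<^sup>+x. ennreal ((cmod (u x))\<^sup>2) \<partial>M)"
proof (cases "(\<integral>\<^sup>+x. ennreal ((cmod (u x))\<^sup>2) \<partial>M) < \<infinity>")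
  case True
  then have i2: "integrable M (\<lambda>x. (cmod (u x))\<^sup>2)" and i1: "integrable M (\<lambda>x. cmod (u x))"
    using integrable_if_square_integrable[OF assms] by auto
  have "0 \<le> variance (\<lambda>x. cmod (u x))"
    by (rule variance_positive)
  then have "(\<integral>x. cmod (u x) \<partial>M)\<^sup>2 \<le> (\<integral>x. (cmod (u x))\<^sup>2 \<partial>M)"
    using i1 i2 by (simp add: variance_eq)
  moreover have "(cmod (\<integral>x. u x \<partial>M))\<^sup>2 \<le> (\<integral>x. cmod (u x) \<partial>M)\<^sup>2"
    by (intro power_mono integral_norm_bound) auto
  ultimately have "(cmod (\<integral>x. u x \<partial>M))\<^sup>2 \<le> (\<integral>x. (cmod (u x))\<^sup>2 \<partial>M)"
    by linarith
  then show ?thesis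
    using i2 by (subst nn_integral_eq_integral) (auto intro: ennreal_leI)
next
  case False
  then show ?thesis
    by (simp add: not_less top_unique)
qed

lemma sum_squared_eq_double_sum:
  fixes y :: "nat \<Rightarrow> complex"
  shows "of_real ((cmod (\<Sum>n<N. y n))\<^sup>2) = (\<Sum>n<N. \<Sum>m<N. y n * cnj (y m))"
  by (subst complex_norm_square) (simp add: sum_product cnj_sum)

lemma three_square_bound:
  fixes x y z :: complex
  shows "(cmod (x + y + z))\<^sup>2 \<le> 3 * (cmod x)\<^sup>2 + 3 * (cmod y)\<^sup>2 + 3 * (cmod z)\<^sup>2"
proof -
  have "(cmod (x + y + z))\<^sup>2 \<le> (cmod x + cmod y + cmod z)\<^sup>2"
    by (intro power_mono norm_triangle_le add_mono norm_triangle_ineq) auto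
  also have "\<dots> \<le> 3 * (cmod x)\<^sup>2 + 3 * (cmod y)\<^sup>2 + 3 * (cmod z)\<^sup>2"
    using zero_le_power2[of "cmod x - cmod y"] zero_le_power2[of "cmod x - cmod z"] zero_le_power2[of "cmod y - cmod z"]
    by (simp add: power2_eq_square algebra_simps)
  finally show ?thesis .
qed

lemma two_square_bound:
  fixes x y :: complex
  shows "(cmod (x + y))\<^sup>2 \<le> 2 * (cmod x)\<^sup>2 + 2 * (cmod y)\<^sup>2"
proof -
  have "(cmod (x + y))\<^sup>2 \<le> (cmod x + cmod y)\<^sup>2"
    by (intro power_mono norm_triangle_ineq) auto
  also have "\<dots> \<le> 2 * (cmod x)\<^sup>2 + 2 * (cmod y)\<^sup>2"
    using zero_le_power2[of "cmod x - cmod y"] by (simp add: power2_eq_square algebra_simps)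
  finally show ?thesis .
qed

context inner_iterates
begin

section \<open>Covariances of the iterates\<close>

lemma iter_norm_antimono: "cmod z < 1 \<Longrightarrow> cmod ((f ^^ Suc n) z) \<le> cmod ((f ^^ n) z)"
  using schwarz[OF iter_less] by simp

lemma H_le_damping:
  assumes "cmod z < 1"
  shows "cmod (H k ((f ^^ n) z)) \<le> damping \<kappa> (\<lambda>j. 1 - cmod ((f ^^ j) z)) n (n + k)"
proof (induction k)
  case (Suc k)
  have e: "(f ^^ k) ((f ^^ n) z) = (f ^^ (n + k)) z"
    by (simp add: funpow_add add.commute[of n])
  have "cmod (H (Suc k) ((f ^^ n) z)) = cmod (H k ((f ^^ n) z)) * cmod (q ((f ^^ (n + k)) z))"
    by (simp add: H_def norm_mult e[symmetric])
  also have "\<dots> \<le> damping \<kappa> (\<lambda>j. 1 - cmod ((f ^^ j) z)) n (n + k) * (1 - \<kappa> * (1 - cmod ((f ^^ (n + k)) z)))"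
    using Suc q_le[OF iter_less[OF assms], of "n + k"] order_trans[OF norm_ge_zero Suc] by (intro mult_mono) auto
  also have "\<dots> = damping \<kappa> (\<lambda>j. 1 - cmod ((f ^^ j) z)) n (n + Suc k)"
    by (simp add: damping_def prod.atLeastLessThan_Suc)
  finally show ?case .
qed (simp add: H_def damping_def)

definition covar :: "complex \<Rightarrow> nat \<Rightarrow> nat \<Rightarrow> complex" where
  "covar z n m = (\<integral>\<xi>. ((T ^^ n) \<xi> - (f ^^ n) z) * cnj ((T ^^ m) \<xi> - (f ^^ m) z) \<partial>harm z)"

lemma covar_cnj: "covar z m n = cnj (covar z n m)"
  unfolding covar_def Bochner_Integration.integral_cnj[symmetric]
  by (intro Bochner_Integration.integral_cong refl) (simp add: mult.commute)

text \<open>Put w = \<open>(f ^^ n) z\<close> and h = \<open>H (m - n) w\<close>. The two means are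
  w and w h, and the mixed moment is cnj h; so the covariance is cnj h - w cnj (w h).\<close>

lemma covar_eq:
  assumes z: "cmod z < 1" and "n \<le> m"
  shows "covar z n m = cnj (H (m - n) ((f ^^ n) z)) * of_real (1 - (cmod ((f ^^ n) z))\<^sup>2)"
proof -
  interpret hz: prob_space "harm z"
    by (rule prob_space_harm[OF z])
  define w where "w = (f ^^ n) z"
  have m: "(f ^^ m) z = w * H (m - n) w"
    using funpow_add[of "m - n" n f] \<open>n \<le> m\<close> iter_eq[where k="m - n" and z=w] by (simp add: w_def)
  have iT: "integrable (harm z) (T ^^ k)" for k
    using z T_pow_norm by (intro integrable_harm_bounded[where B=1]) auto
  have iP: "integrable (harm z) (\<lambda>\<xi>. cnj ((T ^^ n) \<xi>) * (T ^^ m) \<xi>)"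
    using z T_pow_norm by (intro integrable_harm_bounded[where B=1]) (auto simp: norm_mult)
  have iP': "integrable (harm z) (\<lambda>\<xi>. cnj (cnj ((T ^^ n) \<xi>) * (T ^^ m) \<xi>))"
    by (rule integrable_cnj[OF iP])
  have iC: "integrable (harm z) (\<lambda>\<xi>. cnj ((T ^^ m) \<xi>))"
    by (rule integrable_cnj[OF iT])
  have "covar z n m = (\<integral>\<xi>. cnj (cnj ((T ^^ n) \<xi>) * (T ^^ m) \<xi>) - cnj ((f ^^ m) z) * (T ^^ n) \<xi> - w * cnj ((T ^^ m) \<xi>) + w * cnj ((f ^^ m) z) \<partial>harm z)"
    unfolding covar_def w_def[symmetric]
    by (intro Bochner_Integration.integral_cong refl) (simp add: algebra_simps)
  also have "\<dots> = (\<integral>\<xi>. cnj (cnj ((T ^^ n) \<xi>) * (T ^^ m) \<xi>) \<partial>harm z) - cnj ((f ^^ m) z) * (\<integral>\<xi>. (T ^^ n) \<xi> \<partial>harm z)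
      - w * (\<integral>\<xi>. cnj ((T ^^ m) \<xi>) \<partial>harm z) + w * cnj ((f ^^ m) z)"
  proof -
    note j1 = iP' and j2 = integrable_mult_right[OF iT[of n], of "cnj ((f ^^ m) z)"]
      and j3 = integrable_mult_right[OF iC, of w]
    have one: "(\<integral>\<xi>. cnj ((f ^^ m) z) \<partial>harm z) = cnj ((f ^^ m) z)"
      using hz.prob_space by simp
    show ?thesis
      unfolding Bochner_Integration.integral_add[OF Bochner_Integration.integrable_diff[OF Bochner_Integration.integrable_diff[OF j1 j2] j3] hz.integrable_const]
        Bochner_Integration.integral_diff[OF Bochner_Integration.integrable_diff[OF j1 j2] j3]
        Bochner_Integration.integral_diff[OF j1 j2] integral_mult_right_zero one ..
  qed
  also have "\<dots> = cnj (H (m - n) w) - w * cnj (w * H (m - n) w)"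
    unfolding Bochner_Integration.integral_cnj integral_T_pow_mult[OF z \<open>n \<le> m\<close>] integral_harm_T_pow_id[OF z] m w_def[symmetric]
    by simp
  also have "\<dots> = cnj (H (m - n) w) * (1 - w * cnj w)"
    by (simp add: algebra_simps)
  also have "w * cnj w = of_real ((cmod w)\<^sup>2)"
    by (rule complex_norm_square[symmetric])
  finally show ?thesis
    by (simp add: w_def)
qed

lemma integral_sum_sq:
  assumes z: "cmod z < 1"
  shows "integrable (harm z) (\<lambda>\<xi>. (cmod (\<Sum>n<N. c n * ((T ^^ n) \<xi> - (f ^^ n) z)))\<^sup>2)"
    and "(\<integral>\<xi>. (cmod (\<Sum>n<N. c n * ((T ^^ n) \<xi> - (f ^^ n) z)))\<^sup>2 \<partial>harm z)
       \<le> (\<Sum>n<N. \<Sum>m<N. cmod (c n) * cmod (c m) * cmod (covar z n m))"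
proof -
  define y where "y n \<xi> = (T ^^ n) \<xi> - (f ^^ n) z" for n \<xi>
  have y: "cmod (y n \<xi>) \<le> 2" if "cmod \<xi> = 1" for n \<xi>
    unfolding y_def using norm_triangle_ineq4[of "(T ^^ n) \<xi>" "(f ^^ n) z"] T_pow_norm[OF that, of n] iter_less[OF z, of n] by simp
  have [measurable]: "y n \<in> borel_measurable circle_measure" for n
    unfolding y_def[abs_def] by measurable
  have iy: "integrable (harm z) (\<lambda>\<xi>. y n \<xi> * cnj (y m \<xi>))" for n m
  proof (rule integrable_harm_bounded[where B="2 * 2", OF _ _ z])
    show "cmod (y n \<xi> * cnj (y m \<xi>)) \<le> 2 * 2" if "cmod \<xi> = 1" for \<xi>
      unfolding norm_mult complex_mod_cnj using y[OF that] by (intro mult_mono) auto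
  qed measurable
  then have iy': "integrable (harm z) (\<lambda>\<xi>. (c n * cnj (c m)) * (y n \<xi> * cnj (y m \<xi>)))" for n m
    by (rule integrable_mult_right)
  have eq: "of_real ((cmod (\<Sum>n<N. c n * y n \<xi>))\<^sup>2) = (\<Sum>n<N. \<Sum>m<N. (c n * cnj (c m)) * (y n \<xi> * cnj (y m \<xi>)))" for \<xi>
    unfolding sum_squared_eq_double_sum by (intro sum.cong refl) (simp add: mult_ac)
  have eqR: "(cmod (\<Sum>n<N. c n * y n \<xi>))\<^sup>2 = Re (\<Sum>n<N. \<Sum>m<N. (c n * cnj (c m)) * (y n \<xi> * cnj (y m \<xi>)))" for \<xi>
    unfolding eq[symmetric] by simp
  have isum: "integrable (harm z) (\<lambda>\<xi>. \<Sum>n<N. \<Sum>m<N. (c n * cnj (c m)) * (y n \<xi> * cnj (y m \<xi>)))"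
    by (intro Bochner_Integration.integrable_sum iy')
  show "integrable (harm z) (\<lambda>\<xi>. (cmod (\<Sum>n<N. c n * ((T ^^ n) \<xi> - (f ^^ n) z)))\<^sup>2)"
    unfolding y_def[symmetric] eqR by (rule integrable_Re[OF isum])
  have "(\<integral>\<xi>. (cmod (\<Sum>n<N. c n * y n \<xi>))\<^sup>2 \<partial>harm z) = Re (\<integral>\<xi>. (\<Sum>n<N. \<Sum>m<N. (c n * cnj (c m)) * (y n \<xi> * cnj (y m \<xi>))) \<partial>harm z)"
    unfolding eqR by (rule integral_Re[OF isum])
  also have "\<dots> = Re (\<Sum>n<N. \<Sum>m<N. (c n * cnj (c m)) * covar z n m)"
  proof -
    have "(\<integral>\<xi>. (\<Sum>n<N. \<Sum>m<N. (c n * cnj (c m)) * (y n \<xi> * cnj (y m \<xi>))) \<partial>harm z)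
        = (\<Sum>n<N. \<integral>\<xi>. (\<Sum>m<N. (c n * cnj (c m)) * (y n \<xi> * cnj (y m \<xi>))) \<partial>harm z)"
      by (intro Bochner_Integration.integral_sum Bochner_Integration.integrable_sum iy')
    also have "\<dots> = (\<Sum>n<N. \<Sum>m<N. \<integral>\<xi>. (c n * cnj (c m)) * (y n \<xi> * cnj (y m \<xi>)) \<partial>harm z)"
      by (intro sum.cong refl Bochner_Integration.integral_sum iy')
    finally show ?thesis
      by (simp only: integral_mult_right_zero covar_def y_def)
  qed
  also have "\<dots> \<le> cmod (\<Sum>n<N. \<Sum>m<N. (c n * cnj (c m)) * covar z n m)"
    by (rule complex_Re_le_cmod)
  also have "\<dots> \<le> (\<Sum>n<N. \<Sum>m<N. cmod (c n) * cmod (c m) * cmod (covar z n m))"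
    by (intro sum_norm_le) (simp add: norm_mult)
  finally show "(\<integral>\<xi>. (cmod (\<Sum>n<N. c n * ((T ^^ n) \<xi> - (f ^^ n) z)))\<^sup>2 \<partial>harm z)
       \<le> (\<Sum>n<N. \<Sum>m<N. cmod (c n) * cmod (c m) * cmod (covar z n m))"
    by (simp add: y_def)
qed

text \<open>The first bound makes each single covariance vanish near the circle, as VMOA requires;
  the second keeps the decay between n and m that Schur's test sums.\<close>

lemma covar_le:
  assumes z: "cmod z < 1" and "n \<le> m"
  shows "cmod (covar z n m) \<le> 1 - (cmod ((f ^^ n) z))\<^sup>2"
    and "cmod (covar z n m) \<le> 2 * ((1 - cmod ((f ^^ n) z)) * damping \<kappa> (\<lambda>j. 1 - cmod ((f ^^ j) z)) n m)"
proof -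
  define x where "x = cmod ((f ^^ n) z)"
  have x: "0 \<le> x" "x < 1"
    using iter_less[OF z] by (auto simp: x_def)
  have x2: "0 \<le> 1 - x\<^sup>2" "1 - x\<^sup>2 \<le> 2 * (1 - x)"
    using x zero_le_power2[of "1 - x"] by (auto simp: abs_square_le_1 power2_eq_square algebra_simps intro: mult_le_one)
  have e: "cmod (covar z n m) = cmod (H (m - n) ((f ^^ n) z)) * (1 - x\<^sup>2)"
    unfolding covar_eq[OF assms] x_def[symmetric] norm_mult complex_mod_cnj norm_of_real using x2 by simp
  show "cmod (covar z n m) \<le> 1 - (cmod ((f ^^ n) z))\<^sup>2"
    unfolding e using mult_right_mono[OF H_le_1[OF iter_less[OF z]] x2(1), of "m - n" n] by (simp add: x_def)
  have "cmod (covar z n m) \<le> damping \<kappa> (\<lambda>j. 1 - cmod ((f ^^ j) z)) n m * (2 * (1 - x))"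
    unfolding e using H_le_damping[OF z, of "m - n" n] \<open>n \<le> m\<close> x2 order_trans[OF norm_ge_zero H_le_damping[OF z, of "m - n" n]]
    by (intro mult_mono) auto
  then show "cmod (covar z n m) \<le> 2 * ((1 - cmod ((f ^^ n) z)) * damping \<kappa> (\<lambda>j. 1 - cmod ((f ^^ j) z)) n m)"
    by (simp add: x_def algebra_simps)
qed

text \<open>Splitting a row of the majorant \<open>M\<close> at the diagonal gives a column sum and
  a row sum of damped products, each at most 1 / \<kappa>; with the factor 2 of
  \<open>covar_le\<close> this makes 4 / \<kappa>.\<close>

lemma variance_le:
  assumes z: "cmod z < 1"
  shows "(\<integral>\<xi>. (cmod (\<Sum>n<N. c n * ((T ^^ n) \<xi> - (f ^^ n) z)))\<^sup>2 \<partial>harm z) \<le> 4 / \<kappa> * (\<Sum>n<N. (cmod (c n))\<^sup>2)"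
proof -
  define t where "t j = 1 - cmod ((f ^^ j) z)" for j
  have t: "0 \<le> t j" "t j \<le> 1" "t j \<le> t (Suc j)" for j
    using iter_less[OF z, of j] iter_norm_antimono[OF z, of j] unfolding t_def by auto
  have k: "0 < \<kappa>" "\<kappa> \<le> 1"
    using \<kappa> by auto
  have p: "0 \<le> damping \<kappa> t n m" for n m
    using damping_bounds[of \<kappa> t n m] k t by simp
  define M where "M n m = (if n \<le> m then 2 * (t n * damping \<kappa> t n m) else 2 * (t m * damping \<kappa> t m n))" for n m
  have "cmod (covar z n m) \<le> M n m" for n m
    using covar_le(2)[OF z, of n m] covar_le(2)[OF z, of m n] covar_cnj[of z n m]
    by (cases "n \<le> m") (simp_all add: M_def t_def[abs_def])
  then have "(\<Sum>n<N. \<Sum>m<N. cmod (c n) * cmod (c m) * cmod (covar z n m)) \<le> (\<Sum>n<N. \<Sum>m<N. cmod (c n) * cmod (c m) * M n m)"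
    by (intro sum_mono mult_left_mono) auto
  also have "\<dots> \<le> 4 / \<kappa> * (\<Sum>n<N. (cmod (c n))\<^sup>2)"
  proof (rule symmetric_schur_test)
    show "M n m = M m n" for n m
      by (auto simp: M_def)
    show "0 \<le> M n m" for n m
      using t p by (auto simp: M_def)
    fix n assume "n < N"
    have "(\<Sum>m<N. M n m) = (\<Sum>m<n. M n m) + (\<Sum>m\<in>{n..<N}. M n m)"
      using \<open>n < N\<close> by (simp add: lessThan_atLeast0 sum.atLeastLessThan_concat)
    also have "(\<Sum>m<n. M n m) = 2 * (\<Sum>m<n. t m * damping \<kappa> t m n)"
      unfolding sum_distrib_left by (intro sum.cong) (auto simp: M_def)
    also have "\<dots> \<le> 2 * (1 / \<kappa>)"
      by (intro mult_left_mono damping_column_sum k t) auto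
    also have "(\<Sum>m\<in>{n..<N}. M n m) = 2 * (\<Sum>m\<in>{n..<N}. t n * damping \<kappa> t n m)"
      unfolding sum_distrib_left by (intro sum.cong) (auto simp: M_def)
    also have "\<dots> \<le> 2 * (1 / \<kappa>)"
      using \<open>n < N\<close> by (intro mult_left_mono damping_row_sum k t) auto
    finally show "(\<Sum>m<N. M n m) \<le> 4 / \<kappa>"
      by simp
  qed
  finally show ?thesis
    using integral_sum_sq(2)[OF z, where N=N and c=c] by linarith
qed

end

section \<open>Series of iterates\<close>

lemma nn_integral_le_of_AE_limit:
  fixes u :: "nat \<Rightarrow> 'a \<Rightarrow> ennreal"
  assumes "\<And>n. u n \<in> borel_measurable M" and lim: "AE x in M. (\<lambda>n. u n x) \<longlonglongrightarrow> v x"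
    and le: "\<And>n. (\<integral>\<^sup>+x. u n x \<partial>M) \<le> C"
  shows "(\<integral>\<^sup>+x. v x \<partial>M) \<le> C"
proof -
  have "(\<integral>\<^sup>+x. v x \<partial>M) = (\<integral>\<^sup>+x. liminf (\<lambda>n. u n x) \<partial>M)"
    using lim by (intro nn_integral_cong_AE) (auto elim!: eventually_mono dest: lim_imp_Liminf[rotated])
  also have "\<dots> \<le> liminf (\<lambda>n. \<integral>\<^sup>+x. u n x \<partial>M)"
    by (rule nn_integral_liminf[OF assms(1)])
  also have "\<dots> \<le> liminf (\<lambda>n. C)"
    using le by (intro Liminf_mono always_eventually) auto
  also have "\<dots> = C"
    by (simp add: Liminf_const)
  finally show ?thesis .
qed

text \<open>For points \<xi>, \<eta> of the circle the kernel at r \<xi> and \<eta> is symmetric in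
  the two, so after Fubini it integrates to 1 in \<xi>. Combined with Jensen's inequality this
  bounds Hardy norms by boundary norms.\<close>

lemma nn_integral_harm_mean:
  fixes u :: "complex \<Rightarrow> ennreal"
  assumes u [measurable]: "u \<in> borel_measurable circle_measure" and r: "0 \<le> r" "r < 1"
  shows "(\<integral>\<^sup>+\<xi>. (\<integral>\<^sup>+\<eta>. u \<eta> \<partial>harm (of_real r * \<xi>)) \<partial>circle_measure) = (\<integral>\<^sup>+\<eta>. u \<eta> \<partial>circle_measure)"
proof -
  interpret pp: pair_sigma_finite circle_measure circle_measure
    by (intro pair_sigma_finite.intro prob_space_imp_sigma_finite prob_space_circle_measure)
  have id: "(\<lambda>\<xi>::complex. \<xi>) \<in> borel_measurable circle_measure"
    by (rule measurable_circle_borel) simp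
  have [measurable]: "(\<lambda>p. fst p) \<in> borel_measurable (circle_measure \<Otimes>\<^sub>M circle_measure)"
      "(\<lambda>p. snd p) \<in> borel_measurable (circle_measure \<Otimes>\<^sub>M circle_measure)"
    by (rule measurable_compose[OF measurable_fst id], rule measurable_compose[OF measurable_snd id])
  have us [measurable]: "(\<lambda>p. u (snd p)) \<in> borel_measurable (circle_measure \<Otimes>\<^sub>M circle_measure)"
    by (rule measurable_compose[OF measurable_snd u])
  have m: "(\<lambda>p. ennreal (poisson_kernel (of_real r * fst p) (snd p)) * u (snd p)) \<in> borel_measurable (circle_measure \<Otimes>\<^sub>M circle_measure)"
    unfolding poisson_kernel_def by measurable
  have symm: "poisson_kernel (of_real r * \<xi>) \<eta> = poisson_kernel (of_real r * \<eta>) \<xi>" if "cmod \<xi> = 1" "cmod \<eta> = 1" for \<xi> \<eta>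
  proof -
    have "(cmod (a - of_real r * b))\<^sup>2 = 1 + r\<^sup>2 - 2 * r * Re (a * cnj b)" if "cmod a = 1" "cmod b = 1" for a b :: complex
      using cmod_add_squared[of a "- (of_real r * b)"] that by (simp add: norm_mult algebra_simps)
    moreover have "Re (\<xi> * cnj \<eta>) = Re (\<eta> * cnj \<xi>)"
      by (simp add: mult.commute)
    ultimately show ?thesis
      using that by (simp add: poisson_kernel_def norm_mult)
  qed
  have "(\<integral>\<^sup>+\<xi>. (\<integral>\<^sup>+\<eta>. u \<eta> \<partial>harm (of_real r * \<xi>)) \<partial>circle_measure) =
      (\<integral>\<^sup>+\<xi>. (\<integral>\<^sup>+\<eta>. ennreal (poisson_kernel (of_real r * \<xi>) \<eta>) * u \<eta> \<partial>circle_measure) \<partial>circle_measure)"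
    by (simp only: nn_integral_harm[OF u])
  also have "\<dots> = (\<integral>\<^sup>+\<eta>. (\<integral>\<^sup>+\<xi>. ennreal (poisson_kernel (of_real r * \<xi>) \<eta>) * u \<eta> \<partial>circle_measure) \<partial>circle_measure)"
    using m by (intro pp.Fubini'[symmetric]) (simp add: case_prod_unfold)
  also have "\<dots> = (\<integral>\<^sup>+\<eta>. u \<eta> \<partial>circle_measure)"
  proof (rule nn_integral_cong)
    fix \<eta> assume "\<eta> \<in> space circle_measure"
    then have \<eta>: "cmod \<eta> = 1" by simp
    have rz: "cmod (of_real r * \<eta>) < 1"
      using r \<eta> by (simp add: norm_mult)
    interpret hz: prob_space "harm (of_real r * \<eta>)"
      by (rule prob_space_harm[OF rz])
    have "(\<integral>\<^sup>+\<xi>. ennreal (poisson_kernel (of_real r * \<xi>) \<eta>) * u \<eta> \<partial>circle_measure) =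
        (\<integral>\<^sup>+\<xi>. ennreal (poisson_kernel (of_real r * \<eta>) \<xi>) * u \<eta> \<partial>circle_measure)"
      using \<eta> by (intro nn_integral_cong) (simp add: symm)
    also have "\<dots> = (\<integral>\<^sup>+\<xi>. u \<eta> \<partial>harm (of_real r * \<eta>))"
      by (rule nn_integral_harm[symmetric]) simp
    also have "\<dots> = u \<eta>"
      using hz.emeasure_space_1 by simp
    finally show "(\<integral>\<^sup>+\<xi>. ennreal (poisson_kernel (of_real r * \<xi>) \<eta>) * u \<eta> \<partial>circle_measure) = u \<eta>" .
  qed
  finally show ?thesis .
qed

abbreviation (input) square_summable :: "(nat \<Rightarrow> complex) \<Rightarrow> bool" where
  "square_summable c \<equiv> summable (\<lambda>n. (cmod (c n))\<^sup>2)"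

section \<open>Square summable coefficients and their tails\<close>

definition l2_norm_sq :: "(nat \<Rightarrow> complex) \<Rightarrow> real" where "l2_norm_sq c = (\<Sum>n. (cmod (c n))\<^sup>2)"

text \<open>The first N coefficients are zeroed, not dropped, so every iterate keeps its index and a
  remainder of the series is a series of the same kind: each bound for full series applies to
  remainders.\<close>

definition tl_seq :: "nat \<Rightarrow> (nat \<Rightarrow> complex) \<Rightarrow> nat \<Rightarrow> complex" where
  "tl_seq N c n = (if n < N then 0 else c n)"

lemma tl_seq_sums:
  fixes w :: "nat \<Rightarrow> complex"
  assumes "(\<lambda>n. c n * w n) sums s"
  shows "(\<lambda>n. tl_seq N c n * w n) sums (s - (\<Sum>n<N. c n * w n))"
proof -
  have "(\<lambda>n. c n * w n - (if n \<in> {..<N} then c n * w n else 0)) sums (s - (\<Sum>n\<in>{..<N}. c n * w n))"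
    by (intro sums_diff assms sums_If_finite_set) auto
  also have "(\<lambda>n. c n * w n - (if n \<in> {..<N} then c n * w n else 0)) = (\<lambda>n. tl_seq N c n * w n)"
    by (auto simp: tl_seq_def fun_eq_iff)
  finally show ?thesis .
qed

lemma
  assumes "square_summable c"
  shows summable_tl_seq: "summable (\<lambda>n. (cmod (tl_seq N c n))\<^sup>2)"
    and l2_norm_sq_tl_seq: "l2_norm_sq (tl_seq N c) = l2_norm_sq c - (\<Sum>n<N. (cmod (c n))\<^sup>2)"
proof -
  have "(\<lambda>n. (cmod (c n))\<^sup>2 - (if n \<in> {..<N} then (cmod (c n))\<^sup>2 else 0)) sums (l2_norm_sq c - (\<Sum>n\<in>{..<N}. (cmod (c n))\<^sup>2))"
    unfolding l2_norm_sq_def by (intro sums_diff summable_sums assms sums_If_finite_set) auto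
  also have "(\<lambda>n. (cmod (c n))\<^sup>2 - (if n \<in> {..<N} then (cmod (c n))\<^sup>2 else 0)) = (\<lambda>n. (cmod (tl_seq N c n))\<^sup>2)"
    by (auto simp: tl_seq_def fun_eq_iff)
  finally have *: "(\<lambda>n. (cmod (tl_seq N c n))\<^sup>2) sums (l2_norm_sq c - (\<Sum>n<N. (cmod (c n))\<^sup>2))" .
  show "summable (\<lambda>n. (cmod (tl_seq N c n))\<^sup>2)"
    using * by (rule sums_summable)
  show "l2_norm_sq (tl_seq N c) = l2_norm_sq c - (\<Sum>n<N. (cmod (c n))\<^sup>2)"
    unfolding l2_norm_sq_def[of "tl_seq N c"] using * by (rule sums_unique[symmetric])
qed

lemma l2_norm_sq_tl_seq_tendsto_0:
  assumes "square_summable c"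
  shows "(\<lambda>N. l2_norm_sq (tl_seq N c)) \<longlonglongrightarrow> 0"
  unfolding l2_norm_sq_tl_seq[OF assms]
  using tendsto_diff[OF tendsto_const[of "l2_norm_sq c"] summable_LIMSEQ[OF assms]] by (simp add: l2_norm_sq_def)

lemma l2_norm_sq_nonneg: "square_summable c \<Longrightarrow> 0 \<le> l2_norm_sq c"
  unfolding l2_norm_sq_def by (rule suminf_nonneg) auto

lemma sum_le_l2_norm_sq: "square_summable c \<Longrightarrow> (\<Sum>n<N. (cmod (c n))\<^sup>2) \<le> l2_norm_sq c"
  unfolding l2_norm_sq_def by (rule sum_le_suminf) auto

context inner_iterates
begin

text \<open>Indexed from n = 0, where \<open>f ^^ 0\<close> is the identity, to match the
  differences \<open>X \<circ> T ^^ j\<close>; a series that starts at n = 1 is one with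
  \<open>c 0 = 0\<close>.\<close>

definition iterate_sum :: "(nat \<Rightarrow> complex) \<Rightarrow> complex \<Rightarrow> complex" where
  "iterate_sum c z = (\<Sum>n. c n * (f ^^ n) z)"

definition boundary_sum :: "(nat \<Rightarrow> complex) \<Rightarrow> complex \<Rightarrow> complex" where
  "boundary_sum c \<xi> = (\<Sum>n. c n * (T ^^ n) \<xi>)"

lemma iter_norm_le: "cmod z < 1 \<Longrightarrow> cmod ((f ^^ n) z) \<le> cmod z"
  by (induction n) (auto intro: order_trans[OF iter_norm_antimono, simplified])

text \<open>The orbit stays in the disc of radius R, so \<open>q_le\<close> gains a fixed factor at
  each step; with bounded coefficients this gives a Weierstrass majorant.\<close>

lemma iter_geometric:
  assumes "cmod z \<le> R" "R < 1"
  shows "cmod ((f ^^ n) z) \<le> (1 - \<kappa> * (1 - R)) ^ n"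
proof (induction n)
  case 0
  then show ?case using assms by simp
next
  case (Suc n)
  have z: "cmod z < 1" using assms by simp
  have R: "0 \<le> R"
    using assms(1) norm_ge_zero order_trans by blast
  have "\<kappa> * (1 - R) \<le> 1 * 1"
    using \<kappa> assms R by (intro mult_mono) auto
  moreover have "cmod (q ((f ^^ n) z)) \<le> 1 - \<kappa> * (1 - R)"
  proof -
    have "\<kappa> * (1 - R) \<le> \<kappa> * (1 - cmod ((f ^^ n) z))"
      using iter_norm_le[OF z, of n] assms \<kappa> by (intro mult_left_mono) auto
    then show ?thesis
      using q_le[OF iter_less[OF z], of n] by linarith
  qed
  ultimately have "cmod ((f ^^ n) z) * cmod (q ((f ^^ n) z)) \<le> (1 - \<kappa> * (1 - R)) ^ n * (1 - \<kappa> * (1 - R))"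
    using Suc by (intro mult_mono) auto
  moreover have "(f ^^ Suc n) z = (f ^^ n) z * q ((f ^^ n) z)"
    using f_eq[of "(f ^^ n) z"] by simp
  ultimately show ?case
    by (simp only: norm_mult power_Suc2)
qed

lemma
  assumes c: "square_summable c" and R: "0 \<le> R" "R < 1"
  shows iterate_sum_uniform_limit: "uniform_limit (cball 0 R) (\<lambda>N z. \<Sum>n<N. c n * (f ^^ n) z) (iterate_sum c) sequentially"
    and iterate_sum_summable_on: "cmod z \<le> R \<Longrightarrow> summable (\<lambda>n. c n * (f ^^ n) z)"
proof -
  define r where "r = 1 - \<kappa> * (1 - R)"
  have r: "0 \<le> r" "r < 1"
  proof -
    have "\<kappa> * (1 - R) \<le> 1 * 1"
      using \<kappa> R by (intro mult_mono) auto
    then show "0 \<le> r" by (simp add: r_def)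
    show "r < 1" using \<kappa> R by (simp add: r_def)
  qed
  have bc: "cmod (c n) \<le> sqrt (l2_norm_sq c)" for n
  proof (rule real_le_rsqrt)
    have "(cmod (c n))\<^sup>2 \<le> (\<Sum>n<Suc n. (cmod (c n))\<^sup>2)"
      by (simp add: sum_nonneg)
    also have "\<dots> \<le> l2_norm_sq c"
      by (rule sum_le_l2_norm_sq[OF c])
    finally show "(cmod (c n))\<^sup>2 \<le> l2_norm_sq c" .
  qed
  have bd: "cmod (c n * (f ^^ n) z) \<le> sqrt (l2_norm_sq c) * r ^ n" if "z \<in> cball 0 R" for n z
    unfolding norm_mult r_def using that R bc l2_norm_sq_nonneg[OF c] by (intro mult_mono iter_geometric) auto
  have sM: "summable (\<lambda>n. sqrt (l2_norm_sq c) * r ^ n)"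
    using r by (intro summable_mult summable_geometric) auto
  show "uniform_limit (cball 0 R) (\<lambda>N z. \<Sum>n<N. c n * (f ^^ n) z) (iterate_sum c) sequentially"
    unfolding iterate_sum_def[abs_def] by (rule Weierstrass_m_test[OF bd sM])
  show "summable (\<lambda>n. c n * (f ^^ n) z)" if "cmod z \<le> R"
    by (rule summable_comparison_test'[OF sM, of 0]) (use bd that in auto)
qed

lemma iterate_sum_sums:
  assumes "square_summable c" "cmod z < 1"
  shows "(\<lambda>n. c n * (f ^^ n) z) sums iterate_sum c z"
  unfolding iterate_sum_def using iterate_sum_summable_on[OF assms(1), of "cmod z" z] assms(2) by (intro summable_sums) auto

lemma iterate_sum_holomorphic:
  assumes c: "square_summable c"
  shows "iterate_sum c holomorphic_on ball 0 1"
proof (rule holomorphic_uniform_sequence)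
  show "(\<lambda>z. \<Sum>n<N. c n * (f ^^ n) z) holomorphic_on ball 0 1" for N
    by (intro holomorphic_intros iter_holomorphic)
  fix x :: complex assume "x \<in> ball 0 1"
  then have x: "cmod x < 1" by simp
  define d where "d = (1 - cmod x) / 2"
  have sub: "cball x d \<subseteq> cball 0 (cmod x + d)"
  proof
    fix y assume "y \<in> cball x d"
    then show "y \<in> cball 0 (cmod x + d)"
      using norm_triangle_sub[of y x] by (simp add: dist_norm norm_minus_commute)
  qed
  have "uniform_limit (cball x d) (\<lambda>N z. \<Sum>n<N. c n * (f ^^ n) z) (iterate_sum c) sequentially"
    by (rule uniform_limit_on_subset[OF iterate_sum_uniform_limit[OF c] sub]) (use x in \<open>auto simp: d_def field_simps\<close>)
  moreover have "cball 0 (cmod x + d) \<subseteq> ball (0::complex) 1"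
    using x by (auto simp: d_def field_simps)
  ultimately show "\<exists>d>0. cball x d \<subseteq> ball 0 1 \<and> uniform_limit (cball x d) (\<lambda>N z. \<Sum>n<N. c n * (f ^^ n) z) (iterate_sum c) sequentially"
    using x sub by (intro exI[of _ d]) (auto simp: d_def)
qed simp

lemma iterate_sum_tl_seq:
  assumes "square_summable c" "cmod z < 1"
  shows "iterate_sum (tl_seq N c) z = iterate_sum c z - (\<Sum>n<N. c n * (f ^^ n) z)"
  unfolding iterate_sum_def[of "tl_seq N c"] using tl_seq_sums[OF iterate_sum_sums[OF assms]] by (rule sums_unique[symmetric])

lemma iterate_sum_0: "iterate_sum c 0 = 0"
proof -
  have "(f ^^ n) 0 = 0" for n
    by (induction n) (auto simp: zero)
  then show ?thesis
    by (simp add: iterate_sum_def)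
qed

text \<open>Summation by parts: \<^term>\<open>(\<Sum>n<N. c n * (T ^^ n) \<xi>)\<close> becomes a reverse martingale up to a null sequence.\<close>

primrec bseq :: "(nat \<Rightarrow> complex) \<Rightarrow> nat \<Rightarrow> complex" where
  "bseq c 0 = c 0"
| "bseq c (Suc n) = c (Suc n) + cnj \<alpha> * bseq c n"

text \<open>Each step writes the n-th iterate of \<open>T\<close> as X \<circ> T^n + cnj \<alpha>
  T^(n+1) and passes the second part on to the next coefficient.\<close>

lemma sum_eq_rm_S:
  "(\<Sum>n<Suc N. c n * (T ^^ n) \<xi>) = rm.S (bseq c) (Suc N) \<xi> + cnj \<alpha> * bseq c N * (T ^^ Suc N) \<xi>"
proof (induction N)
  case 0
  show ?case
    unfolding rm.S_def by (simp add: X_def algebra_simps)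
next
  case (Suc N)
  have "(\<Sum>n<Suc (Suc N). c n * (T ^^ n) \<xi>) = (\<Sum>n<Suc N. c n * (T ^^ n) \<xi>) + c (Suc N) * (T ^^ Suc N) \<xi>"
    by simp
  also have "\<dots> = rm.S (bseq c) (Suc N) \<xi> + cnj \<alpha> * bseq c N * (T ^^ Suc N) \<xi> + c (Suc N) * (T ^^ Suc N) \<xi>"
    by (simp only: Suc)
  also have "\<dots> = rm.S (bseq c) (Suc (Suc N)) \<xi> + cnj \<alpha> * bseq c (Suc N) * (T ^^ Suc (Suc N)) \<xi>"
    unfolding rm.S_def by (simp add: X_def algebra_simps)
  finally show ?case .
qed

text \<open>With a = |\<alpha>|, the number x + a y is the average of x / (1 - a) and y with weights
  1 - a and a, so convexity gives (x + a y)^2 \<le> x^2 / (1 - a) + a y^2. The last summand on the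
  left carries the a y^2 through the induction.\<close>

lemma bseq_sum_le:
  "(1 - cmod \<alpha>) * (\<Sum>n<Suc N. (cmod (bseq c n))\<^sup>2) + cmod \<alpha> * (cmod (bseq c N))\<^sup>2
     \<le> (\<Sum>n<Suc N. (cmod (c n))\<^sup>2) / (1 - cmod \<alpha>)"
proof (induction N)
  case 0
  have "(1 - cmod \<alpha>) * (cmod (c 0))\<^sup>2 \<le> 1 * (cmod (c 0))\<^sup>2"
    by (intro mult_right_mono) auto
  then show ?case
    using \<alpha>_less mult_right_mono[of "1 - cmod \<alpha>" 1 "(cmod (c 0))\<^sup>2"] by (simp add: field_simps)
next
  case (Suc N)
  define a where "a = cmod \<alpha>"
  define x where "x = cmod (c (Suc N))"
  define y where "y = cmod (bseq c N)"
  have a: "0 \<le> a" "a < 1"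
    using \<alpha>_less by (auto simp: a_def)
  have "cmod (bseq c (Suc N)) \<le> x + a * y"
    using norm_triangle_ineq[of "c (Suc N)" "cnj \<alpha> * bseq c N"] by (simp add: norm_mult a_def x_def y_def)
  then have "(cmod (bseq c (Suc N)))\<^sup>2 \<le> (x + a * y)\<^sup>2"
    by (intro power_mono) auto
  also have "\<dots> \<le> x\<^sup>2 / (1 - a) + a * y\<^sup>2"
  proof -
    have "0 \<le> a * (x - (1 - a) * y)\<^sup>2"
      using a by simp
    also have "\<dots> = (1 - a) * (x\<^sup>2 / (1 - a) + a * y\<^sup>2 - (x + a * y)\<^sup>2)"
      using a by (simp add: field_simps power2_eq_square)
    finally show ?thesis
      using a by (simp add: zero_le_mult_iff)
  qed
  finally show ?case
    using Suc a unfolding a_def[symmetric] y_def[symmetric] x_def[symmetric]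
    by (simp add: x_def[symmetric] y_def[symmetric] add_divide_distrib algebra_simps)
qed

lemma summable_bseq:
  assumes c: "square_summable c"
  shows "summable (\<lambda>n. (cmod (bseq c n))\<^sup>2)"
proof (rule summableI_nonneg_bounded)
  fix N
  have a: "0 < 1 - cmod \<alpha>"
    using \<alpha>_less by simp
  have "(1 - cmod \<alpha>) * (\<Sum>n<N. (cmod (bseq c n))\<^sup>2) \<le> (1 - cmod \<alpha>) * (\<Sum>n<Suc N. (cmod (bseq c n))\<^sup>2)"
    using a by (intro mult_left_mono) auto
  also have "\<dots> \<le> (\<Sum>n<Suc N. (cmod (c n))\<^sup>2) / (1 - cmod \<alpha>)"
    using bseq_sum_le[where N=N and c=c] by (smt (verit) mult_nonneg_nonneg norm_ge_zero zero_le_power2)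
  also have "\<dots> \<le> l2_norm_sq c / (1 - cmod \<alpha>)"
    using a by (intro divide_right_mono sum_le_l2_norm_sq c) auto
  finally have "(1 - cmod \<alpha>) * (\<Sum>n<N. (cmod (bseq c n))\<^sup>2) \<le> l2_norm_sq c / (1 - cmod \<alpha>)" .
  then show "(\<Sum>n<N. (cmod (bseq c n))\<^sup>2) \<le> l2_norm_sq c / (1 - cmod \<alpha>) / (1 - cmod \<alpha>)"
    by (subst pos_le_divide_eq[OF a], subst mult.commute)
qed simp

text \<open>The martingale part converges by \<open>AE_summable\<close>, and the leftover term of
  \<open>sum_eq_rm_S\<close> has modulus |\<alpha>| |bseq c N|, which tends to 0.\<close>

lemma boundary_sum_sums:
  assumes c: "square_summable c"
  shows "AE \<xi> in circle_measure. (\<lambda>n. c n * (T ^^ n) \<xi>) sums boundary_sum c \<xi>"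
  using rm.AE_summable[OF summable_bseq[OF c]] AE_space[of circle_measure]
proof eventually_elim
  case (elim \<xi>)
  have b0: "bseq c \<longlonglongrightarrow> 0"
  proof (rule tendsto_norm_zero_cancel)
    have "(\<lambda>n. sqrt ((cmod (bseq c n))\<^sup>2)) \<longlonglongrightarrow> sqrt 0"
      by (intro tendsto_intros summable_LIMSEQ_zero summable_bseq c)
    then show "(\<lambda>n. cmod (bseq c n)) \<longlonglongrightarrow> 0"
      by simp
  qed
  have "(\<lambda>N. cnj \<alpha> * bseq c N * (T ^^ Suc N) \<xi>) \<longlonglongrightarrow> 0"
  proof (rule tendsto_norm_zero_cancel)
    have "cmod (cnj \<alpha> * bseq c N * (T ^^ Suc N) \<xi>) = cmod \<alpha> * cmod (bseq c N)" for N
      using T_pow_norm[of \<xi> "Suc N"] elim(2) unfolding norm_mult complex_mod_cnj by simp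
    then show "(\<lambda>N. cmod (cnj \<alpha> * bseq c N * (T ^^ Suc N) \<xi>)) \<longlonglongrightarrow> 0"
      using tendsto_mult[OF tendsto_const tendsto_norm[OF b0], of "cmod \<alpha>"] by simp
  qed
  moreover have "(\<lambda>N. rm.S (bseq c) (Suc N) \<xi>) \<longlonglongrightarrow> (\<Sum>j. bseq c j * X ((T ^^ j) \<xi>))"
    unfolding rm.S_def using LIMSEQ_Suc[OF summable_LIMSEQ[OF elim(1)]] .
  ultimately have "(\<lambda>N. \<Sum>n<Suc N. c n * (T ^^ n) \<xi>) \<longlonglongrightarrow> (\<Sum>j. bseq c j * X ((T ^^ j) \<xi>)) + 0"
    unfolding sum_eq_rm_S by (rule tendsto_add[rotated])
  then have "(\<lambda>n. c n * (T ^^ n) \<xi>) sums (\<Sum>j. bseq c j * X ((T ^^ j) \<xi>))"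
    unfolding sums_def add_0_right by (rule LIMSEQ_imp_Suc)
  then show ?case
    unfolding boundary_sum_def by (simp add: sums_iff)
qed

lemma measurable_boundary_sum [measurable]: "boundary_sum c \<in> borel_measurable circle_measure"
  unfolding boundary_sum_def[abs_def] by measurable

lemma boundary_sum_tl_seq:
  assumes "square_summable c"
  shows "AE \<xi> in circle_measure. boundary_sum (tl_seq N c) \<xi> = boundary_sum c \<xi> - (\<Sum>n<N. c n * (T ^^ n) \<xi>)"
  using boundary_sum_sums[OF assms]
  by eventually_elim (unfold boundary_sum_def[of "tl_seq N c"], rule sums_unique[symmetric], rule tl_seq_sums)

text \<open>The Garsia integral with \<open>boundary_sum\<close> in place of
  \<open>boundary_value\<close>: it can be estimated before the non-tangential limit is identified,
  and that identification relies on the estimate.\<close>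

definition energy :: "(nat \<Rightarrow> complex) \<Rightarrow> complex \<Rightarrow> ennreal" where
  "energy c z = (\<integral>\<^sup>+\<xi>. ennreal ((cmod (boundary_sum c \<xi> - iterate_sum c z))\<^sup>2) \<partial>harm z)"

text \<open>Fatou's lemma carries \<open>variance_le\<close> from partial sums to the
  series.\<close>

lemma energy_le:
  assumes c: "square_summable c" and z: "cmod z < 1"
  shows "energy c z \<le> ennreal (4 / \<kappa> * l2_norm_sq c)"
  unfolding energy_def
proof (rule nn_integral_le_of_AE_limit)
  let ?u = "\<lambda>N \<xi>. (cmod (\<Sum>n<N. c n * ((T ^^ n) \<xi> - (f ^^ n) z)))\<^sup>2"
  show "(\<lambda>\<xi>. ennreal (?u N \<xi>)) \<in> borel_measurable (harm z)" for N
    by measurable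
  show "AE \<xi> in harm z. (\<lambda>N. ennreal (?u N \<xi>)) \<longlonglongrightarrow> ennreal ((cmod (boundary_sum c \<xi> - iterate_sum c z))\<^sup>2)"
    using AE_harm[OF boundary_sum_sums[OF c]]
  proof eventually_elim
    case (elim \<xi>)
    have "(\<lambda>n. c n * (T ^^ n) \<xi> - c n * (f ^^ n) z) sums (boundary_sum c \<xi> - iterate_sum c z)"
      by (intro sums_diff elim iterate_sum_sums[OF c z])
    then have "(\<lambda>N. \<Sum>n<N. c n * ((T ^^ n) \<xi> - (f ^^ n) z)) \<longlonglongrightarrow> boundary_sum c \<xi> - iterate_sum c z"
      by (simp add: sums_def right_diff_distrib)
    then show ?case
      by (intro tendsto_intros)
  qed
  show "(\<integral>\<^sup>+\<xi>. ennreal (?u N \<xi>) \<partial>harm z) \<le> ennreal (4 / \<kappa> * l2_norm_sq c)" for N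
  proof -
    have "(\<integral>\<^sup>+\<xi>. ennreal (?u N \<xi>) \<partial>harm z) = ennreal (\<integral>\<xi>. ?u N \<xi> \<partial>harm z)"
      by (intro nn_integral_eq_integral integral_sum_sq z) auto
    also have "\<dots> \<le> ennreal (4 / \<kappa> * (\<Sum>n<N. (cmod (c n))\<^sup>2))"
      by (intro ennreal_leI variance_le z)
    also have "\<dots> \<le> ennreal (4 / \<kappa> * l2_norm_sq c)"
      using \<kappa> by (intro ennreal_leI mult_left_mono sum_le_l2_norm_sq c) auto
    finally show ?thesis .
  qed
qed

lemma nn_integral_boundary_sum_sq_le:
  assumes c: "square_summable c"
  shows "(\<integral>\<^sup>+\<xi>. ennreal ((cmod (boundary_sum c \<xi>))\<^sup>2) \<partial>circle_measure) \<le> ennreal (4 / \<kappa> * l2_norm_sq c)"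
  using energy_le[OF c, of 0] by (simp add: energy_def iterate_sum_0 harm_0)

lemma boundary_sum_integrable:
  assumes c: "square_summable c"
  shows "integrable circle_measure (boundary_sum c)" "integrable circle_measure (\<lambda>\<xi>. (cmod (boundary_sum c \<xi>))\<^sup>2)"
  using circle.integrable_if_square_integrable[OF measurable_boundary_sum le_less_trans[OF nn_integral_boundary_sum_sq_le[OF c]]] by auto

text \<open>Finite sums satisfy the identity, so the defect \<open>D\<close> is the same for every
  remainder of the series; by Jensen |D|^2 is at most the energy of the remainder, whose bound tends
  to 0.\<close>

lemma iterate_sum_eq_integral:
  assumes c: "square_summable c" and z: "cmod z < 1"
  shows "(\<integral>\<xi>. boundary_sum c \<xi> \<partial>harm z) = iterate_sum c z"
proof -
  interpret hz: prob_space "harm z"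
    by (rule prob_space_harm[OF z])
  define D where "D = (\<integral>\<xi>. boundary_sum c \<xi> \<partial>harm z) - iterate_sum c z"
  have iF: "integrable (harm z) (boundary_sum c)"
    by (rule integrable_harm[OF boundary_sum_integrable(1)[OF c] z])
  have iT: "integrable (harm z) (T ^^ n)" for n
    by (rule integrable_harm[OF T_pow_integrable z])
  have "ennreal ((cmod D)\<^sup>2) \<le> ennreal (4 / \<kappa> * l2_norm_sq (tl_seq N c))" for N
  proof -
    note c' = summable_tl_seq[OF c, of N]
    have iF': "integrable (harm z) (boundary_sum (tl_seq N c))"
      by (rule integrable_harm[OF boundary_sum_integrable(1)[OF c'] z])
    have "(\<integral>\<xi>. boundary_sum (tl_seq N c) \<xi> \<partial>harm z) = (\<integral>\<xi>. boundary_sum c \<xi> - (\<Sum>n<N. c n * (T ^^ n) \<xi>) \<partial>harm z)"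
      using AE_harm[OF boundary_sum_tl_seq[OF c, of N]] by (intro integral_cong_AE) measurable
    also have "\<dots> = (\<integral>\<xi>. boundary_sum c \<xi> \<partial>harm z) - (\<Sum>n<N. c n * (f ^^ n) z)"
      using iF iT by (simp add: integral_harm_T_pow_id[OF z])
    finally have "D = (\<integral>\<xi>. boundary_sum (tl_seq N c) \<xi> - iterate_sum (tl_seq N c) z \<partial>harm z)"
      using iF' hz.prob_space by (simp add: D_def iterate_sum_tl_seq[OF c z])
    then have "ennreal ((cmod D)\<^sup>2) \<le> energy (tl_seq N c) z"
      unfolding energy_def by (simp only:) (rule hz.nn_integral_jensen_square, measurable)
    also have "\<dots> \<le> ennreal (4 / \<kappa> * l2_norm_sq (tl_seq N c))"
      by (rule energy_le[OF c' z])
    finally show ?thesis .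
  qed
  moreover have "(\<lambda>N. ennreal (4 / \<kappa> * l2_norm_sq (tl_seq N c))) \<longlonglongrightarrow> ennreal (4 / \<kappa> * 0)"
    by (intro tendsto_intros l2_norm_sq_tl_seq_tendsto_0 c)
  ultimately have "ennreal ((cmod D)\<^sup>2) \<le> ennreal (4 / \<kappa> * 0)"
    by (intro LIMSEQ_le_const) auto
  then have "D = 0"
    by simp
  then show ?thesis
    by (simp add: D_def)
qed

lemma iterate_sum_nontangential_limit:
  assumes c: "square_summable c"
  shows "AE \<xi> in circle_measure. has_nontangential_limit (iterate_sum c) \<xi> (boundary_sum c \<xi>)"
  using fatou_nontangential_limit[OF boundary_sum_integrable(1)[OF c]]
proof eventually_elim
  case (elim \<xi>)
  then show ?case
    by (subst (asm) has_nontangential_limit_cong[where h="iterate_sum c"]) (auto simp: iterate_sum_eq_integral[OF c])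
qed

lemma bmo_integral_iterate_sum:
  assumes c: "square_summable c" and z: "cmod z < 1"
  shows "bmo_integral (iterate_sum c) z = energy c z"
proof -
  have "energy c z = (\<integral>\<^sup>+\<xi>. ennreal (poisson_kernel z \<xi>) * ennreal ((cmod (boundary_sum c \<xi> - iterate_sum c z))\<^sup>2) \<partial>circle_measure)"
    unfolding energy_def by (rule nn_integral_harm) measurable
  also have "\<dots> = bmo_integral (iterate_sum c) z"
    unfolding bmo_integral_def
  proof (rule nn_integral_cong_AE)
    show "AE \<xi> in circle_measure. ennreal (poisson_kernel z \<xi>) * ennreal ((cmod (boundary_sum c \<xi> - iterate_sum c z))\<^sup>2) =
        ennreal ((cmod (boundary_value (iterate_sum c) \<xi> - iterate_sum c z))\<^sup>2 * poisson_kernel z \<xi>)"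
      using iterate_sum_nontangential_limit[OF c] AE_space[of circle_measure]
    proof eventually_elim
      case (elim \<xi>)
      then have "boundary_value (iterate_sum c) \<xi> = boundary_sum c \<xi>"
        by (intro boundary_value_eq) auto
      then show ?case
        using poisson_kernel_nonneg[OF z, of \<xi>] by (simp add: ennreal_mult' mult.commute)
    qed
  qed
  finally show ?thesis by simp
qed

section \<open>Bounds in BMOA and in the Hardy space\<close>

lemma SUP_bmo_integral_le:
  assumes c: "square_summable c"
  shows "(SUP z\<in>ball 0 1. bmo_integral (iterate_sum c) z) \<le> ennreal (4 / \<kappa> * l2_norm_sq c)"
proof (rule SUP_least)
  fix z :: complex assume "z \<in> ball 0 1"
  then have z: "cmod z < 1" by simp
  show "bmo_integral (iterate_sum c) z \<le> ennreal (4 / \<kappa> * l2_norm_sq c)"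
    unfolding bmo_integral_iterate_sum[OF c z] by (rule energy_le[OF c z])
qed

lemma iterate_sum_BMOA:
  assumes c: "square_summable c"
  shows "iterate_sum c \<in> BMOA"
proof -
  have "AE \<xi> in circle_measure. \<exists>l. has_nontangential_limit (iterate_sum c) \<xi> l"
    using iterate_sum_nontangential_limit[OF c] by eventually_elim blast
  moreover have "(SUP z\<in>ball 0 1. bmo_integral (iterate_sum c) z) < \<infinity>"
    using le_less_trans[OF SUP_bmo_integral_le[OF c]] by simp
  ultimately show ?thesis
    unfolding BMOA_def using iterate_sum_holomorphic[OF c] by blast
qed

lemma hardy2_norm_sq_iterate_sum_le:
  assumes c: "square_summable c"
  shows "hardy2_norm_sq (iterate_sum c) \<le> ennreal (4 / \<kappa> * l2_norm_sq c)"
  unfolding hardy2_norm_sq_def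
proof (rule SUP_least)
  fix r :: real assume "r \<in> {0<..<1}"
  then have r: "0 \<le> r" "r < 1" by auto
  have um: "(\<lambda>\<eta>. ennreal ((cmod (boundary_sum c \<eta>))\<^sup>2)) \<in> borel_measurable circle_measure"
    by measurable
  have "(\<integral>\<^sup>+\<xi>. ennreal ((cmod (iterate_sum c (of_real r * \<xi>)))\<^sup>2) \<partial>circle_measure)
      \<le> (\<integral>\<^sup>+\<xi>. (\<integral>\<^sup>+\<eta>. ennreal ((cmod (boundary_sum c \<eta>))\<^sup>2) \<partial>harm (of_real r * \<xi>)) \<partial>circle_measure)"
  proof (rule nn_integral_mono)
    fix \<xi> assume "\<xi> \<in> space circle_measure"
    then have z: "cmod (of_real r * \<xi>) < 1"
      using r by (simp add: norm_mult)
    interpret hz: prob_space "harm (of_real r * \<xi>)"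
      by (rule prob_space_harm[OF z])
    show "ennreal ((cmod (iterate_sum c (of_real r * \<xi>)))\<^sup>2) \<le> (\<integral>\<^sup>+\<eta>. ennreal ((cmod (boundary_sum c \<eta>))\<^sup>2) \<partial>harm (of_real r * \<xi>))"
      unfolding iterate_sum_eq_integral[OF c z, symmetric] by (rule hz.nn_integral_jensen_square) measurable
  qed
  also have "\<dots> = (\<integral>\<^sup>+\<eta>. ennreal ((cmod (boundary_sum c \<eta>))\<^sup>2) \<partial>circle_measure)"
    by (rule nn_integral_harm_mean[OF um r])
  also have "\<dots> \<le> ennreal (4 / \<kappa> * l2_norm_sq c)"
    by (rule nn_integral_boundary_sum_sq_le[OF c])
  finally show "(\<integral>\<^sup>+\<xi>. ennreal ((cmod (iterate_sum c (of_real r * \<xi>)))\<^sup>2) \<partial>circle_measure) \<le> ennreal (4 / \<kappa> * l2_norm_sq c)" .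
qed

text \<open>The recursion reads c (n + 1) = b (n + 1) - cnj \<alpha> b n, so each |b n|^2 is charged
  twice, each time with factor 2. The term 2 |b N|^2 reserves the second charge of the last index
  for the next step.\<close>

lemma sum_le_bseq_sum:
  "(\<Sum>n<Suc N. (cmod (c n))\<^sup>2) + 2 * (cmod (bseq c N))\<^sup>2 \<le> 4 * (\<Sum>n<Suc N. (cmod (bseq c n))\<^sup>2)"
proof (induction N)
  case (Suc N)
  have "c (Suc N) = bseq c (Suc N) + (- (cnj \<alpha> * bseq c N))"
    by simp
  then have "(cmod (c (Suc N)))\<^sup>2 \<le> 2 * (cmod (bseq c (Suc N)))\<^sup>2 + 2 * (cmod (- (cnj \<alpha> * bseq c N)))\<^sup>2"
    using two_square_bound[of "bseq c (Suc N)" "- (cnj \<alpha> * bseq c N)"] by (simp only:)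
  moreover have "(cmod (- (cnj \<alpha> * bseq c N)))\<^sup>2 \<le> (cmod (bseq c N))\<^sup>2"
    unfolding norm_minus_cancel norm_mult complex_mod_cnj using \<alpha>_less
    by (intro power_mono mult_left_le_one_le) auto
  ultimately show ?case
  proof -
    have aux: "S + x + 2 * b' \<le> 4 * (B + b')" if "x \<le> 2 * b' + 2 * m" "m \<le> b" "S + 2 * b \<le> 4 * B" for S x b' m b B :: real
      using that by simp
    assume "(cmod (c (Suc N)))\<^sup>2 \<le> 2 * (cmod (bseq c (Suc N)))\<^sup>2 + 2 * (cmod (- (cnj \<alpha> * bseq c N)))\<^sup>2"
      "(cmod (- (cnj \<alpha> * bseq c N)))\<^sup>2 \<le> (cmod (bseq c N))\<^sup>2"
    from aux[OF this Suc.IH] show ?thesis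
      unfolding sum.lessThan_Suc[of _ "Suc N"] .
  qed
qed simp

text \<open>The martingale sum is \<open>boundary_sum c\<close> minus a remainder minus the leftover
  term of the summation by parts, and the last two vanish in L2 as N grows. The 12 is 3 from
  \<open>three_square_bound\<close> times 4 from \<open>sum_le_bseq_sum\<close>.\<close>

lemma l2_norm_sq_le_boundary_sum:
  assumes c: "square_summable c"
  shows "(1 - cmod \<alpha>)\<^sup>2 / 12 * l2_norm_sq c \<le> (\<integral>\<xi>. (cmod (boundary_sum c \<xi>))\<^sup>2 \<partial>circle_measure)"
proof -
  define A where "A = (\<integral>\<xi>. (cmod (boundary_sum c \<xi>))\<^sup>2 \<partial>circle_measure)"
  define s where "s = (1 - cmod \<alpha>)\<^sup>2"
  have s: "0 \<le> s"
    by (simp add: s_def)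
  have le: "s * (\<Sum>n<Suc N. (cmod (c n))\<^sup>2) / 4 \<le> 3 * A + 3 * (4 / \<kappa> * l2_norm_sq (tl_seq (Suc N) c)) + 3 * (cmod (bseq c N))\<^sup>2" for N
  proof -
    let ?t = "tl_seq (Suc N) c"
    note c' = summable_tl_seq[OF c, of "Suc N"]
    have tail: "(\<integral>\<xi>. (cmod (boundary_sum ?t \<xi>))\<^sup>2 \<partial>circle_measure) \<le> 4 / \<kappa> * l2_norm_sq ?t"
      using nn_integral_boundary_sum_sq_le[OF c'] \<kappa> l2_norm_sq_nonneg[OF c'] boundary_sum_integrable(2)[OF c']
      by (subst (asm) nn_integral_eq_integral) auto
    have "s * (\<Sum>n<Suc N. (cmod (c n))\<^sup>2) / 4 \<le> s * (\<Sum>n<Suc N. (cmod (bseq c n))\<^sup>2)"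
    proof -
      have "(\<Sum>n<Suc N. (cmod (c n))\<^sup>2) \<le> 4 * (\<Sum>n<Suc N. (cmod (bseq c n))\<^sup>2)"
        using sum_le_bseq_sum[where N=N and c=c] zero_le_power2[of "cmod (bseq c N)"] by linarith
      from mult_left_mono[OF this s] show ?thesis
        by linarith
    qed
    also have "\<dots> \<le> (\<integral>\<xi>. (cmod (rm.S (bseq c) (Suc N) \<xi>))\<^sup>2 \<partial>circle_measure)"
      unfolding rm.integral_S_sq s_def mult.commute[of "(1 - cmod \<alpha>)\<^sup>2"]
      by (intro mult_left_mono integral_X_sq_ge sum_nonneg) auto
    also have "\<dots> \<le> (\<integral>\<xi>. 3 * (cmod (boundary_sum c \<xi>))\<^sup>2 + 3 * (cmod (boundary_sum ?t \<xi>))\<^sup>2 + 3 * (cmod (bseq c N))\<^sup>2 \<partial>circle_measure)"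
    proof (rule integral_mono_AE)
      show "integrable circle_measure (\<lambda>\<xi>. 3 * (cmod (boundary_sum c \<xi>))\<^sup>2 + 3 * (cmod (boundary_sum ?t \<xi>))\<^sup>2 + 3 * (cmod (bseq c N))\<^sup>2)"
        using boundary_sum_integrable(2)[OF c] boundary_sum_integrable(2)[OF c'] by simp
      show "AE \<xi> in circle_measure. (cmod (rm.S (bseq c) (Suc N) \<xi>))\<^sup>2 \<le>
          3 * (cmod (boundary_sum c \<xi>))\<^sup>2 + 3 * (cmod (boundary_sum ?t \<xi>))\<^sup>2 + 3 * (cmod (bseq c N))\<^sup>2"
        using boundary_sum_tl_seq[OF c, of "Suc N"] AE_space[of circle_measure]
      proof eventually_elim
        case (elim \<xi>)
        have "rm.S (bseq c) (Suc N) \<xi> = boundary_sum c \<xi> + (- boundary_sum ?t \<xi>) + (- (cnj \<alpha> * bseq c N * (T ^^ Suc N) \<xi>))"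
          unfolding elim(1) sum_eq_rm_S by simp
        then have "(cmod (rm.S (bseq c) (Suc N) \<xi>))\<^sup>2 \<le> 3 * (cmod (boundary_sum c \<xi>))\<^sup>2 + 3 * (cmod (- boundary_sum ?t \<xi>))\<^sup>2
            + 3 * (cmod (- (cnj \<alpha> * bseq c N * (T ^^ Suc N) \<xi>)))\<^sup>2"
          using three_square_bound by (simp only:)
        moreover have "(cmod (- (cnj \<alpha> * bseq c N * (T ^^ Suc N) \<xi>)))\<^sup>2 \<le> (cmod (bseq c N))\<^sup>2"
          unfolding norm_minus_cancel norm_mult complex_mod_cnj using \<alpha>_less T_pow_norm[of \<xi> "Suc N"] elim(2)
          by (intro power_mono) (auto intro: mult_left_le_one_le)
        ultimately show ?case
          unfolding norm_minus_cancel by linarith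
      qed
    qed simp
    also have "\<dots> = 3 * A + 3 * (\<integral>\<xi>. (cmod (boundary_sum ?t \<xi>))\<^sup>2 \<partial>circle_measure) + 3 * (cmod (bseq c N))\<^sup>2"
      using boundary_sum_integrable(2)[OF c] boundary_sum_integrable(2)[OF c'] circle.prob_space by (simp add: A_def)
    also have "\<dots> \<le> 3 * A + 3 * (4 / \<kappa> * l2_norm_sq ?t) + 3 * (cmod (bseq c N))\<^sup>2"
      using tail by simp
    finally show ?thesis .
  qed
  have l1: "(\<lambda>N. s * (\<Sum>n<Suc N. (cmod (c n))\<^sup>2) / 4) \<longlonglongrightarrow> s * l2_norm_sq c / 4"
    unfolding l2_norm_sq_def by (intro tendsto_intros LIMSEQ_Suc[OF summable_LIMSEQ[OF c]]) auto
  have l2: "(\<lambda>N. 3 * A + 3 * (4 / \<kappa> * l2_norm_sq (tl_seq (Suc N) c)) + 3 * (cmod (bseq c N))\<^sup>2) \<longlonglongrightarrow> 3 * A + 3 * (4 / \<kappa> * 0) + 3 * 0"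
    by (intro tendsto_intros LIMSEQ_Suc[OF l2_norm_sq_tl_seq_tendsto_0[OF c]] summable_LIMSEQ_zero summable_bseq c)
  have "s * l2_norm_sq c / 4 \<le> 3 * A + 3 * (4 / \<kappa> * 0) + 3 * 0"
    using le by (intro LIMSEQ_le[OF l1 l2]) blast
  then show ?thesis
    by (simp add: A_def s_def)
qed

end

section \<open>Finite Blaschke products and the main theorem\<close>

abbreviation to_circle :: "complex filter" where
  "to_circle \<equiv> filtercomap cmod (at_left 1)"

lemma eventually_to_circle_less: "\<forall>\<^sub>F z in to_circle. cmod z < 1"
proof -
  have "\<forall>\<^sub>F r in at_left (1::real). r < 1"
    by (simp add: eventually_at_filter)
  then show ?thesis
    by (rule eventually_filtercomapI)
qed

lemma tendsto_cmod_to_circle: "((\<lambda>z. cmod z) \<longlongrightarrow> 1) to_circle"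
proof -
  have "filterlim cmod (at_left 1) to_circle"
    by (rule filterlim_filtercomap)
  then show ?thesis
    by (simp add: filterlim_at)
qed

lemma cmod_blaschke_factor_sq:
  assumes p: "cmod p < 1" and z: "cmod z < 1"
  shows "1 - (cmod ((z - p) / (1 - cnj p * z)))\<^sup>2 = (1 - (cmod p)\<^sup>2) * (1 - (cmod z)\<^sup>2) / (cmod (1 - cnj p * z))\<^sup>2"
    and "1 - cmod p \<le> cmod (1 - cnj p * z)"
proof -
  have "cmod (cnj p * z) \<le> cmod p"
    using z unfolding norm_mult complex_mod_cnj by (intro mult_left_le) auto
  then show lower: "1 - cmod p \<le> cmod (1 - cnj p * z)"
    using norm_triangle_ineq2[of 1 "cnj p * z"] by simp
  then have ne: "cmod (1 - cnj p * z) \<noteq> 0"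
    using p by auto
  have "(cmod (1 - cnj p * z))\<^sup>2 - (cmod (z - p))\<^sup>2 = (1 - (cmod p)\<^sup>2) * (1 - (cmod z)\<^sup>2)"
    unfolding cmod_power2 by (simp add: power2_eq_square algebra_simps)
  moreover have "1 - (cmod ((z - p) / (1 - cnj p * z)))\<^sup>2 = ((cmod (1 - cnj p * z))\<^sup>2 - (cmod (z - p))\<^sup>2) / (cmod (1 - cnj p * z))\<^sup>2"
    unfolding norm_divide power_divide using ne by (simp add: diff_divide_distrib[of "(cmod (1 - cnj p * z))\<^sup>2"])
  ultimately show "1 - (cmod ((z - p) / (1 - cnj p * z)))\<^sup>2 = (1 - (cmod p)\<^sup>2) * (1 - (cmod z)\<^sup>2) / (cmod (1 - cnj p * z))\<^sup>2"
    by simp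
qed

lemma blaschke_factor_to_circle:
  assumes p: "cmod p < 1"
  shows "((\<lambda>z. cmod ((z - p) / (1 - cnj p * z))) \<longlongrightarrow> 1) to_circle"
proof -
  let ?b = "\<lambda>z. (z - p) / (1 - cnj p * z)"
  have "((\<lambda>z. 1 - (cmod (?b z))\<^sup>2) \<longlongrightarrow> 0) to_circle"
  proof (rule tendsto_sandwich)
    show "\<forall>\<^sub>F z in to_circle. 0 \<le> 1 - (cmod (?b z))\<^sup>2"
      using eventually_to_circle_less
    proof eventually_elim
      case (elim z)
      show ?case
        unfolding cmod_blaschke_factor_sq(1)[OF p elim] using p elim by (simp add: abs_square_le_1)
    qed
    show "\<forall>\<^sub>F z in to_circle. 1 - (cmod (?b z))\<^sup>2 \<le> (1 - (cmod z)\<^sup>2) / (1 - cmod p)\<^sup>2"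
      using eventually_to_circle_less
    proof eventually_elim
      case (elim z)
      have "(1 - (cmod p)\<^sup>2) * (1 - (cmod z)\<^sup>2) \<le> 1 * (1 - (cmod z)\<^sup>2)"
        using elim by (intro mult_right_mono) (auto simp: abs_square_le_1)
      then show ?case
        unfolding cmod_blaschke_factor_sq(1)[OF p elim] using p elim cmod_blaschke_factor_sq(2)[OF p elim]
        by (intro frac_le power_mono) (auto simp: abs_square_le_1)
    qed
    have "((\<lambda>z. (1 - (cmod z)\<^sup>2) / (1 - cmod p)\<^sup>2) \<longlongrightarrow> (1 - 1\<^sup>2) / (1 - cmod p)\<^sup>2) to_circle"
      using p by (intro tendsto_intros tendsto_cmod_to_circle) auto
    then show "((\<lambda>z. (1 - (cmod z)\<^sup>2) / (1 - cmod p)\<^sup>2) \<longlongrightarrow> 0) to_circle"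
      by simp
  qed simp
  then have "((\<lambda>z. sqrt (1 - (1 - (cmod (?b z))\<^sup>2))) \<longlongrightarrow> sqrt (1 - 0)) to_circle"
    by (intro tendsto_intros)
  then show ?thesis
    by simp
qed

lemma finite_blaschke_product_to_circle:
  assumes "finite_blaschke_product f"
  shows "((\<lambda>z. cmod (f z)) \<longlongrightarrow> 1) to_circle"
proof -
  obtain c ps where c: "cmod c = 1" and ps: "set ps \<subseteq> ball 0 1"
    and f: "\<And>z. z \<in> ball 0 1 \<Longrightarrow> f z = c * (\<Prod>p\<leftarrow>ps. (z - p) / (1 - cnj p * z))"
    using assms unfolding finite_blaschke_product_def by blast
  have "((\<lambda>z. cmod (\<Prod>p\<leftarrow>ps. (z - p) / (1 - cnj p * z))) \<longlongrightarrow> 1) to_circle"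
    using ps
  proof (induction ps)
    case (Cons p ps)
    have "((\<lambda>z. cmod ((z - p) / (1 - cnj p * z)) * cmod (\<Prod>p\<leftarrow>ps. (z - p) / (1 - cnj p * z))) \<longlongrightarrow> 1 * 1) to_circle"
      using Cons by (intro tendsto_mult blaschke_factor_to_circle) auto
    then show ?case
      unfolding list.map prod_list.Cons norm_mult mult_1_left .
  qed simp
  moreover have "\<forall>\<^sub>F z in to_circle. cmod (\<Prod>p\<leftarrow>ps. (z - p) / (1 - cnj p * z)) = cmod (f z)"
    using eventually_to_circle_less by eventually_elim (simp add: f norm_mult c)
  ultimately show ?thesis
    by (rule Lim_transform_eventually)
qed

context inner_iterates
begin

text \<open>The hypothesis together with |f z| < 1 says that \<open>f\<close> maps the filter
  \<open>to_circle\<close> to itself, a property that is preserved by composition.\<close>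

lemma iter_to_circle:
  assumes "((\<lambda>z. cmod (f z)) \<longlongrightarrow> 1) to_circle"
  shows "((\<lambda>z. cmod ((f ^^ n) z)) \<longlongrightarrow> 1) to_circle"
proof -
  have "filterlim (\<lambda>z. cmod (f z)) (at_left 1) to_circle"
    unfolding filterlim_at using assms eventually_to_circle_less
    by (auto elim!: eventually_mono dest: f_less)
  then have f: "filterlim f to_circle to_circle"
    by (simp add: filterlim_filtercomap_iff o_def)
  have "filterlim (f ^^ n) to_circle to_circle"
  proof (induction n)
    case (Suc n)
    then show ?case
      using filterlim_compose[OF f Suc] by (simp add: o_def)
  qed (simp add: id_def filterlim_ident)
  then show ?thesis
    using filterlim_compose[OF tendsto_cmod_to_circle] by blast
qed

text \<open>The head of the series is measured by finitely many covariances at z; the remainder has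
  a bound independent of z.\<close>

lemma energy_split:
  assumes c: "square_summable c" and z: "cmod z < 1"
  shows "energy c z \<le> ennreal (2 * (\<Sum>n<N. \<Sum>m<N. cmod (c n) * cmod (c m) * cmod (covar z n m)) + 2 * (4 / \<kappa> * l2_norm_sq (tl_seq N c)))"
proof -
  let ?t = "tl_seq N c"
  let ?h = "\<lambda>\<xi>. (cmod (\<Sum>n<N. c n * ((T ^^ n) \<xi> - (f ^^ n) z)))\<^sup>2"
  note c' = summable_tl_seq[OF c, of N]
  have hm: "(\<lambda>\<xi>. ennreal (?h \<xi>)) \<in> borel_measurable (harm z)"
    by measurable
  have tm: "(\<lambda>\<xi>. ennreal ((cmod (boundary_sum ?t \<xi> - iterate_sum ?t z))\<^sup>2)) \<in> borel_measurable (harm z)"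
    by measurable
  have "energy c z \<le> (\<integral>\<^sup>+\<xi>. 2 * ennreal (?h \<xi>) + 2 * ennreal ((cmod (boundary_sum ?t \<xi> - iterate_sum ?t z))\<^sup>2) \<partial>harm z)"
    unfolding energy_def
  proof (rule nn_integral_mono_AE)
    show "AE \<xi> in harm z. ennreal ((cmod (boundary_sum c \<xi> - iterate_sum c z))\<^sup>2) \<le> 2 * ennreal (?h \<xi>) + 2 * ennreal ((cmod (boundary_sum ?t \<xi> - iterate_sum ?t z))\<^sup>2)"
      using AE_harm[OF boundary_sum_tl_seq[OF c, of N]]
    proof eventually_elim
      case (elim \<xi>)
      have "boundary_sum c \<xi> - iterate_sum c z = (\<Sum>n<N. c n * ((T ^^ n) \<xi> - (f ^^ n) z)) + (boundary_sum ?t \<xi> - iterate_sum ?t z)"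
        unfolding elim iterate_sum_tl_seq[OF c z] right_diff_distrib sum_subtractf by simp
      then have "(cmod (boundary_sum c \<xi> - iterate_sum c z))\<^sup>2 \<le> 2 * ?h \<xi> + 2 * (cmod (boundary_sum ?t \<xi> - iterate_sum ?t z))\<^sup>2"
        using two_square_bound by (simp only:)
      then have "ennreal ((cmod (boundary_sum c \<xi> - iterate_sum c z))\<^sup>2) \<le> ennreal (2 * ?h \<xi> + 2 * (cmod (boundary_sum ?t \<xi> - iterate_sum ?t z))\<^sup>2)"
        by (rule ennreal_leI)
      also have "\<dots> = 2 * ennreal (?h \<xi>) + 2 * ennreal ((cmod (boundary_sum ?t \<xi> - iterate_sum ?t z))\<^sup>2)"
        by (simp add: ennreal_plus ennreal_mult)
      finally show ?case .
    qed
  qed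
  also have "\<dots> = 2 * (\<integral>\<^sup>+\<xi>. ennreal (?h \<xi>) \<partial>harm z) + 2 * energy ?t z"
    unfolding energy_def using hm tm by (simp add: nn_integral_add nn_integral_cmult)
  also have "\<dots> \<le> 2 * ennreal (\<Sum>n<N. \<Sum>m<N. cmod (c n) * cmod (c m) * cmod (covar z n m)) + 2 * ennreal (4 / \<kappa> * l2_norm_sq ?t)"
  proof (intro add_mono mult_left_mono energy_le c' z)
    have "(\<integral>\<^sup>+\<xi>. ennreal (?h \<xi>) \<partial>harm z) = ennreal (\<integral>\<xi>. ?h \<xi> \<partial>harm z)"
      by (intro nn_integral_eq_integral integral_sum_sq z) auto
    also have "\<dots> \<le> ennreal (\<Sum>n<N. \<Sum>m<N. cmod (c n) * cmod (c m) * cmod (covar z n m))"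
      by (intro ennreal_leI integral_sum_sq z)
    finally show "(\<integral>\<^sup>+\<xi>. ennreal (?h \<xi>) \<partial>harm z) \<le> \<dots>" .
  qed auto
  also have "\<dots> = ennreal (2 * (\<Sum>n<N. \<Sum>m<N. cmod (c n) * cmod (c m) * cmod (covar z n m)) + 2 * (4 / \<kappa> * l2_norm_sq ?t))"
    using \<kappa> l2_norm_sq_nonneg[OF c'] by (simp add: ennreal_plus ennreal_mult sum_nonneg del: times_divide_eq_left)
  finally show ?thesis .
qed

lemma covar_to_circle:
  assumes f: "((\<lambda>z. cmod (f z)) \<longlongrightarrow> 1) to_circle"
  shows "((\<lambda>z. cmod (covar z n m)) \<longlongrightarrow> 0) to_circle"
proof -
  define k where "k = min n m"
  show ?thesis
  proof (rule tendsto_sandwich[where f="\<lambda>_. 0" and h="\<lambda>z. 1 - (cmod ((f ^^ k) z))\<^sup>2"])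
  show "\<forall>\<^sub>F z in to_circle. cmod (covar z n m) \<le> 1 - (cmod ((f ^^ k) z))\<^sup>2"
    using eventually_to_circle_less
  proof eventually_elim
    case (elim z)
    show ?case
      using covar_le(1)[OF elim, of n m] covar_le(1)[OF elim, of m n] covar_cnj[of z n m]
      by (cases "n \<le> m") (simp_all add: k_def min_def)
  qed
  show "((\<lambda>z. 1 - (cmod ((f ^^ k) z))\<^sup>2) \<longlongrightarrow> 0) to_circle"
    by (rule tendsto_eq_intros refl iter_to_circle[OF f] | simp)+
  qed auto
qed

text \<open>The length N of the head is fixed first, using the remainder bound that is uniform in z;
  afterwards the finitely many covariances of the head tend to 0.\<close>

lemma iterate_sum_VMOA:
  assumes f: "((\<lambda>z. cmod (f z)) \<longlongrightarrow> 1) to_circle" and c: "square_summable c"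
  shows "iterate_sum c \<in> VMOA"
proof -
  have "(bmo_integral (iterate_sum c) \<longlongrightarrow> 0) to_circle"
  proof (rule order_tendstoI)
    fix a :: ennreal assume "0 < a"
    \<comment> \<open>\<open>a\<close> may be \<infinity>; a smaller positive \<open>b\<close> is
      finite and so yields a real tolerance.\<close>
    then obtain b where b: "0 < b" "b < a"
      using dense by blast
    then have "b < \<top>"
      using less_le_trans[OF b(2) top_greatest] by simp
    define e where "e = enn2real b"
    have e: "0 < e" "ennreal e < a"
      using b \<open>b < \<top>\<close> by (auto simp: e_def enn2real_positive_iff)
    have "(\<lambda>N. 2 * (4 / \<kappa> * l2_norm_sq (tl_seq N c))) \<longlonglongrightarrow> 2 * (4 / \<kappa> * 0)"
      by (intro tendsto_intros l2_norm_sq_tl_seq_tendsto_0 c)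
    then have "\<forall>\<^sub>F N in sequentially. 2 * (4 / \<kappa> * l2_norm_sq (tl_seq N c)) < e / 2"
      using e by (intro order_tendstoD) auto
    then obtain N where N: "2 * (4 / \<kappa> * l2_norm_sq (tl_seq N c)) < e / 2"
      by (auto simp: eventually_sequentially)
    have "((\<lambda>z. 2 * (\<Sum>n<N. \<Sum>m<N. cmod (c n) * cmod (c m) * cmod (covar z n m))) \<longlongrightarrow> 2 * (\<Sum>n<N. \<Sum>m<N. cmod (c n) * cmod (c m) * 0)) to_circle"
      by (intro tendsto_intros covar_to_circle f)
    then have "\<forall>\<^sub>F z in to_circle. 2 * (\<Sum>n<N. \<Sum>m<N. cmod (c n) * cmod (c m) * cmod (covar z n m)) < e / 2"
      using e by (intro order_tendstoD) auto
    then show "\<forall>\<^sub>F z in to_circle. bmo_integral (iterate_sum c) z < a"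
      using eventually_to_circle_less
    proof eventually_elim
      case (elim z)
      have "bmo_integral (iterate_sum c) z = energy c z"
        by (rule bmo_integral_iterate_sum[OF c elim(2)])
      also have "\<dots> \<le> ennreal (2 * (\<Sum>n<N. \<Sum>m<N. cmod (c n) * cmod (c m) * cmod (covar z n m)) + 2 * (4 / \<kappa> * l2_norm_sq (tl_seq N c)))"
        by (rule energy_split[OF c elim(2)])
      also have "\<dots> \<le> ennreal e"
        using elim(1) N by (intro ennreal_leI) simp
      also have "\<dots> < a"
        by (rule e)
      finally show ?case .
    qed
  qed simp
  then show ?thesis
    using iterate_sum_BMOA[OF c] by (simp add: VMOA_def)
qed

lemma bmoa_norm_iterate_sum_le:
  assumes c: "square_summable c"
  shows "(bmoa_norm (iterate_sum c))\<^sup>2 \<le> 4 / \<kappa> * l2_norm_sq c"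
proof -
  have "enn2real (SUP z\<in>ball 0 1. bmo_integral (iterate_sum c) z) \<le> 4 / \<kappa> * l2_norm_sq c"
    by (rule enn2real_leI[OF _ SUP_bmo_integral_le[OF c]]) (use \<kappa> l2_norm_sq_nonneg[OF c] in simp)
  then show ?thesis
    unfolding bmoa_norm_def by (subst real_sqrt_pow2) auto
qed

text \<open>The origin alone suffices: as \<open>iterate_sum c 0 = 0\<close>, the integral there is
  the squared L2 norm of \<open>boundary_sum c\<close>.\<close>

lemma bmoa_norm_iterate_sum_ge:
  assumes c: "square_summable c"
  shows "(1 - cmod \<alpha>)\<^sup>2 / 12 * l2_norm_sq c \<le> (bmoa_norm (iterate_sum c))\<^sup>2"
proof -
  have "(1 - cmod \<alpha>)\<^sup>2 / 12 * l2_norm_sq c \<le> (\<integral>\<xi>. (cmod (boundary_sum c \<xi>))\<^sup>2 \<partial>circle_measure)"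
    by (rule l2_norm_sq_le_boundary_sum[OF c])
  also have "\<dots> = enn2real (energy c 0)"
    using boundary_sum_integrable(2)[OF c] unfolding energy_def by (simp add: iterate_sum_0 harm_0 nn_integral_eq_integral)
  also have "\<dots> \<le> enn2real (SUP z\<in>ball 0 1. bmo_integral (iterate_sum c) z)"
  proof (rule enn2real_mono)
    have "bmo_integral (iterate_sum c) 0 \<le> (SUP z\<in>ball 0 1. bmo_integral (iterate_sum c) z)"
      by (rule SUP_upper) simp
    then show "energy c 0 \<le> (SUP z\<in>ball 0 1. bmo_integral (iterate_sum c) z)"
      by (simp add: bmo_integral_iterate_sum[OF c])
    show "(SUP z\<in>ball 0 1. bmo_integral (iterate_sum c) z) < \<top>"
      using le_less_trans[OF SUP_bmo_integral_le[OF c]] by simp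
  qed
  also have "\<dots> = (bmoa_norm (iterate_sum c))\<^sup>2"
    by (simp add: bmoa_norm_def)
  finally show ?thesis .
qed

end

section \<open>Passage to series that start with the first iterate\<close>

lemma hardy2_norm_sq_cong:
  assumes "\<And>z. cmod z < 1 \<Longrightarrow> g z = h z"
  shows "hardy2_norm_sq g = hardy2_norm_sq h"
  unfolding hardy2_norm_sq_def
proof (intro SUP_cong refl nn_integral_cong)
  fix r :: real and \<xi> :: complex assume "r \<in> {0<..<1}" "\<xi> \<in> space circle_measure"
  then have "cmod (of_real r * \<xi>) < 1"
    by (simp add: norm_mult)
  then show "ennreal ((cmod (g (of_real r * \<xi>)))\<^sup>2) = ennreal ((cmod (h (of_real r * \<xi>)))\<^sup>2)"
    by (simp add: assms)
qed

context inner_iterates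
begin

lemma iterate_term_hardy2: "iterate_term f a n \<in> hardy2"
proof -
  have "(\<lambda>z. a (Suc n) * (f ^^ Suc n) z) holomorphic_on ball 0 1"
    by (intro holomorphic_intros iter_holomorphic)
  then have "iterate_term f a n holomorphic_on ball 0 1"
    by (simp add: iterate_term_def[abs_def])
  moreover have le: "hardy2_norm_sq (iterate_term f a n) \<le> ennreal ((cmod (a (Suc n)))\<^sup>2)"
    unfolding hardy2_norm_sq_def
  proof (rule SUP_least)
    fix r :: real assume r: "r \<in> {0<..<1}"
    have "(\<integral>\<^sup>+\<xi>. ennreal ((cmod (iterate_term f a n (of_real r * \<xi>)))\<^sup>2) \<partial>circle_measure) \<le> (\<integral>\<^sup>+\<xi>. ennreal ((cmod (a (Suc n)))\<^sup>2) \<partial>circle_measure)"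
    proof (intro nn_integral_mono ennreal_leI power_mono)
      fix \<xi> assume "\<xi> \<in> space circle_measure"
      then have z: "cmod (of_real r * \<xi>) < 1"
        using r by (simp add: norm_mult)
      show "cmod (iterate_term f a n (of_real r * \<xi>)) \<le> cmod (a (Suc n))"
        unfolding iterate_term_def norm_mult[of "a (Suc n)"] using iter_less[OF z, of "Suc n"] by (intro mult_left_le) auto
    qed auto
    then show "(\<integral>\<^sup>+\<xi>. ennreal ((cmod (iterate_term f a n (of_real r * \<xi>)))\<^sup>2) \<partial>circle_measure) \<le> ennreal ((cmod (a (Suc n)))\<^sup>2)"
      using circle.emeasure_space_1 by simp
  qed
  moreover have "hardy2_norm_sq (iterate_term f a n) < \<infinity>"
    using le_less_trans[OF le ennreal_less_top] by simp
  ultimately show ?thesis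
    by (simp add: hardy2_def)
qed

text \<open>An equality of total functions: at every z, inside the disc or not, both series have the
  same sums or none, so \<open>suminf\<close> picks the same value.\<close>

lemma iterate_series_eq_iterate_sum: "iterate_series f a = iterate_sum (a(0 := 0))"
proof
  fix z
  have "(\<lambda>n. (a(0 := 0)) (Suc n) * (f ^^ Suc n) z) sums s \<longleftrightarrow> (\<lambda>n. (a(0 := 0)) n * (f ^^ n) z) sums s" for s
    using sums_Suc_iff[of "\<lambda>n. (a(0 := 0)) n * (f ^^ n) z" s] by simp
  then have "(sums) (\<lambda>n. iterate_term f a n z) = (sums) (\<lambda>n. (a(0 := 0)) n * (f ^^ n) z)"
    by (intro ext) (simp add: iterate_term_def)
  then show "iterate_series f a z = iterate_sum (a(0 := 0)) z"
    unfolding iterate_series_def iterate_sum_def suminf_def by (simp only:)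
qed

lemma iterate_series_main:
  assumes a: "summable (\<lambda>n. (cmod (a (Suc n)))\<^sup>2)"
  shows "hardy2_sums (iterate_term f a) (iterate_series f a)"
    and "AE \<xi> in circle_measure. \<exists>b s.
           (\<forall>n. has_radial_limit (f ^^ Suc n) \<xi> (b (Suc n))) \<and>
           (\<lambda>n. a (Suc n) * b (Suc n)) sums s \<and>
           has_radial_limit (iterate_series f a) \<xi> s"
    and "summable (\<lambda>n. (cmod ((a(0 := 0)) n))\<^sup>2)"
    and "l2_norm_sq (a(0 := 0)) = (\<Sum>n. (cmod (a (Suc n)))\<^sup>2)"
proof -
  define c where "c = a(0 := 0)"
  have cS: "c (Suc n) = a (Suc n)" "c 0 = 0" for n
    by (simp_all add: c_def)
  have c: "square_summable c"
    using a summable_Suc_iff[of "\<lambda>n. (cmod (c n))\<^sup>2"] by (simp add: cS)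
  then show "summable (\<lambda>n. (cmod ((a(0 := 0)) n))\<^sup>2)"
    unfolding c_def .
  show "l2_norm_sq (a(0 := 0)) = (\<Sum>n. (cmod (a (Suc n)))\<^sup>2)"
    unfolding l2_norm_sq_def c_def[symmetric] using suminf_split_head[OF c] by (simp add: cS)
  have F: "iterate_series f a = iterate_sum c"
    by (simp only: iterate_series_eq_iterate_sum c_def)
  \<comment> \<open>The first N terms, with iterates 1 to N, correspond to the first N + 1
    coefficients of \<open>c\<close>, since \<open>c 0 = 0\<close>; hence
    \<open>Suc N\<close>.\<close>
  have "hardy2_norm_sq (\<lambda>z. iterate_series f a z - (\<Sum>n<N. iterate_term f a n z)) \<le> ennreal (4 / \<kappa> * l2_norm_sq (tl_seq (Suc N) c))" for N
  proof -
    have "hardy2_norm_sq (\<lambda>z. iterate_series f a z - (\<Sum>n<N. iterate_term f a n z)) = hardy2_norm_sq (iterate_sum (tl_seq (Suc N) c))"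
    proof (rule hardy2_norm_sq_cong)
      fix z :: complex assume z: "cmod z < 1"
      have "(\<Sum>n<Suc N. c n * (f ^^ n) z) = (\<Sum>n<N. iterate_term f a n z)"
        unfolding sum.lessThan_Suc_shift by (simp add: cS iterate_term_def)
      then show "iterate_series f a z - (\<Sum>n<N. iterate_term f a n z) = iterate_sum (tl_seq (Suc N) c) z"
        unfolding F iterate_sum_tl_seq[OF c z] by simp
    qed
    then show ?thesis
      using hardy2_norm_sq_iterate_sum_le[OF summable_tl_seq[OF c, of "Suc N"]] by simp
  qed
  moreover have "(\<lambda>N. ennreal (4 / \<kappa> * l2_norm_sq (tl_seq (Suc N) c))) \<longlonglongrightarrow> ennreal (4 / \<kappa> * 0)"
    by (intro tendsto_intros LIMSEQ_Suc[OF l2_norm_sq_tl_seq_tendsto_0[OF c]])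
  ultimately have "(\<lambda>N. hardy2_norm_sq (\<lambda>z. iterate_series f a z - (\<Sum>n<N. iterate_term f a n z))) \<longlonglongrightarrow> 0"
    using tendsto_sandwich[OF always_eventually always_eventually tendsto_const, of 0
        "\<lambda>N. hardy2_norm_sq (\<lambda>z. iterate_series f a z - (\<Sum>n<N. iterate_term f a n z))"
        "\<lambda>N. ennreal (4 / \<kappa> * l2_norm_sq (tl_seq (Suc N) c))" sequentially] by simp
  moreover have "iterate_series f a \<in> hardy2"
    unfolding hardy2_def F using iterate_sum_holomorphic[OF c] le_less_trans[OF hardy2_norm_sq_iterate_sum_le[OF c]] by simp
  ultimately show "hardy2_sums (iterate_term f a) (iterate_series f a)"
    unfolding hardy2_sums_def using iterate_term_hardy2 by blast
  have "AE \<xi> in circle_measure. \<forall>n. has_radial_limit (f ^^ n) \<xi> ((T ^^ n) \<xi>)"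
    unfolding AE_all_countable using iter_radial_limit by blast
  then show "AE \<xi> in circle_measure. \<exists>b s.
           (\<forall>n. has_radial_limit (f ^^ Suc n) \<xi> (b (Suc n))) \<and>
           (\<lambda>n. a (Suc n) * b (Suc n)) sums s \<and>
           has_radial_limit (iterate_series f a) \<xi> s"
    using boundary_sum_sums[OF c] iterate_sum_nontangential_limit[OF c] AE_space[of circle_measure]
  proof eventually_elim
    case (elim \<xi>)
    have "(\<lambda>n. a (Suc n) * (T ^^ Suc n) \<xi>) sums boundary_sum c \<xi>"
      using elim(2) sums_Suc_iff[of "\<lambda>n. c n * (T ^^ n) \<xi>" "boundary_sum c \<xi>"] by (simp add: cS)
    moreover have "has_radial_limit (iterate_series f a) \<xi> (boundary_sum c \<xi>)"
      unfolding F using elim(3,4) by (intro nontangential_imp_radial_limit) auto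
    ultimately show ?case
      using elim(1) by (intro exI[of _ "\<lambda>n. (T ^^ n) \<xi>"] exI[of _ "boundary_sum c \<xi>"]) blast
  qed
qed

end

theorem corollary1p3:
  fixes f :: "complex \<Rightarrow> complex"
  assumes "inner_function f" and "f 0 = 0" and "\<not> is_rotation f"
  shows
    "(\<exists>C::real. C > 0 \<and> (\<forall>a :: nat \<Rightarrow> complex. summable (\<lambda>n. (cmod (a (Suc n)))\<^sup>2) \<longrightarrow>
        hardy2_sums (iterate_term f a) (iterate_series f a) \<and>
        iterate_series f a \<in> BMOA \<and>
        (AE \<xi> in circle_measure. \<exists>b s.
           (\<forall>n. has_radial_limit (f ^^ Suc n) \<xi> (b (Suc n))) \<and>
           (\<lambda>n. a (Suc n) * b (Suc n)) sums s \<and>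
           has_radial_limit (iterate_series f a) \<xi> s) \<and>
        inverse C * (\<Sum>n. (cmod (a (Suc n)))\<^sup>2) \<le> (bmoa_norm (iterate_series f a))\<^sup>2 \<and>
        (bmoa_norm (iterate_series f a))\<^sup>2 \<le> C * (\<Sum>n. (cmod (a (Suc n)))\<^sup>2))) \<and>
     (finite_blaschke_product f \<longrightarrow>
        (\<forall>a :: nat \<Rightarrow> complex. summable (\<lambda>n. (cmod (a (Suc n)))\<^sup>2) \<longrightarrow>
           iterate_series f a \<in> VMOA))"
proof -
  interpret inner_iterates f
    using assms by unfold_locales
  define s where "s = (1 - cmod \<alpha>)\<^sup>2 / 12"
  have s: "0 < s"
    using \<alpha>_less by (simp add: s_def)
  define C where "C = max (4 / \<kappa>) (inverse s)"
  have C: "C > 0" "4 / \<kappa> \<le> C" "inverse C \<le> s"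
  proof -
    show "C > 0" "4 / \<kappa> \<le> C"
      using \<kappa> s by (auto simp: C_def less_max_iff_disj)
    have "inverse C \<le> inverse (inverse s)"
      using s by (intro le_imp_inverse_le) (auto simp: C_def)
    then show "inverse C \<le> s" by simp
  qed
  show ?thesis
  proof (intro conjI exI[of _ C] allI impI C(1))
    fix a :: "nat \<Rightarrow> complex" assume a: "summable (\<lambda>n. (cmod (a (Suc n)))\<^sup>2)"
    note main = iterate_series_main[OF a]
    note c = main(3)
    show "hardy2_sums (iterate_term f a) (iterate_series f a)"
      by (rule main)
    show "iterate_series f a \<in> BMOA"
      unfolding iterate_series_eq_iterate_sum by (rule iterate_sum_BMOA[OF c])
    show "AE \<xi> in circle_measure. \<exists>b s. (\<forall>n. has_radial_limit (f ^^ Suc n) \<xi> (b (Suc n))) \<and>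
           (\<lambda>n. a (Suc n) * b (Suc n)) sums s \<and> has_radial_limit (iterate_series f a) \<xi> s"
      by (rule main)
    have "inverse C * l2_norm_sq (a(0 := 0)) \<le> s * l2_norm_sq (a(0 := 0))"
      by (intro mult_right_mono C l2_norm_sq_nonneg c)
    then show "inverse C * (\<Sum>n. (cmod (a (Suc n)))\<^sup>2) \<le> (bmoa_norm (iterate_series f a))\<^sup>2"
      using bmoa_norm_iterate_sum_ge[OF c] unfolding iterate_series_eq_iterate_sum main(4)[symmetric] s_def by linarith
    have "4 / \<kappa> * l2_norm_sq (a(0 := 0)) \<le> C * l2_norm_sq (a(0 := 0))"
      by (intro mult_right_mono C l2_norm_sq_nonneg c)
    then show "(bmoa_norm (iterate_series f a))\<^sup>2 \<le> C * (\<Sum>n. (cmod (a (Suc n)))\<^sup>2)"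
      using bmoa_norm_iterate_sum_le[OF c] unfolding iterate_series_eq_iterate_sum main(4)[symmetric] by linarith
  next
    fix a :: "nat \<Rightarrow> complex"
    assume "finite_blaschke_product f" and a: "summable (\<lambda>n. (cmod (a (Suc n)))\<^sup>2)"
    then show "iterate_series f a \<in> VMOA"
      unfolding iterate_series_eq_iterate_sum
      by (intro iterate_sum_VMOA finite_blaschke_product_to_circle iterate_series_main(3))
  qed
qed

end
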